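(* Let $d\geq4$ be an integer. Then, for every real $u$ with $-1\leq u<1$, $$\lim_{t\uparrow1}\vartheta\bigl(G(S^{d-1},t)\bigr)\leq\vartheta\bigl(G(S^{d-1},u)\bigr).$$
   Context: $S^{d-1}$ is the unit sphere in $\mathbb R^d$. For $-1\le t<1$, $G(S^{d-1},t)$ is the (infinite) graph whose vertex set is $S^{d-1}$ and in which two points $x,y$ are adjacent when their Euclidean inner product satisfies $x\cdot y=t$. The number $\vartheta$ is de Oliveira Filho's extension of the Lov\'asz theta number to these infinite distance graphs: with $\omega$ the surface measure on $S^{d-1}$, $$\vartheta\bigl(G(S^{d-1},t)\bigr)=\sup\Bigl\{\int_{S^{d-1}}\int_{S^{d-1}}K(x,y)\,d\omega(x)\,d\omega(y)\Bigr\},$$ the supremum being over all continuous symmetric positive semidefinite kernels $K\colon S^{d-1}\times S^{d-1}\to\mathbb R$ (i.e. $(K(x_i,x_j))_{i,j=1}^N$ is a positive semidefinite matrix for every $N$ and all $x_1,\dots,x_N\in S^{d-1}$) such that $\int_{S^{d-1}}K(x,x)\,d\omega(x)=1$ and $K(x,y)=0$ whenever $x\cdot y=t$. The choice of normalisation of $\omega$ only multiplies $\vartheta$ by a positive constant depending on $d$ and does not affect the claim. The limit is the one-sided limit as $t\to1$ with $t<1$. *)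

theory Defs
  imports "HOL-Analysis.Analysis"
begin

text \<open>
  The surface measure on the unit sphere of a Euclidean space, as given by integration in polar
  coordinates: the measure of a Borel set \<open>A\<close> is \<open>DIM('a)\<close> times the Lebesgue measure of the cone
  \<open>{r *\<^sub>R a | a r. a \<in> A \<and> 0 < r \<and> r < 1}\<close>. Recall that \<open>sgn x = x /\<^sub>R norm x\<close>.
\<close>

definition surface_measure :: "'a::euclidean_space measure" where
  "surface_measure =
     scale_measure (of_nat DIM('a))
       (distr (restrict_space lborel (ball 0 1 - {0})) (restrict_space borel (sphere 0 1)) sgn)"

lemma sgn_measurable_sphere:
  "sgn \<in> restrict_space lborel (ball (0::'a::euclidean_space) 1 - {0})
           \<rightarrow>\<^sub>M restrict_space borel (sphere 0 1)"
proof (rule measurable_restrict_space2)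
  show "sgn \<in> space (restrict_space lborel (ball (0::'a) 1 - {0})) \<rightarrow> sphere 0 1"
    by (auto simp: space_restrict_space norm_sgn)
  have "sgn \<in> borel_measurable (borel :: 'a measure)"
    unfolding sgn_div_norm by measurable
  then show "sgn \<in> borel_measurable (restrict_space lborel (ball (0::'a) 1 - {0}))"
    by (intro measurable_restrict_space1) simp
qed

lemma emeasure_surface_measure:
  fixes A :: "'a::euclidean_space set"
  assumes "A \<in> sets borel" "A \<subseteq> sphere 0 1"
  shows "emeasure surface_measure A =
           of_nat DIM('a) * emeasure lborel {r *\<^sub>R a | a r. a \<in> A \<and> 0 < r \<and> r < 1}"
proof -
  have A: "A \<in> sets (restrict_space borel (sphere 0 1))"
    using assms by (auto simp: sets_restrict_space_iff)
  have eq: "sgn -` A \<inter> (ball 0 1 - {0}) = {r *\<^sub>R a | a r. a \<in> A \<and> 0 < r \<and> r < 1}" (is "?L = ?R")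
  proof
    show "?L \<subseteq> ?R"
    proof
      fix x assume x: "x \<in> ?L"
      then have "x = norm x *\<^sub>R sgn x" by (simp add: sgn_div_norm)
      with x show "x \<in> ?R" by (intro CollectI exI[of _ "sgn x"] exI[of _ "norm x"]) auto
    qed
    show "?R \<subseteq> ?L"
    proof
      fix x assume "x \<in> ?R"
      then obtain a r where ar: "x = r *\<^sub>R a" "a \<in> A" "0 < r" "r < 1" by blast
      then have "norm a = 1" using assms by auto
      with ar show "x \<in> ?L" by (auto simp: sgn_div_norm)
    qed
  qed
  have "?R \<subseteq> ball 0 1 - {0}"
    unfolding eq[symmetric] by blast
  then have "emeasure (restrict_space lborel (ball 0 1 - {0})) ?R = emeasure lborel ?R"
    by (intro emeasure_restrict_space) auto
  then show ?thesis
    by (simp add: surface_measure_def emeasure_distr[OF sgn_measurable_sphere A]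
        space_restrict_space eq)
qed

definition sphere_distance_graph :: "real \<Rightarrow> ('a::euclidean_space) rel" where
  "sphere_distance_graph t = {(x, y). x \<in> sphere 0 1 \<and> y \<in> sphere 0 1 \<and> x \<bullet> y = t}"

text \<open>Kernels on the sphere are total functions; only their values on the sphere matter.\<close>

definition psd_kernel_on :: "'a set \<Rightarrow> ('a \<Rightarrow> 'a \<Rightarrow> real) \<Rightarrow> bool" where
  "psd_kernel_on S K \<longleftrightarrow>
     (\<forall>x\<in>S. \<forall>y\<in>S. K x y = K y x) \<and>
     (\<forall>(N::nat) x c. (\<forall>i<N. x i \<in> S) \<longrightarrow> (\<Sum>i<N. \<Sum>j<N. c i * c j * K (x i) (x j)) \<ge> 0)"

definition theta_feasible :: "('a::euclidean_space) rel \<Rightarrow> ('a \<Rightarrow> 'a \<Rightarrow> real) \<Rightarrow> bool" where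
  "theta_feasible E K \<longleftrightarrow>
     continuous_on (sphere 0 1 \<times> sphere 0 1) (\<lambda>(x, y). K x y) \<and>
     psd_kernel_on (sphere 0 1) K \<and>
     (\<integral>x. K x x \<partial>surface_measure) = 1 \<and>
     (\<forall>(x, y)\<in>E. K x y = 0)"

text \<open>
  The theta number of a graph on the unit sphere, given by its adjacency relation. Positive
  semidefiniteness gives \<open>2 * K x y \<le> K x x + K y y\<close>, so the set below is bounded above by the total
  surface measure. For \<open>sphere_distance_graph t\<close> with \<open>-1 \<le> t < 1\<close> in dimension at least 2 it is
  nonempty, so that \<open>Sup\<close> on the reals is a genuine supremum there.
\<close>

definition theta_number :: "('a::euclidean_space) rel \<Rightarrow> real" where
  "theta_number E =
     Sup {(\<integral>x. (\<integral>y. K x y \<partial>surface_measure) \<partial>surface_measure) | K. theta_feasible E K}"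

end

theory Submission
  imports Defs
begin

text \<open>
  Let \<open>d\<close> be the dimension of the ambient space, \<open>p = d - 2\<close>, and let \<open>P\<^sub>k\<close> be the Gegenbauer polynomial of degree
  \<open>k\<close> belonging to the sphere, normalised by \<open>P\<^sub>k(1) = 1\<close>; let \<open>\<sigma>\<close> be the total surface measure.

  The theta number is governed by the smallest value of \<open>P\<^sub>k(t)\<close> over all degrees \<open>k\<close>. On the one hand, whenever
  \<open>m = P\<^sub>k(u) \<le> 0\<close> for some \<open>k \<ge> 1\<close>, a suitable affine function of the kernel \<open>P\<^sub>k(x \<bullet> y)\<close> is feasible at \<open>u\<close> and has
  the value \<open>\<sigma> * (-m) / (1 - m)\<close> (\<open>theta_number_ge\<close>). On the other hand, if \<open>m \<le> P\<^sub>k(s)\<close> for all \<open>k\<close> and all \<open>s\<close> in an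
  interval \<open>(t\<^sub>0, 1)\<close>, then no feasible kernel at a point of this interval exceeds that value; this is Hoffman's
  eigenvalue bound for the operator that averages over the neighbours of a point, smeared out slightly
  (\<open>hoffman_bound\<close>, \<open>feasible_value_le\<close>). Since \<open>-m / (1 - m)\<close> decreases with \<open>m\<close>, everything follows from one statement
  about polynomials (\<open>minimum_over_degrees\<close>): there is a number \<open>j \<le> 0\<close> such that for every \<open>u\<close> in \<open>[-1, 1)\<close> some \<open>k \<ge> 1\<close>
  has \<open>P\<^sub>k(u) \<le> j\<close>, while for every \<open>\<epsilon> > 0\<close> all \<open>P\<^sub>k\<close> are at least \<open>j - \<epsilon>\<close> on a left neighbourhood of \<open>1\<close>.
  The limit of the theta numbers is then \<open>\<sigma> * (-j) / (1 - j)\<close>.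

  To find \<open>j\<close>, let \<open>c\<^sub>k\<close> be the largest point below \<open>1\<close> at which \<open>P\<^sub>k\<close> and \<open>P\<^bsub>k+1\<^esub>\<close> agree. These points increase to \<open>1\<close>,
  and between \<open>c\<^bsub>k-1\<^esub>\<close> and \<open>c\<^sub>k\<close> the polynomial \<open>P\<^sub>k\<close> is negative and below both its neighbours in degree. The
  function \<open>amplitude\<close>, in the spirit of Sonin's function, agrees with \<open>P\<^sub>k\<^sup>2\<close> at both ends of this interval, is at most
  \<open>P\<^sub>k\<^sup>2\<close> inside, and is decreasing because for \<open>d \<ge> 4\<close> a certain algebraic form is nonnegative
  (\<open>amplitude_form_nonneg\<close>). So the common values \<open>P\<^sub>k(c\<^sub>k)\<close> increase with \<open>k\<close>, \<open>j\<close> is their limit, and \<open>P\<^sub>k \<le> j\<close> on the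
  whole interval. In the other direction, near \<open>1\<close> the amplitude differs little from \<open>P\<^sub>k\<^sup>2\<close>, lower degrees are
  larger than \<open>P\<^sub>k\<close>, and an energy that decreases with the degree controls the higher ones.

  The harmonic analysis consists of the Funk-Hecke formula (\<open>funk_hecke\<close>), obtained from the invariance of the surface
  measure under reflections: it makes the kernels \<open>P\<^sub>k(x \<bullet> y)\<close> positive semidefinite and diagonalises convolution
  with any zonal function.
\<close>

section \<open>Auxiliary facts about real functions, sequences and a polynomial form\<close>

text \<open>
  A zero with positive derivative is passed from below to above, so between two such zeros there would have to be one
  passed in the other direction.
\<close>

lemma positive_after_upcrossing:
  fixes f :: "real \<Rightarrow> real"
  assumes deriv: "\<And>y. a < y \<Longrightarrow> y < b \<Longrightarrow> (f has_real_derivative f' y) (at y)"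
    and up: "\<And>y. a < y \<Longrightarrow> y < b \<Longrightarrow> f y = 0 \<Longrightarrow> f' y > 0"
    and z: "a < z" "f z = 0" and x: "z < x" "x < b"
  shows "f x > 0"
proof (rule ccontr)
  assume "\<not> f x > 0"
  then have fx: "f x \<le> 0" by simp
  obtain d where d: "d > 0" "\<And>h. h > 0 \<Longrightarrow> h < d \<Longrightarrow> f z < f (z + h)"
    using DERIV_pos_inc_right[OF deriv up, of z] z x by auto
  define h0 where "h0 = min (d / 2) ((x - z) / 2)"
  define w where "w = z + h0"
  have "h0 > 0" "h0 < d" "h0 < x - z" using d(1) x by (auto simp: h0_def min_def)
  then have w: "z < w" "w < x" "f w > 0"
    using d(2)[of h0] z by (auto simp: w_def)
  have cont: "continuous_on {w..x} f"
  proof (intro continuous_at_imp_continuous_on ballI)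
    fix y assume "y \<in> {w..x}"
    then have "a < y" "y < b" using w x z by auto
    then show "isCont f y" using DERIV_isCont[OF deriv] by blast
  qed
  \<comment> \<open>The first point of \<open>Z\<close> would be a zero that \<open>f\<close> reaches from above.\<close>
  define Z where "Z = {y \<in> {w..x}. f y \<le> 0}"
  have "closed Z" unfolding Z_def
    by (intro continuous_on_closed_Collect_le cont continuous_intros closed_atLeastAtMost)
  moreover have "Z \<noteq> {}" "bdd_below Z" using w x fx by (auto simp: Z_def)
  ultimately have Inf: "Inf Z \<in> Z" by (rule closed_contains_Inf[rotated 2])
  have pos: "f y > 0" if "w \<le> y" "y < Inf Z" for y
    using that cInf_lower[of y Z] \<open>bdd_below Z\<close> Inf by (force simp: Z_def)
  have "w < Inf Z" using Inf w by (auto simp: Z_def less_le)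
  have "f (Inf Z) = 0"
  proof (rule ccontr)
    assume "f (Inf Z) \<noteq> 0"
    then have "f (Inf Z) < 0" using Inf by (auto simp: Z_def)
    moreover have "continuous_on {w..Inf Z} f" using cont Inf by (auto simp: Z_def intro: continuous_on_subset)
    ultimately obtain y where "w \<le> y" "y \<le> Inf Z" "f y = 0"
      using IVT2'[of f "Inf Z" 0 w] w(3) \<open>w < Inf Z\<close> by (metis less_imp_le)
    then show False using pos[of y] \<open>f (Inf Z) \<noteq> 0\<close> by (cases "y = Inf Z") auto
  qed
  moreover have in_ab: "a < Inf Z" "Inf Z < b" using Inf w x z by (auto simp: Z_def)
  ultimately obtain e where e: "e > 0" "\<And>h. h > 0 \<Longrightarrow> h < e \<Longrightarrow> f (Inf Z - h) < f (Inf Z)"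
    using DERIV_pos_inc_left[OF deriv up, of "Inf Z"] by auto
  define h where "h = min (e/2) (Inf Z - w)"
  have "h > 0" "h < e" "w \<le> Inf Z - h" using e \<open>w < Inf Z\<close> by (auto simp: h_def min_def)
  then show False using e(2)[of h] pos[of "Inf Z - h"] \<open>f (Inf Z) = 0\<close> by auto
qed

lemma no_positive_sequence_with_steady_decrease:
  fixes s :: "nat \<Rightarrow> real"
  assumes "\<delta> > 0" "\<And>k. k \<ge> K \<Longrightarrow> s (Suc k) \<le> s k - \<delta>" "\<And>k. s k > 0"
  shows False
proof -
  have "s (K + m) \<le> s K - real m * \<delta>" for m
  proof (induction m)
    case (Suc m)
    then show ?case using assms(2)[of "K + m"] by (simp add: algebra_simps)
  qed simp
  moreover obtain m where "real m * \<delta> > s K" using \<open>\<delta> > 0\<close> reals_Archimedean3 by blast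
  ultimately show False using assms(3)[of "K + m"] by (smt (verit))
qed

text \<open>
  With \<open>t = (1 - x) / (1 + x)\<close> this form is, up to a negative factor, the derivative of the function
  \<open>amplitude\<close> below; \<open>w\<close>, \<open>B\<close> and \<open>M + 2 * w\<close> stand for \<open>slope\<close>, \<open>defect\<close> and \<open>scale\<close>.
\<close>

abbreviation amplitude_form :: "real \<Rightarrow> real \<Rightarrow> real \<Rightarrow> real \<Rightarrow> real \<Rightarrow> real \<Rightarrow> real" where
  "amplitude_form p lam w t B M \<equiv> (1 + t) * w\<^sup>2 * (M + 2 * w)
     + ((p - 1) * (M + 2 * w) - 2 * lam - w * (p + 1 - (p - 1) * t) - 2 * t * w\<^sup>2) * B"

text \<open>
  As a function of \<open>t\<close> this is \<open>G0 + t * G1\<close>. For \<open>w \<ge> 0\<close> both \<open>G0\<close> and \<open>G1\<close> are nonnegative.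
  For \<open>w = -a < 0\<close> it is enough to look at \<open>t = 0\<close> and \<open>t = 2\<close>; eliminating \<open>lam\<close> in favour of \<open>B\<close> leaves polynomials
  in \<open>a\<close>, \<open>B\<close> and \<open>q = p - 2\<close> that are visibly nonnegative. The condition \<open>p \<ge> 2\<close>, which is \<open>d \<ge> 4\<close>, enters here.
\<close>

lemma amplitude_form_nonneg:
  fixes p lam w t B M :: real
  assumes p: "p \<ge> 2" and lam: "lam \<ge> 2 * p" and t: "0 \<le> t" "t \<le> 2"
    and B: "B = lam + p * w - w\<^sup>2" "B \<ge> 0" and L: "M = 2 * lam + p * (p - 1) / 2"
  shows "M + 2 * w > 0"
    and "amplitude_form p lam w t B M \<ge> 0"
proof -
  define G0 where "G0 = w\<^sup>2 * (M + 2 * w) + ((2 * p - 4) * lam + p * (p - 1)\<^sup>2 / 2 + (p - 3) * w) * B"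
  define G1 where "G1 = w\<^sup>2 * (M + 2 * w) + w * (p - 1 - 2 * w) * B"
  have G: "amplitude_form p lam w t B M = G0 + t * G1"
    by (simp add: G0_def G1_def L power2_eq_square field_simps)
  have "M + 2 * w > 0 \<and> G0 + t * G1 \<ge> 0"
  proof (cases "w \<ge> 0")
    case True
    define q where "q = p - 2"
    have q: "q \<ge> 0" "p = q + 2" using p by (auto simp: q_def)
    have pos: "M + 2 * w > 0" using True q lam unfolding L by (simp add: add_pos_nonneg)
    have "G1 = w\<^sup>2 * (3 * p * (p - 1) / 2 - 3 * (p - 1) * w + 2 * w\<^sup>2) + (p - 1) * lam * w"
      by (simp add: G1_def B L power2_eq_square field_simps)
    also have "3 * p * (p - 1) / 2 - 3 * (p - 1) * w + 2 * w\<^sup>2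
        = 2 * (w - 3 * (p - 1) / 4)\<^sup>2 + 3 * (p - 1) * (p + 3) / 8"
      by (simp add: power2_eq_square field_simps)
    finally have "G1 \<ge> 0" using True p lam by (auto intro!: add_nonneg_nonneg mult_nonneg_nonneg)
    moreover have "G0 \<ge> 0"
    proof -
      have "p * (p - 1)\<^sup>2 / 2 \<ge> 2 * 1\<^sup>2 / 2"
        using p by (intro divide_right_mono mult_mono power_mono) auto
      moreover have "(2 * p - 4) * lam \<ge> 0" "(p - 2) * w \<ge> 0" using p lam True by auto
      ultimately have "(2 * p - 4) * lam + p * (p - 1)\<^sup>2 / 2 + (p - 3) * w \<ge> 1 - w"
        by (simp add: algebra_simps)
      then have "G0 \<ge> w\<^sup>2 * (M + 2 * w) + (1 - w) * B"
        unfolding G0_def using B(2) by (intro add_left_mono mult_right_mono) auto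
      moreover have "w\<^sup>2 * (M + 2 * w) + (1 - w) * B
          = (lam - 2 * p) * (w\<^sup>2 + (w - 1/2)\<^sup>2 + 3/4)
            + 3 * w ^ 3 + w\<^sup>2 * (2 * p - 1 + p * (p - 1) / 2) + p * ((w - 1/2)\<^sup>2 + 7/4)"
        by (simp add: B L power2_eq_square power3_eq_cube field_simps)
      moreover have "\<dots> \<ge> 0"
        using True p lam by (intro add_nonneg_nonneg mult_nonneg_nonneg divide_nonneg_nonneg) auto
      ultimately show ?thesis by linarith
    qed
    ultimately show ?thesis using pos t by simp
  next
    case False
    define a where "a = - w"
    define q where "q = p - 2"
    have a: "a > 0" "w = - a" using False by (auto simp: a_def)
    have q: "q \<ge> 0" "p = q + 2" using p by (auto simp: q_def)
    have lamB: "lam = B + p * a + a\<^sup>2" using B a by simp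
    have "M + 2 * w = 2 * B + (2 * q + 2) * a + 2 * a\<^sup>2 + (q + 2) * (q + 1) / 2"
      by (simp add: L lamB a q power2_eq_square field_simps)
    moreover have "\<dots> > 0" using B a q by (intro add_nonneg_pos add_nonneg_nonneg) auto
    ultimately have pos: "M + 2 * w > 0" by simp
    define E where "E = (2 * q + 2) * a + 2 * a\<^sup>2 + (q + 2) * (q + 1) / 2"
    have "G0 = a\<^sup>2 * (2 * B + E) + B * (2 * q * B + (2 * q\<^sup>2 + 3 * q + 1) * a + 2 * q * a\<^sup>2
        + (q + 2) * (q + 1)\<^sup>2 / 2)"
      by (simp add: G0_def L lamB a q E_def power2_eq_square field_simps)
    moreover have "\<dots> \<ge> 0" unfolding E_def
      using a B(2) q by (intro add_nonneg_nonneg mult_nonneg_nonneg divide_nonneg_nonneg) auto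
    ultimately have "G0 \<ge> 0" by simp
    have "G0 + 2 * G1 = 3 * a\<^sup>2 * E
        + B * (2 * q * B + (q + 1) * (2 * (a - 1/4)\<^sup>2 + 7/8 + 2 * q * a + q\<^sup>2 / 2 + 3 * q / 2))"
      by (simp add: G0_def G1_def L lamB a q E_def power2_eq_square field_simps)
    moreover have "\<dots> \<ge> 0" unfolding E_def
      using a B(2) q by (intro add_nonneg_nonneg mult_nonneg_nonneg divide_nonneg_nonneg) auto
    ultimately have "G0 + 2 * G1 \<ge> 0" by simp
    have "G0 + t * G1 = (1 - t / 2) * G0 + t / 2 * (G0 + 2 * G1)" by (simp add: field_simps)
    moreover have "(1 - t / 2) * G0 \<ge> 0" "t / 2 * (G0 + 2 * G1) \<ge> 0"
      using t \<open>G0 \<ge> 0\<close> \<open>G0 + 2 * G1 \<ge> 0\<close> by auto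
    ultimately show ?thesis using pos by simp
  qed
  then show "M + 2 * w > 0"
    and "amplitude_form p lam w t B M \<ge> 0"
    by (simp_all add: G)
qed

text \<open>
  The left-hand side is what the quotient rule produces for the derivative of \<open>amplitude\<close>, after \<open>x\<close> has been expressed
  by \<open>t\<close>.
\<close>

lemma amplitude_form_identity:
  fixes p lam w t B M :: real
  assumes B: "B = lam + p * w - w\<^sup>2" and M: "M = 2 * lam + p * (p - 1) / 2"
  shows "- w * (1 + t) * (M + 2 * w)\<^sup>2 + 2 * w * t * B * (M + 2 * w) + B * (M + 2 * w)
      - (lam + t * w\<^sup>2 + w * ((1 + t) + p * (1 - t)) / 2) * ((p - 2 * w) * (M + 2 * w) - 2 * B)
    = - (amplitude_form p lam w t B M)"
  unfolding B M by (simp add: power2_eq_square field_simps)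

section \<open>Gegenbauer polynomials\<close>

text \<open>
  In classical notation this is \<open>C\<^sub>k\<^sup>\<nu>\<close> divided by its value at \<open>1\<close>, with \<open>\<nu> = p / 2\<close>; it belongs to the unit sphere
  of a space of dimension \<open>p + 2\<close>.
\<close>

fun gegen :: "real \<Rightarrow> nat \<Rightarrow> real poly" where
  "gegen p 0 = 1"
| "gegen p (Suc 0) = [:0, 1:]"
| "gegen p (Suc (Suc k)) =
     smult (1 / (real k + 1 + p))
       (smult (2 * real k + 2 + p) ([:0, 1:] * gegen p (Suc k)) - smult (real k + 1) (gegen p k))"

declare gegen.simps(3) [simp del]

locale gegenbauer =
  fixes p :: real
  assumes p: "p \<ge> 2"
begin

abbreviation P :: "nat \<Rightarrow> real \<Rightarrow> real" where
  "P k x \<equiv> poly (gegen p k) x"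

abbreviation P' :: "nat \<Rightarrow> real \<Rightarrow> real" where
  "P' k x \<equiv> poly (pderiv (gegen p k)) x"

lemma recurrence:
  "(real k + 1 + p) * P (Suc (Suc k)) x = (2 * real k + 2 + p) * x * P (Suc k) x - (real k + 1) * P k x"
  using p by (simp add: gegen.simps(3) field_simps add_nonneg_eq_0_iff)

lemma P_at_1: "P k 1 = 1"
proof (induction k rule: induct_nat_012)
  case (ge2 k)
  then have "(real k + 1 + p) * P (Suc (Suc k)) 1 = real k + 1 + p"
    using recurrence[of k 1] by (simp add: algebra_simps)
  then show ?case using p by simp
qed auto

lemma recurrence_deriv:
  "(real k + 1 + p) * P' (Suc (Suc k)) x
   = (2 * real k + 2 + p) * (P (Suc k) x + x * P' (Suc k) x) - (real k + 1) * P' k x"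
  using p by (simp add: gegen.simps(3) pderiv_smult pderiv_diff pderiv_mult pderiv_pCons field_simps add_nonneg_eq_0_iff)

text \<open>
  For each degree the two formulas are equivalent by the recurrence; differentiating the recurrence carries them to the
  next degree.
\<close>

lemma derivative_lower: "(1 - x\<^sup>2) * P' (Suc k) x = (real k + 1) * (P k x - x * P (Suc k) x)"
  and derivative_upper: "(1 - x\<^sup>2) * P' k x = (real k + p) * (x * P k x - P (Suc k) x)"
proof -
  have "(1 - x\<^sup>2) * P' (Suc k) x = (real k + 1) * (P k x - x * P (Suc k) x) \<and>
     (1 - x\<^sup>2) * P' k x = (real k + p) * (x * P k x - P (Suc k) x)"
  proof (induction k)
    case 0
    then show ?case by (simp add: pderiv_pCons power2_eq_square)
  next
    case (Suc k)
    let ?a = "P k x" and ?b = "P (Suc k) x" and ?c = "P (Suc (Suc k)) x"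
    have up: "(1 - x\<^sup>2) * P' (Suc k) x = (real k + 1 + p) * (x * ?b - ?c)"
      using Suc recurrence[of k x] by (simp add: algebra_simps)
    have "(real k + 1 + p) * ((1 - x\<^sup>2) * P' (Suc (Suc k)) x)
        = (2 * real k + 2 + p) * ((1 - x\<^sup>2) * ?b + x * ((1 - x\<^sup>2) * P' (Suc k) x))
          - (real k + 1) * ((1 - x\<^sup>2) * P' k x)"
      using recurrence_deriv[of k x] by (simp add: algebra_simps) algebra
    also have "\<dots> = (2 * real k + 2 + p) * ((1 - x\<^sup>2) * ?b + x * ((real k + 1) * (?a - x * ?b)))
          - (real k + 1) * ((real k + p) * (x * ?a - ?b))"
      using Suc by simp
    also have "\<dots> = (real k + 2) * ((real k + 1 + p) * ?b
        - x * ((2 * real k + 2 + p) * x * ?b - (real k + 1) * ?a))"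
      by algebra
    also have "\<dots> = (real k + 1 + p) * ((real k + 2) * (?b - x * ?c))"
      using recurrence[of k x] by algebra
    finally have "(1 - x\<^sup>2) * P' (Suc (Suc k)) x = (real k + 2) * (?b - x * ?c)"
      using p by (simp add: add_nonneg_eq_0_iff)
    then show ?case
      using up by (simp add: algebra_simps)
  qed
  then show "(1 - x\<^sup>2) * P' (Suc k) x = (real k + 1) * (P k x - x * P (Suc k) x)"
    "(1 - x\<^sup>2) * P' k x = (real k + p) * (x * P k x - P (Suc k) x)" by auto
qed

text \<open>
  Differentiating \<open>derivative_lower\<close> and removing the polynomial of lower degree with \<open>derivative_upper\<close> gives the equation
  multiplied by \<open>1 - x\<^sup>2\<close>; this factor cancels in the ring of polynomials.
\<close>

lemma ode:
  "(1 - x\<^sup>2) * poly (pderiv (pderiv (gegen p k))) x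
     = (p + 1) * x * P' k x - real k * (real k + p) * P k x"
proof (cases k)
  case (Suc n)
  let ?a = "gegen p n" and ?b = "gegen p (Suc n)"
  define q :: "real poly" where "q = [:1, 0, -1:]"
  have q: "poly q y = 1 - y\<^sup>2" and q': "poly (pderiv q) y = - 2 * y" for y
    by (simp_all add: q_def pderiv_pCons power2_eq_square)
  let ?R = "q * pderiv (pderiv ?b) - smult (p + 1) ([:0, 1:] * pderiv ?b)
              + smult ((real n + 1) * (real n + 1 + p)) ?b"
  have lower: "q * pderiv ?b = smult (real n + 1) (?a - [:0, 1:] * ?b)"
    using derivative_lower[of _ n]
    by (intro poly_eq_poly_eq_iff[THEN iffD1] ext) (simp add: q)
  have lower': "(1 - y\<^sup>2) * poly (pderiv (pderiv ?b)) y - 2 * y * P' (Suc n) y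
      = (real n + 1) * (P' n y - P (Suc n) y - y * P' (Suc n) y)" for y
  proof -
    have "poly (pderiv (q * pderiv ?b)) y = poly (pderiv (smult (real n + 1) (?a - [:0, 1:] * ?b))) y"
      by (simp only: lower)
    moreover have "poly (pderiv [:0, 1:]) y = 1" by (simp add: pderiv_pCons)
    ultimately show ?thesis
      by (simp only: pderiv_mult pderiv_smult pderiv_diff poly_add poly_mult poly_smult poly_diff q q')
         (simp add: algebra_simps)
  qed
  have "q * ?R = 0"
  proof (intro poly_eq_poly_eq_iff[THEN iffD1] ext)
    fix y
    have "poly (q * ?R) y = (1 - y\<^sup>2) * ((1 - y\<^sup>2) * poly (pderiv (pderiv ?b)) y
        - (p + 1) * (y * P' (Suc n) y) + (real n + 1) * (real n + 1 + p) * P (Suc n) y)"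
      by (simp add: q)
    also have "\<dots> = 0"
      using lower'[of y] derivative_lower[of y n] derivative_upper[of y n] by algebra
    finally show "poly (q * ?R) y = poly 0 y" by simp
  qed
  moreover have "q \<noteq> 0" by (simp add: q_def)
  ultimately have "?R = 0" by simp
  then have "poly ?R x = 0" by (simp only: poly_0)
  then show ?thesis
    unfolding Suc
    by (simp add: q) (simp add: algebra_simps)
qed simp

text \<open>
  For \<open>p = 0\<close>, that is \<open>P\<^sub>k(cos \<phi>) = cos (k * \<phi>)\<close>, this is the constant \<open>(sin \<phi>)\<^sup>2\<close>. For positive \<open>p\<close> the recurrence is
  damped, and the energy decreases with the degree.
\<close>

definition energy :: "nat \<Rightarrow> real \<Rightarrow> real" where
  "energy k x = (P k x)\<^sup>2 - 2 * x * P k x * P (Suc k) x + (P (Suc k) x)\<^sup>2"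

lemma energy_ge: "(1 - x\<^sup>2) * (P k x)\<^sup>2 \<le> energy k x"
proof -
  have "energy k x = (1 - x\<^sup>2) * (P k x)\<^sup>2 + (P (Suc k) x - x * P k x)\<^sup>2"
    by (simp add: energy_def power2_eq_square algebra_simps)
  then show ?thesis by simp
qed

lemma energy_antimono:
  assumes "k \<le> l" shows "energy l x \<le> energy k x"
  using assms
proof (induction rule: dec_induct)
  case (step k)
  let ?a = "P k x" and ?b = "P (Suc k) x" and ?c = "P (Suc (Suc k)) x"
  let ?s = "real k + 1 + p"
  have "?s\<^sup>2 * (energy (Suc k) x - energy k x) = (?s * (?c - ?a)) * (?s * (?c + ?a - 2 * x * ?b))"
    by (simp only: energy_def) algebra
  also have "?s * (?c - ?a) = (2 * real k + 2 + p) * (x * ?b - ?a)"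
    using recurrence[of k x] by algebra
  also have "?s * (?c + ?a - 2 * x * ?b) = p * (?a - x * ?b)"
    using recurrence[of k x] by algebra
  also have "(2 * real k + 2 + p) * (x * ?b - ?a) * (p * (?a - x * ?b))
      = - (p * (2 * real k + 2 + p) * (?a - x * ?b)\<^sup>2)"
    by algebra
  also have "\<dots> \<le> 0" using p by simp
  finally have "energy (Suc k) x - energy k x \<le> 0"
    using p by (simp add: mult_le_0_iff)
  with step show ?case by simp
qed simp

section \<open>Crossings of consecutive polynomials\<close>

text \<open>
  At a point where two consecutive polynomials take the same negative value, the adjacent polynomials on both sides are
  larger, and the difference of the two crosses zero upwards.
\<close>

lemma tie_next:
  assumes "P k x = v" "P (Suc k) x = v"
  shows "(real k + 1 + p) * (P (Suc (Suc k)) x - v) = - v * (1 - x) * (2 * real k + 2 + p)"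
  using recurrence[of k x] assms by algebra

lemma tie_previous:
  assumes "P (Suc k) x = v" "P (Suc (Suc k)) x = v"
  shows "(real k + 1) * (P k x - v) = - v * (1 - x) * (2 * real k + 2 + p)"
  using recurrence[of k x] assms by algebra

lemma tie_derivative:
  assumes "P k x = v" "P (Suc k) x = v"
  shows "(1 - x\<^sup>2) * (P' k x - P' (Suc k) x) = - v * (1 - x) * (2 * real k + 1 + p)"
  using derivative_upper[of x k] derivative_lower[of x k] assms by algebra

lemma P'_at_1: "(p + 1) * P' k 1 = real k * (real k + p)"
  using ode[of 1 k] P_at_1[of k] by simp

text \<open>
  The lower bound is the crossing of \<open>P\<^sub>1\<close> and \<open>P\<^sub>2\<close>. As \<open>p \<ge> 2\<close> it keeps all crossings above \<open>-1/3\<close>, where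
  \<open>(1 - x) / (1 + x) \<le> 2\<close>, as \<open>amplitude_form_nonneg\<close> requires.
\<close>

definition is_crossing :: "nat \<Rightarrow> real \<Rightarrow> bool" where
  "is_crossing k c \<longleftrightarrow> - 1 / (p + 2) \<le> c \<and> c < 1 \<and> P (Suc k) c = P k c \<and> P k c < 0 \<and>
     (\<forall>x. c < x \<and> x < 1 \<longrightarrow> (\<forall>j\<le>k. P (Suc j) x < P j x))"

lemma is_crossing_gt: "is_crossing k c \<Longrightarrow> -1 < c"
proof -
  have "-1 < - 1 / (p + 2)" using p by (simp add: field_simps)
  then show "is_crossing k c \<Longrightarrow> -1 < c" by (simp add: is_crossing_def)
qed

lemma is_crossing_1: "is_crossing (Suc 0) (- 1 / (p + 2))"
proof -
  have P2: "(p + 1) * (P (Suc 0) x - P (Suc (Suc 0)) x) = (1 - x) * ((p + 2) * x + 1)" for x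
    using recurrence[of 0 x] by (simp add: algebra_simps)
  have "P (Suc (Suc 0)) x < P (Suc 0) x" if "- 1 / (p + 2) < x" "x < 1" for x
  proof -
    have "(p + 2) * x + 1 > 0" using that p by (simp add: field_simps)
    then have "(1 - x) * ((p + 2) * x + 1) > 0" using that by simp
    then have "0 < (p + 1) * (P (Suc 0) x - P (Suc (Suc 0)) x)"
      unfolding P2 .
    then show ?thesis using p by (simp add: zero_less_mult_iff)
  qed
  moreover have "P (Suc (Suc 0)) (- 1 / (p + 2)) = P (Suc 0) (- 1 / (p + 2))"
    using P2[of "- 1 / (p + 2)"] p by simp
  ultimately show ?thesis
    using p by (auto simp: is_crossing_def le_Suc_eq field_simps)
qed

text \<open>
  Right of a crossing of degree \<open>k\<close> the value of \<open>P\<^sub>k\<close> exceeds that of \<open>P\<^bsub>k+1\<^esub>\<close>. If the latter ties with \<open>P\<^bsub>k+2\<^esub>\<close>, the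
  recurrence turns this strict inequality into negativity of the common value.
\<close>

lemma difference_upcrossing:
  assumes c: "is_crossing k c" and y: "c < y" "y < 1" and tie: "P (Suc k) y - P (Suc (Suc k)) y = 0"
  shows "P (Suc k) y < 0" "P' (Suc k) y - P' (Suc (Suc k)) y > 0"
proof -
  have "\<bar>y\<bar> < 1" using is_crossing_gt[OF c] y by simp
  then have y2: "1 - y\<^sup>2 > 0" by (simp add: abs_square_less_1)
  have "P (Suc k) y < P k y" using c y by (auto simp: is_crossing_def)
  then have "(real k + 1) * (P k y - P (Suc k) y) > 0" by simp
  then have "0 < - P (Suc k) y * (1 - y) * (2 * real k + 2 + p)"
    using tie_previous[of k y "P (Suc k) y"] tie by simp
  then show neg: "P (Suc k) y < 0"
    using y p by (simp add: zero_less_mult_iff mult_less_0_iff)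
  then have "- P (Suc k) y * (1 - y) * (2 * real (Suc k) + 1 + p) > 0"
    using y p by (intro mult_pos_pos) auto
  then have "(1 - y\<^sup>2) * (P' (Suc k) y - P' (Suc (Suc k)) y) > 0"
    using tie_derivative[of "Suc k" y "P (Suc k) y"] tie by simp
  then show "P' (Suc k) y - P' (Suc (Suc k)) y > 0"
    using y2 by (simp only: zero_less_mult_iff) auto
qed

lemma difference_negative_at_crossing:
  assumes "is_crossing k c" shows "P (Suc k) c < P (Suc (Suc k)) c"
proof -
  have "- P k c * (1 - c) * (2 * real k + 2 + p) > 0"
    using assms p by (simp add: is_crossing_def mult_less_0_iff)
  then have "(real k + 1 + p) * (P (Suc (Suc k)) c - P (Suc k) c) > 0"
    using tie_next[of k c "P k c"] assms by (simp add: is_crossing_def)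
  then show ?thesis using p by (simp add: zero_less_mult_iff)
qed

lemma difference_has_derivative:
  "((\<lambda>x. P (Suc k) x - P (Suc (Suc k)) x) has_real_derivative (P' (Suc k) x - P' (Suc (Suc k)) x)) (at x)"
  by (intro derivative_intros poly_DERIV)

lemma difference_positive_after:
  assumes c: "is_crossing k c" and z: "c < z" "P (Suc k) z = P (Suc (Suc k)) z" and x: "z < x" "x < 1"
  shows "P (Suc (Suc k)) x < P (Suc k) x"
  using positive_after_upcrossing[where f = "\<lambda>x. P (Suc k) x - P (Suc (Suc k)) x" and a = c and b = 1 and
      z = z and x = x, OF difference_has_derivative difference_upcrossing(2)[OF c]] z x
  by simp

text \<open>
  The difference of the next two polynomials is negative at \<open>c\<close> and positive just below \<open>1\<close>, where all polynomials meet
  and the slope \<open>P\<^sub>k'(1)\<close> grows with \<open>k\<close>. The zero between is unique because all zeros are upcrossings, so the ordering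
  of the degrees holds all the way to \<open>1\<close>.
\<close>

lemma next_crossing_exists:
  assumes c: "is_crossing k c"
  shows "\<exists>c'>c. is_crossing (Suc k) c'"
proof -
  let ?f = "\<lambda>x. P (Suc k) x - P (Suc (Suc k)) x"
  have c1: "c < 1" using c by (simp add: is_crossing_def)
  have "(p + 1) * (P' (Suc k) 1 - P' (Suc (Suc k)) 1) < 0"
    using p P'_at_1[of "Suc k"] P'_at_1[of "Suc (Suc k)"] by (simp add: algebra_simps)
  then have "P' (Suc k) 1 - P' (Suc (Suc k)) 1 < 0" using p by (simp add: mult_less_0_iff)
  then obtain d where d: "d > 0" "\<And>h. h > 0 \<Longrightarrow> h < d \<Longrightarrow> ?f 1 < ?f (1 - h)"
    using DERIV_neg_dec_left[OF difference_has_derivative[of k 1]] by blast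
  define h where "h = min (d / 2) ((1 - c) / 2)"
  have h: "h > 0" "h < d" "c < 1 - h" using d c1 by (auto simp: h_def min_def field_simps)
  have "?f (1 - h) > 0" using d(2)[OF h(1,2)] by (simp add: P_at_1)
  moreover have "?f c < 0" using difference_negative_at_crossing[OF c] by simp
  moreover have cont: "continuous_on {c..1 - h} ?f" by (intro continuous_intros)
  ultimately obtain z where z: "c \<le> z" "z \<le> 1 - h" "?f z = 0"
    using IVT'[OF less_imp_le less_imp_le less_imp_le cont, of 0] h(3) by blast
  have "c < z" using z \<open>?f c < 0\<close> by (cases "c = z") auto
  have "is_crossing (Suc k) z"
    unfolding is_crossing_def
  proof (intro conjI allI impI)
    show "- 1 / (p + 2) \<le> z" "z < 1" using c \<open>c < z\<close> z h by (auto simp: is_crossing_def)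
    show "P (Suc (Suc k)) z = P (Suc k) z" "P (Suc k) z < 0"
      using z difference_upcrossing(1)[OF c \<open>c < z\<close>] h by auto
    fix x j assume x: "z < x \<and> x < 1" and j: "j \<le> Suc k"
    show "P (Suc j) x < P j x"
    proof (cases "j = Suc k")
      case True
      then show ?thesis using difference_positive_after[OF c \<open>c < z\<close>] z x by simp
    next
      case False
      then show ?thesis using c j x \<open>c < z\<close> by (simp add: is_crossing_def)
    qed
  qed
  then show ?thesis using \<open>c < z\<close> by blast
qed

lemma crossings_exist:
  obtains c where "\<And>n. is_crossing (Suc n) (c n)" "\<And>n. c n < c (Suc n)" "c 0 = - 1 / (p + 2)"
proof -
  have "\<exists>c. \<forall>n. (is_crossing (Suc n) (c n) \<and> (n = 0 \<longrightarrow> c n = - 1 / (p + 2))) \<and> c n < c (Suc n)"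
  proof (rule dependent_nat_choice)
    show "\<exists>x. is_crossing (Suc 0) x \<and> (0 = (0::nat) \<longrightarrow> x = - 1 / (p + 2))"
      using is_crossing_1 by auto
    show "\<exists>y. (is_crossing (Suc (Suc n)) y \<and> (Suc n = 0 \<longrightarrow> y = - 1 / (p + 2))) \<and> x < y"
      if "is_crossing (Suc n) x \<and> (n = 0 \<longrightarrow> x = - 1 / (p + 2))" for x n
      using next_crossing_exists[of "Suc n" x] that by auto
  qed
  then show thesis using that by auto
qed

text \<open>
  If all crossings stayed below \<open>u\<close>, the sequence \<open>P\<^sub>k(u)\<close> would decrease strictly in \<open>k\<close>. Once negative, the recurrence
  makes its decrements shrink by a fixed amount in every step. If it stays positive, its ratios \<open>r\<close> shrink by a fixed
  amount in every step, because \<open>r + 1 / r \<ge> 2\<close> while the recurrence asks for about \<open>2 * u\<close>. Neither can go on forever.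
\<close>

lemma crossings_tend_to_1:
  assumes c: "\<And>n. is_crossing (Suc n) (c n)" and "u < 1"
  shows "\<exists>n. u \<le> c n"
proof (rule ccontr)
  assume "\<not> (\<exists>n. u \<le> c n)"
  then have cu: "c n < u" for n by (simp add: not_le)
  define a where "a k = P k u" for k
  have dec: "a (Suc k) < a k" for k
    using c[of k] cu[of k] \<open>u < 1\<close> by (auto simp: a_def is_crossing_def)
  then have dec': "a l \<le> a k" if "k \<le> l" for k l
    using that lift_Suc_antimono_le[of a] by (meson less_imp_le)
  have rec: "(real k + 1 + p) * a (Suc (Suc k)) = (2 * real k + 2 + p) * u * a (Suc k) - (real k + 1) * a k" for k
    unfolding a_def by (rule recurrence)
  have pos: "a m > 0" for m
  proof (rule ccontr)
    assume "\<not> a m > 0"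
    then have m: "a (Suc m) < 0" using dec[of m] by simp
    let ?d = "- (a (Suc m)) * (1 - u)"
    show False
    proof (rule no_positive_sequence_with_steady_decrease[of ?d "Suc m" "\<lambda>k. a k - a (Suc k)"])
      show "?d > 0" using m \<open>u < 1\<close> by (intro mult_pos_pos) auto
      show "a k - a (Suc k) > 0" for k using dec[of k] by simp
      fix k assume k: "k \<ge> Suc m"
      let ?s = "real k + 1 + p"
      have "?s * (a (Suc k) - a (Suc (Suc k)))
          = (real k + 1) * (a k - a (Suc k)) + (2 * real k + 2 + p) * ((1 - u) * a (Suc k))"
        using rec[of k] by algebra
      also have "(real k + 1) * (a k - a (Suc k)) \<le> ?s * (a k - a (Suc k))"
        using dec[of k] p by (intro mult_right_mono) auto
      also have "(2 * real k + 2 + p) * ((1 - u) * a (Suc k)) \<le> ?s * ((1 - u) * a (Suc k))"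
        using dec'[of "Suc m" "Suc k"] k m \<open>u < 1\<close> by (intro mult_right_mono_neg) (auto simp: mult_le_0_iff)
      also have "?s * ((1 - u) * a (Suc k)) \<le> ?s * ((1 - u) * a (Suc m))"
        using dec'[of "Suc m" "Suc k"] k p \<open>u < 1\<close> by (intro mult_left_mono) auto
      finally have "?s * (a (Suc k) - a (Suc (Suc k))) \<le> ?s * (a k - a (Suc k) - ?d)"
        by (simp add: algebra_simps)
      then show "a (Suc k) - a (Suc (Suc k)) \<le> a k - a (Suc k) - ?d"
        using p by (simp add: mult_le_cancel_left)
    qed
  qed
  define r where "r k = a (Suc k) / a k" for k
  have r: "0 < r k" "r k < 1" for k using pos[of k] pos[of "Suc k"] dec[of k] by (auto simp: r_def)
  define A where "A = p * \<bar>u\<bar>"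
  have A: "p * u \<le> A" "0 \<le> A" using p by (auto simp: A_def intro: mult_left_mono)
  \<comment> \<open>From degree \<open>K\<close> on, the terms of the recurrence that contain \<open>p\<close> are negligible.\<close>
  obtain K :: nat where K: "real K * (1 - u) \<ge> A + p"
    using \<open>u < 1\<close> by (metis diff_gt_0_iff_gt less_imp_le reals_Archimedean3)
  show False
  proof (rule no_positive_sequence_with_steady_decrease[of "(1 - u) / 2" K r])
    show "(1 - u) / 2 > 0" using \<open>u < 1\<close> by simp
    show "r k > 0" for k by (rule r)
    fix k assume k: "K \<le> k"
    let ?s = "real k + 1 + p"
    have "?s * r (Suc k) = (2 * real k + 2 + p) * u - (real k + 1) / r k"
      using rec[of k] pos[of k] pos[of "Suc k"] by (simp add: r_def field_simps)
    moreover have "1 / r k + r k \<ge> 2"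
    proof -
      have "(1 - r k)\<^sup>2 / r k \<ge> 0" using r[of k] by simp
      then show ?thesis using r[of k] by (simp add: field_simps power2_eq_square)
    qed
    then have "(real k + 1) * (1 / r k + r k) \<ge> (real k + 1) * 2"
      by (intro mult_left_mono) auto
    then have "(real k + 1) / r k \<ge> 2 * (real k + 1) - (real k + 1) * r k" by (simp add: algebra_simps)
    moreover have "p * r k \<ge> 0" using p r[of k] by simp
    ultimately have *: "?s * r (Suc k) \<le> (2 * real k + 2 + p) * u - 2 * (real k + 1) + ?s * r k"
      by (simp add: algebra_simps)
    have "real k * (1 - u) \<ge> A + p"
      using k \<open>u < 1\<close> by (intro order_trans[OF K] mult_right_mono) auto
    moreover have "3 * X + 3 * (1 - u) - p - p * u \<ge> 0" if "A + p \<le> X" for X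
      using that p A \<open>u < 1\<close> by argo
    ultimately have "3 * (real k * (1 - u)) + 3 * (1 - u) - p - p * u \<ge> 0" by blast
    then have "(2 * real k + 2 + p) * u - 2 * (real k + 1) \<le> - (?s * ((1 - u) / 2))"
      by (simp add: field_simps)
    with * have "?s * r (Suc k) \<le> ?s * (r k - (1 - u) / 2)" by (simp add: algebra_simps)
    then show "r (Suc k) \<le> r k - (1 - u) / 2" using p by (simp add: mult_le_cancel_left)
  qed
qed

section \<open>The amplitude between two crossings\<close>

text \<open>
  If \<open>P\<^bsub>k+1\<^esub>\<close> exceeded \<open>P\<^bsub>k+2\<^esub>\<close> somewhere before \<open>c'\<close>, their difference would have crossed zero upwards before and would
  still be positive at \<open>c'\<close>. The recurrence expresses \<open>x * P\<^bsub>k+1\<^esub>(x)\<close> as a weighted mean of the two neighbours; as both are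
  at least \<open>P\<^bsub>k+1\<^esub>(x)\<close> and \<open>x < 1\<close>, this value is not positive; were it zero, so would be \<open>P\<^sub>k(x)\<close>.
\<close>

lemma signs_between_crossings:
  assumes c: "is_crossing k c" and c': "is_crossing (Suc k) c'" and x: "c \<le> x" "x \<le> c'"
  shows "P (Suc k) x \<le> P k x" "P (Suc k) x \<le> P (Suc (Suc k)) x" "P (Suc k) x < 0"
proof -
  have "x < 1" "-1 < x" using c' x is_crossing_gt[OF c] by (auto simp: is_crossing_def)
  show prev: "P (Suc k) x \<le> P k x" using c x \<open>x < 1\<close> by (cases "x = c") (auto simp: is_crossing_def le_less)
  show "next": "P (Suc k) x \<le> P (Suc (Suc k)) x"
  proof (cases "x = c'")
    case False
    let ?f = "\<lambda>x. P (Suc k) x - P (Suc (Suc k)) x"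
    show ?thesis
    proof (rule ccontr)
      assume "\<not> ?thesis"
      then have fx: "?f x > 0" by simp
      have fc: "?f c < 0" using difference_negative_at_crossing[OF c] by simp
      have cont: "continuous_on {c..x} ?f" by (intro continuous_intros)
      obtain z where z: "c \<le> z" "z \<le> x" "?f z = 0"
        using IVT'[OF _ _ x(1) cont, of 0] fx fc by force
      have "c < z" using z fc by (cases "c = z") auto
      then have "P (Suc (Suc k)) c' < P (Suc k) c'"
        using difference_positive_after[OF c _ _ _ , of z c'] z x c' False by (simp add: is_crossing_def)
      then show False using c' by (simp add: is_crossing_def)
    qed
  qed (use c' in \<open>simp add: is_crossing_def\<close>)
  let ?v = "P (Suc k) x"
  have "(real k + 1 + p) * ?v \<le> (real k + 1 + p) * P (Suc (Suc k)) x"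
    using "next" p by (intro mult_left_mono) auto
  moreover have "(real k + 1) * ?v \<le> (real k + 1) * P k x"
    using prev by (intro mult_left_mono) auto
  ultimately have "0 \<ge> (2 * real k + 2 + p) * ((1 - x) * ?v) + (real k + 1) * (P k x - ?v)"
    using recurrence[of k x] by (simp add: algebra_simps)
  moreover have "(real k + 1) * (P k x - ?v) \<ge> 0" using prev by simp
  ultimately have "(2 * real k + 2 + p) * ((1 - x) * ?v) \<le> 0" by linarith
  then have "?v \<le> 0" using p \<open>x < 1\<close> by (simp add: mult_le_0_iff)
  moreover have "?v \<noteq> 0"
  proof
    assume v: "?v = 0"
    have "(real k + 1 + p) * P (Suc (Suc k)) x \<ge> 0" using "next" v p by simp
    moreover have "(real k + 1 + p) * P (Suc (Suc k)) x = - ((real k + 1) * P k x)"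
      using recurrence[of k x] v by simp
    ultimately have "(real k + 1) * P k x \<le> 0" by linarith
    then have "P k x = 0" using prev v by (simp add: mult_le_0_iff)
    with v show False using c x \<open>x < 1\<close> by (cases "x = c") (force simp: is_crossing_def)+
  qed
  ultimately show "?v < 0" by simp
qed

text \<open>
  In the angle \<open>\<phi> = arccos x\<close> this is the logarithmic derivative of \<open>P\<^sub>k(cos \<phi>)\<close> divided by \<open>tan (\<phi> / 2)\<close>. The scaling
  makes it \<open>-k\<close> at a tie with degree \<open>k - 1\<close> and \<open>k + p\<close> at a tie with degree \<open>k + 1\<close>.
\<close>

definition slope :: "nat \<Rightarrow> real \<Rightarrow> real" where
  "slope k x = - (1 + x) * P' k x / P k x"

text \<open>
  This is \<open>(k + p - slope) * (k + slope)\<close>: it vanishes exactly at the ties and is positive where \<open>P\<^sub>k\<close> is negative and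
  below both neighbours.
\<close>

definition defect :: "nat \<Rightarrow> real \<Rightarrow> real" where
  "defect k x = real k * (real k + p) + p * slope k x - (slope k x)\<^sup>2"

text \<open>
  With \<open>a * slope\<close> in place of \<open>2 * slope\<close>, the square of the slope would enter the derivative of the amplitude with a
  factor proportional to \<open>a - 1\<close>. The choice \<open>a = 2\<close> gives it the sign needed for monotonicity.
\<close>

definition scale :: "nat \<Rightarrow> real \<Rightarrow> real" where
  "scale k x = 2 * (real k * (real k + p)) + p * (p - 1) / 2 + 2 * slope k x"

text \<open>
  The subtracted term vanishes at the two ties, so there the amplitude is \<open>P\<^sub>k\<^sup>2\<close>; monotonicity of the amplitude thus
  compares the values of \<open>P\<^sub>k\<close> at its ties with both neighbours.
\<close>

definition amplitude :: "nat \<Rightarrow> real \<Rightarrow> real" where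
  "amplitude k x = (P k x)\<^sup>2 * (1 - (1 - x) * defect k x / scale k x)"

lemma slope_lower:
  assumes "P (Suc k) x \<noteq> 0"
  shows "real (Suc k) * (P k x - P (Suc k) x) = - ((1 - x) * P (Suc k) x) * (real (Suc k) + slope (Suc k) x)"
proof -
  have "slope (Suc k) x * P (Suc k) x = - (1 + x) * P' (Suc k) x" using assms by (simp add: slope_def)
  then show ?thesis using derivative_lower[of x k] unfolding of_nat_Suc by algebra
qed

lemma slope_upper:
  assumes "P k x \<noteq> 0"
  shows "(real k + p) * (P (Suc k) x - P k x) = - ((1 - x) * P k x) * (real k + p - slope k x)"
proof -
  have "slope k x * P k x = - (1 + x) * P' k x" using assms by (simp add: slope_def)
  then show ?thesis using derivative_upper[of x k] by algebra
qed

lemma defect_factors: "defect k x = (real k + p - slope k x) * (real k + slope k x)"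
  by (simp add: defect_def power2_eq_square algebra_simps)

lemma slope_bounds:
  assumes x: "x < 1" and neg: "P (Suc k) x < 0"
    and prev: "P (Suc k) x \<le> P k x" and "next": "P (Suc k) x \<le> P (Suc (Suc k)) x"
  shows "- real (Suc k) \<le> slope (Suc k) x" "slope (Suc k) x \<le> real (Suc k) + p" "defect (Suc k) x \<ge> 0"
proof -
  have neg': "(1 - x) * P (Suc k) x < 0" using x neg by (simp add: mult_less_0_iff)
  have "real (Suc k) * (P k x - P (Suc k) x) \<ge> 0" using prev by simp
  then have "- ((1 - x) * P (Suc k) x) * (real (Suc k) + slope (Suc k) x) \<ge> 0"
    using slope_lower[of k x] neg by simp
  then show 1: "- real (Suc k) \<le> slope (Suc k) x" using neg' by (simp only: zero_le_mult_iff) auto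
  have "(real (Suc k) + p) * (P (Suc (Suc k)) x - P (Suc k) x) \<ge> 0" using "next" p by simp
  then have "- ((1 - x) * P (Suc k) x) * (real (Suc k) + p - slope (Suc k) x) \<ge> 0"
    using slope_upper[of "Suc k" x] neg by simp
  then show 2: "slope (Suc k) x \<le> real (Suc k) + p" using neg' by (simp only: zero_le_mult_iff) auto
  show "defect (Suc k) x \<ge> 0" unfolding defect_factors using 1 2 by simp
qed

text \<open>
  The differential equation turns into a Riccati equation for the logarithmic derivative.
\<close>

lemma slope_has_derivative:
  assumes "\<bar>x\<bar> < 1" "P k x \<noteq> 0"
  shows "(slope k has_real_derivative
    ((1 + x) * (real k * (real k + p)) + (1 - x) * (slope k x)\<^sup>2 + slope k x * (1 + p * x)) / (1 - x\<^sup>2)) (at x)"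
proof -
  let ?D2 = "poly (pderiv (pderiv (gegen p k))) x"
  have "1 - x\<^sup>2 > 0" using assms by (simp add: abs_square_less_1)
  have "((\<lambda>x. - (1 + x) * P' k x / P k x) has_real_derivative
      ((- P' k x + - (1 + x) * ?D2) * P k x - - (1 + x) * P' k x * P' k x) / (P k x * P k x)) (at x)"
    using assms by (auto intro!: derivative_eq_intros)
  moreover have "((- P' k x + - (1 + x) * ?D2) * P k x - - (1 + x) * P' k x * P' k x) / (P k x * P k x)
    = ((1 + x) * (real k * (real k + p)) + (1 - x) * (slope k x)\<^sup>2 + slope k x * (1 + p * x)) / (1 - x\<^sup>2)"
  proof -
    have 1: "slope k x * P k x = - (1 + x) * P' k x" using assms by (simp add: slope_def)
    have "(P k x * P k x) * ((1 + x) * (real k * (real k + p)) + (1 - x) * (slope k x)\<^sup>2 + slope k x * (1 + p * x))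
       = (1 + x) * (P k x * P k x) * (real k * (real k + p)) + (1 - x) * (slope k x * P k x)\<^sup>2
           + (slope k x * P k x) * P k x * (1 + p * x)"
      by (simp add: power2_eq_square algebra_simps)
    also have "\<dots> = ((- P' k x + - (1 + x) * ?D2) * P k x - - (1 + x) * P' k x * P' k x) * (1 - x\<^sup>2)"
      unfolding 1 using ode[of x k] by algebra
    finally show ?thesis using \<open>1 - x\<^sup>2 > 0\<close> assms by (simp add: frac_eq_eq mult.commute)
  qed
  ultimately show ?thesis by (simp add: slope_def[abs_def])
qed

lemma P_has_derivative_slope:
  assumes "-1 < x" "P k x \<noteq> 0"
  shows "(P k has_real_derivative - slope k x * P k x / (1 + x)) (at x)"
proof -
  have "slope k x * P k x = - (1 + x) * P' k x" using assms by (simp add: slope_def)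
  then have "- slope k x * P k x = (1 + x) * P' k x" by algebra
  then have "- slope k x * P k x / (1 + x) = P' k x" using assms(1) by simp
  then show ?thesis using poly_DERIV[of "gegen p k" x] by simp
qed

text \<open>
  By the Riccati equation for \<open>slope\<close>, the derivative is \<open>-(P\<^sub>k / scale)\<^sup>2\<close> times \<open>amplitude_form\<close>.
\<close>

lemma amplitude_derivative_nonpos:
  assumes x: "-1/3 \<le> x" "x < 1" and k: "k \<ge> 2" and P: "P k x \<noteq> 0" and B: "defect k x \<ge> 0"
  shows "scale k x > 0" "\<exists>D\<le>0. (amplitude k has_real_derivative D) (at x)"
proof -
  define l where "l = real k * (real k + p)"
  define t where "t = (1 - x) / (1 + x)"
  define w where "w = slope k x"
  define b where "b = defect k x"
  define M where "M = 2 * l + p * (p - 1) / 2"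
  define w' where "w' = ((1 + x) * l + (1 - x) * w\<^sup>2 + w * (1 + p * x)) / (1 - x\<^sup>2)"
  have b_eq: "b = l + p * w - w\<^sup>2" by (simp add: b_def defect_def l_def w_def)
  have l: "l \<ge> 2 * p"
  proof -
    have "l \<ge> 2 * (0 + p)" unfolding l_def using k p by (intro mult_mono) auto
    then show ?thesis by simp
  qed
  have t: "0 \<le> t" "t \<le> 2" using x by (auto simp: t_def field_simps)
  have scale_eq: "scale k x = M + 2 * w" by (simp add: scale_def M_def l_def w_def)
  note G = amplitude_form_nonneg[OF p l t b_eq _ M_def]
  have b0: "0 \<le> b" using B by (simp add: b_def)
  show "scale k x > 0" using G(1)[OF b0] by (simp add: scale_eq)
  then have E: "M + 2 * w > 0" by (simp add: scale_eq)
  have x1: "\<bar>x\<bar> < 1" using x by auto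
  have w_deriv: "(slope k has_real_derivative w') (at x)"
    using slope_has_derivative[OF x1 P] by (simp add: w'_def l_def w_def)
  have b_deriv: "(defect k has_real_derivative (p - 2 * w) * w') (at x)"
    unfolding defect_def[abs_def]
    by (rule derivative_eq_intros w_deriv refl)+ (simp add: w_def algebra_simps)
  have M_deriv: "(scale k has_real_derivative 2 * w') (at x)"
    unfolding scale_def[abs_def]
    by (rule derivative_eq_intros w_deriv refl)+ (simp add: algebra_simps)
  define Q where "Q = P k x"
  have P_deriv: "(P k has_real_derivative - w * Q / (1 + x)) (at x)"
    using P_has_derivative_slope[of x k] x P by (simp add: w_def Q_def)
  let ?D = "2 * Q * (- w * Q / (1 + x)) * (1 - (1 - x) * b / (M + 2 * w))
     + Q\<^sup>2 * ((b / (M + 2 * w)) - (1 - x) * ((p - 2 * w) * w' * (M + 2 * w) - b * (2 * w')) / (M + 2 * w)\<^sup>2)"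
  have sc: "scale k x \<noteq> 0" using E by (simp add: scale_eq)
  have num: "((\<lambda>x. (1 - x) * defect k x) has_real_derivative (1 - x) * ((p - 2 * w) * w') - b) (at x)"
  proof -
    have "((\<lambda>x. 1 - x) has_real_derivative -1) (at x)" by (auto intro!: derivative_eq_intros)
    from DERIV_mult[OF this b_deriv] show ?thesis by (simp add: b_def algebra_simps)
  qed
  have quot: "((\<lambda>x. (1 - x) * defect k x / scale k x) has_real_derivative
      (((1 - x) * ((p - 2 * w) * w') - b) * (M + 2 * w) - (1 - x) * b * (2 * w')) / ((M + 2 * w) * (M + 2 * w))) (at x)"
    using DERIV_divide[OF num M_deriv sc] by (simp add: scale_eq b_def)
  have "(amplitude k has_real_derivative
      2 * Q * (- w * Q / (1 + x)) * (1 - (1 - x) * b / (M + 2 * w)) + Q\<^sup>2 *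
      - ((((1 - x) * ((p - 2 * w) * w') - b) * (M + 2 * w) - (1 - x) * b * (2 * w')) / ((M + 2 * w) * (M + 2 * w)))) (at x)"
    using DERIV_mult[OF DERIV_power[OF P_deriv, of 2] DERIV_diff[OF DERIV_const quot, of 1]]
    unfolding amplitude_def[abs_def] by (simp add: b_def Q_def scale_eq algebra_simps)
  moreover have "- ((((1 - x) * ((p - 2 * w) * w') - b) * S - (1 - x) * b * (2 * w')) / (S * S))
      = b / S - (1 - x) * ((p - 2 * w) * w' * S - b * (2 * w')) / S\<^sup>2" if "S > 0" for S
    using that by (simp add: power2_eq_square field_simps)
  ultimately have "(amplitude k has_real_derivative ?D) (at x)" using E by simp
  moreover have "(M + 2 * w)\<^sup>2 * ?D = - Q\<^sup>2 * (amplitude_form p l w t b M)"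
  proof -
    have x_t: "2 / (1 + x) = 1 + t" and xt: "(1 - x) * (2 / (1 + x)) = 2 * t"
      using x by (simp_all add: t_def field_simps)
    have halves: "w * (1 + p * x) / y = w * (2 / y + p * (2 * x / y)) / 2" if "y \<noteq> 0" for y
      using that by (simp add: field_simps)
    have "1 - x\<^sup>2 = (1 - x) * (1 + x)" by (simp add: power2_eq_square algebra_simps)
    then have "(1 - x) * w' = ((1 + x) * l + (1 - x) * w\<^sup>2 + w * (1 + p * x)) / (1 + x)"
      using x by (simp add: w'_def)
    also have "\<dots> = l + t * w\<^sup>2 + w * (1 + p * x) / (1 + x)"
      using x by (simp add: t_def add_divide_distrib)
    also have "w * (1 + p * x) / (1 + x) = w * (2 / (1 + x) + p * (2 * x / (1 + x))) / 2"
      using halves[of "1 + x"] x by simp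
    also have "2 * x / (1 + x) = 1 - t" using x by (simp add: t_def field_simps)
    also note x_t
    finally have tw': "(1 - x) * w' = l + t * w\<^sup>2 + w * ((1 + t) + p * (1 - t)) / 2" .
    have "S\<^sup>2 * (2 * Q * (- w * Q / y) * (1 - (1 - x) * b / S)
         + Q\<^sup>2 * (b / S - (1 - x) * ((p - 2 * w) * w' * S - b * (2 * w')) / S\<^sup>2))
        = Q\<^sup>2 * (- w * (2 / y) * S\<^sup>2 + w * ((1 - x) * (2 / y)) * b * S + b * S
        - ((1 - x) * w') * ((p - 2 * w) * S - 2 * b))" if "S > 0" "y > 0" for S y
      using that by (simp add: power2_eq_square field_simps)
    from this[OF E, of "1 + x"] have "(M + 2 * w)\<^sup>2 * ?D = Q\<^sup>2 * (- w * (2 / (1 + x)) * (M + 2 * w)\<^sup>2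
        + w * ((1 - x) * (2 / (1 + x))) * b * (M + 2 * w) + b * (M + 2 * w)
        - ((1 - x) * w') * ((p - 2 * w) * (M + 2 * w) - 2 * b))"
      using x by simp
    also have "\<dots> = Q\<^sup>2 * (- w * (1 + t) * (M + 2 * w)\<^sup>2 + 2 * w * t * b * (M + 2 * w) + b * (M + 2 * w)
      - (l + t * w\<^sup>2 + w * ((1 + t) + p * (1 - t)) / 2) * ((p - 2 * w) * (M + 2 * w) - 2 * b))"
      unfolding tw' xt unfolding x_t by (simp add: algebra_simps)
    finally show ?thesis unfolding amplitude_form_identity[OF b_eq M_def] by (simp only: mult_minus_left mult_minus_right)
  qed
  then have "(M + 2 * w)\<^sup>2 * ?D \<le> 0" using G(2)[OF b0] by simp
  then have "?D \<le> 0" using E by (simp only: mult_le_0_iff) (auto simp: not_le)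
  ultimately show "\<exists>D\<le>0. (amplitude k has_real_derivative D) (at x)" by blast
qed

lemma amplitude_antimono:
  assumes ab: "-1/3 \<le> a" "a \<le> b" "b < 1" and k: "k \<ge> 2"
    and P: "\<And>x. a \<le> x \<Longrightarrow> x \<le> b \<Longrightarrow> P k x \<noteq> 0" and B: "\<And>x. a \<le> x \<Longrightarrow> x \<le> b \<Longrightarrow> defect k x \<ge> 0"
  shows "amplitude k b \<le> amplitude k a"
proof (rule DERIV_nonpos_imp_nonincreasing[OF ab(2)])
  fix x assume "a \<le> x" "x \<le> b"
  then show "\<exists>D. (amplitude k has_real_derivative D) (at x) \<and> D \<le> 0"
    using amplitude_derivative_nonpos(2)[of x k] P[of x] B[of x] ab k by force
qed

lemma amplitude_bounds:
  assumes x: "-1/3 \<le> x" "x < 1" and k: "k \<ge> 2" and P: "P k x \<noteq> 0" and B: "defect k x \<ge> 0"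
  shows "amplitude k x \<le> (P k x)\<^sup>2" "x * (P k x)\<^sup>2 \<le> amplitude k x"
proof -
  have E: "scale k x > 0" by (rule amplitude_derivative_nonpos(1)[OF assms])
  let ?l = "real k * (real k + p)" and ?w = "slope k x"
  have "(1 - x) * defect k x / scale k x \<ge> 0" using E B x by simp
  then show "amplitude k x \<le> (P k x)\<^sup>2"
    unfolding amplitude_def by (intro mult_left_le) auto
  have "scale k x - defect k x = ?l + (?w - (p - 2) / 2)\<^sup>2 + (p\<^sup>2 + 2 * p - 4) / 4"
    by (simp add: scale_def defect_def power2_eq_square field_simps)
  moreover have "p\<^sup>2 + 2 * p - 4 \<ge> 0" using p by (smt (verit) zero_le_power2)
  ultimately have "defect k x \<le> scale k x" using p by (smt (verit) divide_nonneg_nonneg mult_nonneg_nonneg of_nat_0_le_iff zero_le_power2)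
  then have "(1 - x) * (defect k x / scale k x) \<le> (1 - x) * 1"
    using E x by (intro mult_left_mono) auto
  then have "x \<le> 1 - (1 - x) * defect k x / scale k x" by simp
  then show "x * (P k x)\<^sup>2 \<le> amplitude k x"
    unfolding amplitude_def by (metis mult.commute mult_left_mono zero_le_power2)
qed

lemma amplitude_at_tie:
  assumes "x < 1" "P (Suc k) x < 0" "P k x = P (Suc k) x \<or> P (Suc (Suc k)) x = P (Suc k) x"
  shows "amplitude (Suc k) x = (P (Suc k) x)\<^sup>2"
proof -
  have "defect (Suc k) x = 0"
    using assms(3)
  proof
    assume "P k x = P (Suc k) x"
    then show ?thesis using slope_lower[of k x] assms(1,2) by (simp add: defect_factors)
  next
    assume "P (Suc (Suc k)) x = P (Suc k) x"
    then show ?thesis using slope_upper[of "Suc k" x] assms(1,2) by (simp add: defect_factors)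
  qed
  then show ?thesis by (simp add: amplitude_def)
qed

text \<open>
  The amplitude of \<open>P\<^bsub>k+1\<^esub>\<close> decreases from \<open>c\<close> to \<open>c'\<close>, where it equals the squares of the common values, and lies between
  \<open>x * P\<^bsub>k+1\<^esub>(x)\<^sup>2\<close> and \<open>P\<^bsub>k+1\<^esub>(x)\<^sup>2\<close>. The last bound comes from \<open>slope \<le> k + 1 + p\<close>.
\<close>

lemma between_crossings:
  assumes c: "is_crossing k c" and c': "is_crossing (Suc k) c'" and x: "c \<le> x" "x \<le> c'" and k: "k \<ge> 1"
  shows "(P (Suc k) c')\<^sup>2 \<le> (P (Suc k) x)\<^sup>2" "x * (P (Suc k) x)\<^sup>2 \<le> (P k c)\<^sup>2"
    "P k x - P (Suc k) x \<le> (1 - x) * - P (Suc k) x * (2 + p)"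
proof -
  have "- 1 / (p + 2) \<ge> - 1 / 3" using p by (simp add: field_simps)
  then have third: "-1/3 \<le> c" using c by (simp add: is_crossing_def)
  have c'1: "c' < 1" using c' by (simp add: is_crossing_def)
  have signs: "P (Suc k) y < 0" "defect (Suc k) y \<ge> 0" "slope (Suc k) y \<le> real (Suc k) + p"
    if "c \<le> y" "y \<le> c'" for y
    using signs_between_crossings[OF c c' that] slope_bounds[of y k] that c'1 by auto
  have anti: "amplitude (Suc k) z \<le> amplitude (Suc k) y" if "c \<le> y" "y \<le> z" "z \<le> c'" for y z
  proof (rule amplitude_antimono)
    show "-1/3 \<le> y" "y \<le> z" "z < 1" "2 \<le> Suc k" using that third c'1 k by auto
    show "P (Suc k) u \<noteq> 0" "0 \<le> defect (Suc k) u" if u: "y \<le> u" "u \<le> z" for u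
      using signs[of u] \<open>c \<le> y\<close> \<open>z \<le> c'\<close> u by auto
  qed
  have c_tie: "amplitude (Suc k) c = (P k c)\<^sup>2"
    using amplitude_at_tie[of c k] c x signs(1)[of c] by (auto simp: is_crossing_def)
  have c'_tie: "amplitude (Suc k) c' = (P (Suc k) c')\<^sup>2"
    using amplitude_at_tie[of c' k] c' x signs(1)[of c'] by (auto simp: is_crossing_def)
  have bounds: "amplitude (Suc k) x \<le> (P (Suc k) x)\<^sup>2" "x * (P (Suc k) x)\<^sup>2 \<le> amplitude (Suc k) x"
    using amplitude_bounds[of x "Suc k"] signs[OF x] third x c'1 k by auto
  show "(P (Suc k) c')\<^sup>2 \<le> (P (Suc k) x)\<^sup>2" using bounds(1) anti[of x c'] x c'_tie by simp
  show "x * (P (Suc k) x)\<^sup>2 \<le> (P k c)\<^sup>2" using bounds(2) anti[of c x] x c_tie by simp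
  have "1 * p \<le> real (Suc k) * p" using p by (intro mult_right_mono) auto
  then have "real (Suc k) + (real (Suc k) + p) \<le> real (Suc k) * (2 + p)" by (simp add: algebra_simps)
  then have "real (Suc k) + slope (Suc k) x \<le> real (Suc k) * (2 + p)" using signs(3)[OF x] by simp
  moreover have "- ((1 - x) * P (Suc k) x) \<ge> 0" using signs(1)[OF x] x c'1 by (simp add: mult_le_0_iff)
  ultimately have "real (Suc k) * (P k x - P (Suc k) x) \<le> - ((1 - x) * P (Suc k) x) * (real (Suc k) * (2 + p))"
    using slope_lower[of k x] signs(1)[OF x] by (metis less_irrefl mult_left_mono)
  then have "real (Suc k) * (P k x - P (Suc k) x) \<le> real (Suc k) * ((1 - x) * - P (Suc k) x * (2 + p))"
    by (simp add: algebra_simps)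
  then show "P k x - P (Suc k) x \<le> (1 - x) * - P (Suc k) x * (2 + p)"
    by (rule mult_left_le_imp_le) simp
qed

text \<open>
  Right of the crossing the inequalities are part of its definition; at the crossing they follow by continuity.
\<close>

lemma decreasing_in_degree:
  assumes c: "is_crossing k c" and x: "c \<le> x" "x < 1" and "l \<le> k"
  shows "P k x \<le> P l x"
proof -
  have step: "P (Suc j) x \<le> P j x" if j: "j \<le> k" for j
  proof -
    let ?f = "\<lambda>y. P j y - P (Suc j) y"
    have "(?f \<longlongrightarrow> ?f x) (at_right x)"
      using continuous_on_tendsto_compose[of UNIV ?f "\<lambda>y. y" x] by (auto intro!: tendsto_intros)
    moreover have "eventually (\<lambda>y. 0 \<le> ?f y) (at_right x)"
      unfolding eventually_at_right[OF x(2)] using c x j by (intro exI[of _ 1]) (force simp: is_crossing_def)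
    ultimately have "0 \<le> ?f x" by (intro tendsto_lowerbound) auto
    then show ?thesis by simp
  qed
  have "m \<le> k \<longrightarrow> P m x \<le> P l x" if "l \<le> m" for m
    using that by (induction rule: dec_induct) (use step in \<open>force dest: Suc_leD\<close>)+
  then show ?thesis using \<open>l \<le> k\<close> by blast
qed

text \<open>
  For \<open>l \<le> k\<close> the value \<open>P\<^sub>l(x)\<close> lies above \<open>P\<^bsub>k+1\<^esub>(x)\<close>. For larger \<open>l\<close> the energy of degree \<open>k\<close> bounds it: since \<open>P\<^sub>k(x)\<close> and
  \<open>P\<^bsub>k+1\<^esub>(x)\<close> differ by \<open>O(1 - x)\<close>, this energy is at most \<open>(1 - x) * P\<^bsub>k+1\<^esub>(x)\<^sup>2 * (2 + O(1 - x))\<close>. The fraction tends to \<open>1\<close> as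
  \<open>x\<close> tends to \<open>1\<close>.
\<close>

lemma lower_bound_between_crossings:
  assumes c: "is_crossing k c" and c': "is_crossing (Suc k) c'" and x: "c \<le> x" "x \<le> c'" and k: "k \<ge> 1"
    and x0: "0 < x"
  shows "(P l x < 0 \<longrightarrow> (P l x)\<^sup>2 \<le> (P k c)\<^sup>2 * ((2 + (1 - x) * (2 + p)\<^sup>2) / (x * (1 + x))))"
proof
  assume neg: "P l x < 0"
  let ?H = "(2 + (1 - x) * (2 + p)\<^sup>2) / (x * (1 + x))"
  let ?v = "P (Suc k) x"
  have x1: "x < 1" using c' x by (simp add: is_crossing_def)
  note signs = signs_between_crossings[OF c c' x]
  have "(P l x)\<^sup>2 \<le> ?v\<^sup>2 * ((2 + (1 - x) * (2 + p)\<^sup>2) / (1 + x))"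
  proof (cases "l \<le> k")
    case True
    then have "P k x \<le> P l x" using decreasing_in_degree[OF c x(1) x1] by blast
    then have "\<bar>P l x\<bar> \<le> \<bar>?v\<bar>" using signs neg by simp
    then have "(P l x)\<^sup>2 \<le> ?v\<^sup>2" by (simp only: abs_le_square_iff)
    moreover have "?v\<^sup>2 * 1 \<le> ?v\<^sup>2 * ((2 + (1 - x) * (2 + p)\<^sup>2) / (1 + x))"
    proof (intro mult_left_mono)
      have "(1 - x) * (2 + p)\<^sup>2 \<ge> 0" using x1 by simp
      then have "1 + x \<le> 2 + (1 - x) * (2 + p)\<^sup>2" using x1 by linarith
      then show "1 \<le> (2 + (1 - x) * (2 + p)\<^sup>2) / (1 + x)" using x0 by simp
    qed simp
    ultimately show ?thesis by simp
  next
    case False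
    let ?d = "P k x - ?v"
    have d: "0 \<le> ?d" "?d \<le> (1 - x) * - ?v * (2 + p)"
      using signs between_crossings(3)[OF c c' x k] by auto
    have "(1 - x\<^sup>2) * (P l x)\<^sup>2 \<le> energy k x"
      using energy_ge[of x l] energy_antimono[of k l x] False by linarith
    also have "energy k x = ?d\<^sup>2 + 2 * (1 - x) * (?v * ?v + ?d * ?v)"
      by (simp add: energy_def power2_eq_square algebra_simps)
    also have "\<dots> \<le> ((1 - x) * - ?v * (2 + p))\<^sup>2 + 2 * (1 - x) * (?v * ?v + 0)"
    proof -
      have "?d\<^sup>2 \<le> ((1 - x) * - ?v * (2 + p))\<^sup>2" using d by (intro power_mono) simp_all
      moreover have "?d * ?v \<le> 0" using d(1) signs(3) by (intro mult_nonneg_nonpos) simp_all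
      then have "2 * (1 - x) * (?v * ?v + ?d * ?v) \<le> 2 * (1 - x) * (?v * ?v + 0)"
        using x1 by (intro mult_left_mono) simp_all
      ultimately show ?thesis by (rule add_mono)
    qed
    also have "\<dots> = (1 - x) * (?v\<^sup>2 * (2 + (1 - x) * (2 + p)\<^sup>2))"
      by (simp add: power2_eq_square algebra_simps)
    also have "(1 - x\<^sup>2) * (P l x)\<^sup>2 = (1 - x) * ((1 + x) * (P l x)\<^sup>2)"
      by (simp add: power2_eq_square algebra_simps)
    finally have "(1 + x) * (P l x)\<^sup>2 \<le> ?v\<^sup>2 * (2 + (1 - x) * (2 + p)\<^sup>2)"
      by (rule mult_left_le_imp_le) (use x1 in simp)
    then show ?thesis using x0 by (simp add: field_simps)
  qed
  also have "\<dots> = (x * ?v\<^sup>2) * ?H" using x0 by simp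
  also have "\<dots> \<le> (P k c)\<^sup>2 * ?H"
    using between_crossings(2)[OF c c' x k] x0 x1 by (intro mult_right_mono) auto
  finally show "(P l x)\<^sup>2 \<le> (P k c)\<^sup>2 * ?H" .
qed

text \<open>
  The number \<open>j\<close> is the limit of the values at the crossings, which increase by \<open>between_crossings\<close>.
\<close>

lemma minimum_over_degrees:
  obtains j where "j \<le> 0"
    "\<And>u. -1 \<le> u \<Longrightarrow> u < 1 \<Longrightarrow> \<exists>k\<ge>1. P k u \<le> j"
    "\<And>\<epsilon>. \<epsilon> > 0 \<Longrightarrow> \<exists>t0<1. \<forall>t l. t0 < t \<and> t < 1 \<longrightarrow> j - \<epsilon> \<le> P l t"
proof -
  obtain c where c: "\<And>n. is_crossing (Suc n) (c n)" "\<And>n. c n < c (Suc n)" "c 0 = - 1 / (p + 2)"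
    by (rule crossings_exist) blast
  define v where "v n = P (Suc n) (c n)" for n
  have v_neg: "v n < 0" for n using c(1)[of n] by (simp add: v_def is_crossing_def)
  have c_mono: "mono c" using c(2) by (simp add: incseq_SucI less_imp_le)
  have interval: "\<exists>m\<ge>n. c m \<le> u \<and> u \<le> c (Suc m)" if "c n \<le> u" "u < 1" for n u
  proof -
    obtain N where N: "u \<le> c N" using crossings_tend_to_1[OF c(1) \<open>u < 1\<close>] by blast
    \<comment> \<open>The interval between consecutive crossings, from index \<open>n\<close> on, that contains \<open>u\<close>.\<close>
    define m where "m = (LEAST m. u \<le> c (Suc m) \<and> n \<le> m)"
    have "u \<le> c (Suc (max n N)) \<and> n \<le> max n N"
      using order_trans[OF N monoD[OF c_mono]] by simp
    then have m: "u \<le> c (Suc m)" "n \<le> m" unfolding m_def by (metis (mono_tags, lifting) LeastI)+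
    have "c m \<le> u"
    proof (cases "m = n")
      case False
      then have "\<not> (u \<le> c (Suc (m - 1)) \<and> n \<le> m - 1)"
        unfolding m_def using m by (intro not_less_Least) (auto simp: m_def)
      then show ?thesis using False m by auto
    qed (use that in simp)
    then show ?thesis using m by blast
  qed
  have below: "P (Suc (Suc m)) u \<le> v (Suc m)" if "c m \<le> u" "u \<le> c (Suc m)" for m u
  proof -
    have "(v (Suc m))\<^sup>2 \<le> (P (Suc (Suc m)) u)\<^sup>2"
      unfolding v_def by (rule between_crossings(1)[OF c(1) c(1) that]) simp
    then have "\<bar>v (Suc m)\<bar> \<le> \<bar>P (Suc (Suc m)) u\<bar>" by (simp only: abs_le_square_iff)
    then show ?thesis using signs_between_crossings(3)[OF c(1) c(1) that] v_neg[of "Suc m"] by simp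
  qed
  have "v n \<le> v (Suc n)" for n
    using below[of n "c n"] c(1)[of n] c(2)[of n] by (simp add: v_def is_crossing_def)
  then have v_mono: "mono v" by (simp add: incseq_SucI)
  obtain j where j: "v \<longlonglongrightarrow> j" "\<And>n. v n \<le> j"
    using incseq_convergent[OF v_mono, of 0] v_neg by (metis less_imp_le)
  show thesis
  proof
    show "j \<le> 0" using LIMSEQ_le_const2[OF j(1)] v_neg by (metis less_imp_le)
    show "\<exists>k\<ge>1. P k u \<le> j" if u: "-1 \<le> u" "u < 1" for u
    proof (cases "u \<le> c 0")
      case True
      then have "P 1 u \<le> v 0" by (simp add: v_def)
      then show ?thesis using j(2)[of 0] by (intro exI[of _ 1]) simp
    next
      case False
      then obtain m where "c m \<le> u" "u \<le> c (Suc m)" using interval[of 0 u] u by auto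
      then have "P (Suc (Suc m)) u \<le> j" using below[of m u] j(2)[of "Suc m"] by simp
      then show ?thesis by (intro exI[of _ "Suc (Suc m)"]) simp
    qed
    fix \<epsilon> :: real assume \<epsilon>: "\<epsilon> > 0"
    \<comment> \<open>The factor in \<open>lower_bound_between_crossings\<close>, equal to \<open>1\<close> at \<open>t = 1\<close>.\<close>
    let ?H = "\<lambda>t. (2 + (1 - t) * (2 + p)\<^sup>2) / (t * (1 + t))"
    have "eventually (\<lambda>n. v n > j - \<epsilon> / 2) sequentially"
      using order_tendstoD(1)[OF j(1)] \<epsilon> by simp
    then obtain N where N: "v N > j - \<epsilon> / 2" by (auto simp: eventually_sequentially)
    have "((\<lambda>t. - (sqrt ((v N)\<^sup>2 * ?H t))) \<longlongrightarrow> - (sqrt ((v N)\<^sup>2 * ?H 1))) (at_left 1)"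
      by (intro tendsto_intros) auto
    then have "((\<lambda>t. - (sqrt ((v N)\<^sup>2 * ?H t))) \<longlongrightarrow> v N) (at_left 1)" using v_neg[of N] by simp
    then have "eventually (\<lambda>t. j - \<epsilon> < - (sqrt ((v N)\<^sup>2 * ?H t))) (at_left 1)"
    proof (rule order_tendstoD(1))
      show "j - \<epsilon> < v N" using N \<epsilon> by linarith
    qed
    then obtain t1 where t1: "t1 < 1" "\<And>t. t1 < t \<Longrightarrow> t < 1 \<Longrightarrow> j - \<epsilon> < - (sqrt ((v N)\<^sup>2 * ?H t))"
      unfolding eventually_at_left[OF zero_less_one] by auto
    define t0 where "t0 = max (max t1 0) (c N)"
    have "j - \<epsilon> \<le> P l t" if t: "t0 < t" "t < 1" for l t
    proof (cases "P l t < 0")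
      case False
      then show ?thesis using \<open>j \<le> 0\<close> \<epsilon> by simp
    next
      case True
      have "c N \<le> t" "0 < t" "t1 < t" using t by (auto simp: t0_def)
      then obtain m where m: "m \<ge> N" "c m \<le> t" "t \<le> c (Suc m)" using interval[of N t] t by auto
      have "?H t \<ge> 0" using t \<open>0 < t\<close> by auto
      have "(P l t)\<^sup>2 \<le> (v m)\<^sup>2 * ?H t"
        unfolding v_def using lower_bound_between_crossings[OF c(1) c(1) m(2,3) _ \<open>0 < t\<close>] True by simp
      also have "\<dots> \<le> (v N)\<^sup>2 * ?H t"
      proof (intro mult_right_mono)
        have "\<bar>v m\<bar> \<le> \<bar>v N\<bar>" using monoD[OF v_mono m(1)] v_neg[of m] by simp
        then show "(v m)\<^sup>2 \<le> (v N)\<^sup>2" by (simp only: abs_le_square_iff)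
      qed fact
      finally have "\<bar>P l t\<bar> \<le> sqrt ((v N)\<^sup>2 * ?H t)" by (metis real_sqrt_abs real_sqrt_le_mono)
      then show ?thesis using t1(2)[OF \<open>t1 < t\<close> t(2)] by linarith
    qed
    moreover have "t0 < 1" using t1 c(1)[of N] by (simp add: t0_def is_crossing_def)
    ultimately show "\<exists>t0<1. \<forall>t l. t0 < t \<and> t < 1 \<longrightarrow> j - \<epsilon> \<le> P l t" by blast
  qed
qed

end

section \<open>Invariance of the surface measure\<close>

lemma nn_integral_lborel_translate:
  fixes g :: "'a::euclidean_space \<Rightarrow> ennreal"
  assumes [measurable]: "g \<in> borel_measurable borel"
  shows "(\<integral>\<^sup>+x. g (x + a) \<partial>lborel) = (\<integral>\<^sup>+x. g x \<partial>lborel)"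
proof -
  have "(\<integral>\<^sup>+x. g x \<partial>lborel) = (\<integral>\<^sup>+x. g x \<partial>(distr lborel borel ((+) a)))"
    by (simp add: lborel_distr_plus)
  also have "\<dots> = (\<integral>\<^sup>+x. g (x + a) \<partial>lborel)" by (subst nn_integral_distr) (auto simp: add.commute)
  finally show ?thesis by simp
qed

text \<open>
  The image measure is translation invariant, and so proportional to Lebesgue measure: integrating the indicator of
  \<open>f y \<in> B \<and> x + f y \<in> A\<close> in both orders gives the factor. The unit ball \<open>B\<close>, which \<open>f\<close> preserves, shows that it is \<open>1\<close>.
\<close>

lemma distr_lborel_orthogonal:
  fixes f :: "'a::euclidean_space \<Rightarrow> 'a"
  assumes f: "orthogonal_transformation f"
  shows "distr lborel borel f = lborel"
proof (rule measure_eqI)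
  let ?B = "ball (0::'a) 1" and ?c = "emeasure lborel (ball (0::'a) 1)"
  have lin: "linear f" using f by (rule orthogonal_transformation_linear)
  have cont: "continuous_on UNIV f"
    using lin by (simp add: linear_continuous_on linear_conv_bounded_linear)
  then have f_meas[measurable]: "f \<in> borel_measurable borel" by (rule borel_measurable_continuous_onI)
  have surj: "surj f" by (rule orthogonal_transformation_surj[OF f])
  have norm_f: "norm (f y) = norm y" for y by (rule orthogonal_transformation_norm[OF f])
  fix A assume "A \<in> sets (distr lborel borel f)"
  then have A[measurable]: "A \<in> sets borel" by simp
  have B[measurable]: "?B \<in> sets borel" by simp
  have "?c * emeasure lborel A = (\<integral>\<^sup>+y. indicator ?B (f y) * emeasure lborel A \<partial>lborel)"
    by (subst nn_integral_multc) (auto simp: indicator_def norm_f intro!: nn_integral_cong simp flip: nn_integral_indicator)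
  also have "\<dots> = (\<integral>\<^sup>+y. (\<integral>\<^sup>+x. indicator ?B (f y) * indicator A (x + f y) \<partial>lborel) \<partial>lborel)"
    by (simp add: nn_integral_cmult nn_integral_lborel_translate)
  also have "\<dots> = (\<integral>\<^sup>+x. (\<integral>\<^sup>+y. indicator ?B (f y) * indicator A (x + f y) \<partial>lborel) \<partial>lborel)"
    by (rule lborel_pair.Fubini') measurable
  also have "\<dots> = (\<integral>\<^sup>+x. (\<integral>\<^sup>+y. indicator ?B (f y - x) * indicator A (f y) \<partial>lborel) \<partial>lborel)"
  proof (rule nn_integral_cong)
    fix x
    obtain x' where x': "x = f x'" using surj by (metis surjD)
    have "(\<integral>\<^sup>+y. indicator ?B (f y - x) * indicator A (f y) \<partial>lborel)
        = (\<integral>\<^sup>+y. indicator ?B (f (y + x') - x) * indicator A (f (y + x')) \<partial>lborel)"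
      by (rule nn_integral_lborel_translate[symmetric]) measurable
    then show "(\<integral>\<^sup>+y. indicator ?B (f y) * indicator A (x + f y) \<partial>lborel)
        = (\<integral>\<^sup>+y. indicator ?B (f y - x) * indicator A (f y) \<partial>lborel)"
      by (simp add: x' linear_add[OF lin] add.commute)
  qed
  also have "\<dots> = (\<integral>\<^sup>+y. (\<integral>\<^sup>+x. indicator ?B (f y - x) * indicator A (f y) \<partial>lborel) \<partial>lborel)"
    by (rule lborel_pair.Fubini') measurable
  also have "\<dots> = (\<integral>\<^sup>+y. ?c * indicator A (f y) \<partial>lborel)"
  proof (rule nn_integral_cong)
    fix y
    have "(\<integral>\<^sup>+x. indicator ?B (f y - x) * indicator A (f y) \<partial>lborel)
        = (\<integral>\<^sup>+x. indicator ?B (x + - f y) \<partial>lborel) * indicator A (f y)"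
      by (subst nn_integral_multc[symmetric]) (auto intro!: nn_integral_cong simp: indicator_def norm_minus_commute)
    also have "(\<integral>\<^sup>+x. indicator ?B (x + - f y) \<partial>lborel) = ?c"
      by (subst nn_integral_lborel_translate) simp_all
    finally show "(\<integral>\<^sup>+x. indicator ?B (f y - x) * indicator A (f y) \<partial>lborel) = ?c * indicator A (f y)" .
  qed
  also have "\<dots> = ?c * emeasure (distr lborel borel f) A"
  proof -
    have "(\<integral>\<^sup>+y. indicator A (f y) \<partial>lborel) = (\<integral>\<^sup>+y. indicator A y \<partial>(distr lborel borel f))"
      by (subst nn_integral_distr) auto
    then show ?thesis by (simp add: nn_integral_cmult)
  qed
  finally have "?c * emeasure lborel A = ?c * emeasure (distr lborel borel f) A" .
  moreover have "?c \<noteq> 0" "?c \<noteq> \<infinity>"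
    using emeasure_lborel_ball_finite[of "0::'a" 1] content_ball_pos[of 1 "0::'a"]
    by (auto simp: measure_def)
  ultimately show "emeasure (distr lborel borel f) A = emeasure lborel A"
    by (simp add: ennreal_mult_cancel_left)
qed simp

abbreviation surface_integral :: "('a::euclidean_space \<Rightarrow> real) \<Rightarrow> real" (binder "\<integral>\<^sub>S" 10) where
  "surface_integral f \<equiv> \<integral>x. f x \<partial>surface_measure"

abbreviation continuous_kernel :: "('a::euclidean_space \<Rightarrow> 'a \<Rightarrow> real) \<Rightarrow> bool" where
  "continuous_kernel K \<equiv> continuous_on (sphere 0 1 \<times> sphere 0 1) (\<lambda>(x, y). K x y)"

lemma space_surface_measure [simp]: "space surface_measure = sphere (0::'a::euclidean_space) 1"
  by (simp add: surface_measure_def space_scale_measure space_restrict_space)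

lemma sets_surface_measure [measurable_cong]:
  "sets surface_measure = sets (restrict_space borel (sphere (0::'a::euclidean_space) 1))"
  by (simp add: surface_measure_def)

lemma sets_surface_measure_iff:
  "A \<in> sets surface_measure \<longleftrightarrow> A \<in> sets borel \<and> A \<subseteq> sphere (0::'a::euclidean_space) 1"
  by (auto simp: sets_surface_measure sets_restrict_space_iff)

lemma sgn_borel_measurable [measurable]: "sgn \<in> borel_measurable (borel :: 'a::euclidean_space measure)"
  unfolding sgn_div_norm by measurable

lemma emeasure_surface_measure_sgn:
  fixes A :: "'a::euclidean_space set"
  assumes A: "A \<in> sets surface_measure"
  shows "emeasure surface_measure A = of_nat DIM('a) * emeasure lborel (sgn -` A \<inter> (ball 0 1 - {0}))"
proof -
  have A': "A \<in> sets (restrict_space borel (sphere 0 1))" using A by (simp add: sets_surface_measure)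
  show ?thesis
    by (simp add: surface_measure_def emeasure_distr[OF sgn_measurable_sphere A'] space_restrict_space
        emeasure_restrict_space)
qed

lemma finite_surface_measure: "finite_measure (surface_measure :: 'a::euclidean_space measure)"
proof
  have "emeasure lborel (sgn -` sphere (0::'a) 1 \<inter> (ball 0 1 - {0})) \<le> emeasure lborel (ball (0::'a) 1)"
    by (intro emeasure_mono) auto
  also have "\<dots> < \<infinity>" by (rule emeasure_lborel_ball_finite)
  finally have "emeasure lborel (sgn -` sphere (0::'a) 1 \<inter> (ball 0 1 - {0})) \<noteq> \<infinity>" by simp
  then show "emeasure surface_measure (space (surface_measure :: 'a measure)) \<noteq> (\<infinity> :: ennreal)"
    by (auto simp: emeasure_surface_measure_sgn sets_surface_measure_iff closed_sphere borel_closed ennreal_mult_eq_top_iff)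
qed

interpretation surface: finite_measure "surface_measure :: 'a::euclidean_space measure"
  by (rule finite_surface_measure)

lemma surface_measure_open_pos:
  fixes U :: "'a::euclidean_space set"
  assumes U: "open U" "e \<in> U" "norm e = 1"
  shows "measure surface_measure (U \<inter> sphere 0 1) > 0"
proof -
  have A: "U \<inter> sphere 0 1 \<in> sets surface_measure" using U by (auto simp: sets_surface_measure_iff)
  let ?V = "sgn -` U \<inter> (ball 0 1 - {0})"
  have cont: "continuous_on (ball 0 1 - {0}) (sgn :: 'a \<Rightarrow> 'a)"
    unfolding sgn_div_norm by (auto intro!: continuous_intros)
  have "open ?V"
    using continuous_open_preimage[OF cont _ U(1)] by (simp add: Int_commute open_delete)
  moreover have "(1/2) *\<^sub>R e \<in> ?V" using U by (auto simp: sgn_div_norm)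
  ultimately obtain r where r: "r > 0" "ball ((1/2) *\<^sub>R e) r \<subseteq> ?V" by (meson openE)
  have "0 < emeasure lborel (ball ((1/2) *\<^sub>R e) r)"
    using content_ball_pos[OF r(1), of "(1/2) *\<^sub>R e"] by (auto simp: measure_def zero_less_iff_neq_zero)
  also have "\<dots> \<le> emeasure lborel ?V"
    using r \<open>open ?V\<close> by (intro emeasure_mono) auto
  also have "?V = sgn -` (U \<inter> sphere 0 1) \<inter> (ball 0 1 - {0})" by (auto simp: norm_sgn)
  finally have "emeasure surface_measure (U \<inter> sphere 0 1) > 0"
    unfolding emeasure_surface_measure_sgn[OF A] by (simp add: ennreal_zero_less_mult_iff)
  then show ?thesis by (simp add: surface.emeasure_eq_measure)
qed

lemma measurable_sphere:
  assumes "continuous_on (sphere 0 1) g"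
  shows "g \<in> borel_measurable (surface_measure :: 'a::euclidean_space measure)"
proof -
  have "g \<in> borel_measurable (restrict_space borel (sphere 0 1))"
    by (rule borel_measurable_continuous_on_restrict[OF assms])
  then show ?thesis by (simp add: sets_surface_measure cong: measurable_cong_sets)
qed

lemma integrable_sphere:
  fixes g :: "'a::euclidean_space \<Rightarrow> real"
  assumes "continuous_on (sphere 0 1) g"
  shows "integrable surface_measure g"
proof -
  have "compact (g ` sphere 0 1)" by (intro compact_continuous_image assms) simp
  then obtain b where "\<And>x. x \<in> sphere 0 1 \<Longrightarrow> norm (g x) \<le> b"
    using compact_imp_bounded bounded_iff by (metis imageI)
  then show ?thesis
    by (intro surface.integrable_const_bound[of _ b] AE_I2 measurable_sphere assms) auto
qed

lemma integral_surface_cong: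
  assumes "\<And>x. norm x = 1 \<Longrightarrow> f x = g x"
  shows "(\<integral>x. f x \<partial>(surface_measure :: 'a::euclidean_space measure)) = (\<integral>\<^sub>S x. g x)"
  by (rule Bochner_Integration.integral_cong) (auto simp: assms)

lemma integral_surface_orthogonal:
  fixes g :: "'a::euclidean_space \<Rightarrow> real" and f :: "'a \<Rightarrow> 'a"
  assumes f: "orthogonal_transformation f" and g: "continuous_on (sphere 0 1) g"
  shows "(\<integral>\<^sub>S x. g (f x)) = (\<integral>\<^sub>S x. g x)"
proof -
  have lin: "linear f" using f by (rule orthogonal_transformation_linear)
  have norm_f: "norm (f y) = norm y" for y by (rule orthogonal_transformation_norm[OF f])
  have cont: "continuous_on UNIV f"
    using lin by (simp add: linear_continuous_on linear_conv_bounded_linear)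
  then have f_borel[measurable]: "f \<in> borel_measurable borel" by (rule borel_measurable_continuous_onI)
  have f_meas: "f \<in> surface_measure \<rightarrow>\<^sub>M surface_measure"
  proof -
    have "f \<in> restrict_space borel (sphere 0 1) \<rightarrow>\<^sub>M restrict_space borel (sphere 0 1)"
      by (intro measurable_restrict_space2 measurable_restrict_space1) (auto simp: space_restrict_space norm_f)
    then show ?thesis by (simp add: sets_surface_measure cong: measurable_cong_sets)
  qed
  have "distr surface_measure surface_measure f = surface_measure"
  proof (rule measure_eqI)
    fix A :: "'a set" assume "A \<in> sets (distr surface_measure surface_measure f)"
    then have A: "A \<in> sets surface_measure" by simp
    then have A': "A \<in> sets borel" by (simp add: sets_surface_measure_iff)
    let ?C = "\<lambda>A. sgn -` A \<inter> (ball (0::'a) 1 - {0})"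
    have C: "?C A \<in> sets borel"
    proof -
      have "sgn -` A \<in> sets (borel :: 'a measure)" using measurable_sets_borel[OF sgn_borel_measurable A'] by simp
      then show ?thesis by (intro sets.Int) auto
    qed
    have "f -` A \<inter> sphere 0 1 \<in> sets surface_measure"
      using measurable_sets[OF f_meas A] by simp
    then have "emeasure (distr surface_measure surface_measure f) A
        = of_nat DIM('a) * emeasure lborel (?C (f -` A \<inter> sphere 0 1))"
      using f_meas A by (simp add: emeasure_distr emeasure_surface_measure_sgn)
    also have "?C (f -` A \<inter> sphere 0 1) = f -` ?C A"
    proof -
      have "sgn (f x) = f (sgn x)" for x by (simp add: sgn_div_norm norm_f linear_scale[OF lin])
      moreover have "f x = 0 \<longleftrightarrow> x = 0" for x by (metis norm_eq_zero norm_f)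
      ultimately show ?thesis by (auto simp: norm_f norm_sgn)
    qed
    also have "emeasure lborel (f -` ?C A) = emeasure (distr lborel borel f) (?C A)"
      using C by (simp add: emeasure_distr)
    also have "\<dots> = emeasure lborel (?C A)" by (simp add: distr_lborel_orthogonal[OF f])
    also have "of_nat DIM('a) * \<dots> = emeasure surface_measure A"
      by (simp add: emeasure_surface_measure_sgn[OF A])
    finally show "emeasure (distr surface_measure surface_measure f) A = emeasure surface_measure A" .
  qed simp
  then have "(\<integral>\<^sub>S x. g x) = (\<integral>x. g x \<partial>(distr surface_measure surface_measure f))" by simp
  also have "\<dots> = (\<integral>\<^sub>S x. g (f x))"
    by (rule integral_distr[OF f_meas measurable_sphere[OF g]])
  finally show ?thesis by simp
qed

lemma integral_surface_nonneg:
  fixes g :: "'a::euclidean_space \<Rightarrow> real"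
  assumes "\<And>x. norm x = 1 \<Longrightarrow> g x \<ge> 0"
  shows "(\<integral>\<^sub>S x. g x) \<ge> 0"
  using assms by (intro integral_nonneg_AE AE_I2) simp

lemma integral_surface_mono:
  fixes f g :: "'a::euclidean_space \<Rightarrow> real"
  assumes "continuous_on (sphere 0 1) f" "continuous_on (sphere 0 1) g" "\<And>x. norm x = 1 \<Longrightarrow> f x \<le> g x"
  shows "(\<integral>\<^sub>S x. f x) \<le> (\<integral>\<^sub>S x. g x)"
  using assms by (intro integral_mono integrable_sphere) simp_all

lemma integral_surface_pos:
  fixes g :: "'a::euclidean_space \<Rightarrow> real"
  assumes g: "continuous_on (sphere 0 1) g" "\<And>x. norm x = 1 \<Longrightarrow> g x \<ge> 0" and e: "norm e = 1" "g e > 0"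
  shows "(\<integral>\<^sub>S x. g x) > 0"
proof -
  obtain d where d: "d > 0" "\<And>x. norm x = 1 \<Longrightarrow> dist x e < d \<Longrightarrow> dist (g x) (g e) < g e / 2"
    using g(1) e unfolding continuous_on_iff by (metis half_gt_zero mem_sphere_0)
  have "0 < g e / 2 * measure surface_measure (ball e d \<inter> sphere 0 1)"
    using surface_measure_open_pos[of "ball e d" e] d e by simp
  also have "\<dots> = (\<integral>\<^sub>S x. g e / 2 * indicator (ball e d \<inter> sphere 0 1) x)"
    by (simp add: sets_surface_measure_iff)
  also have "\<dots> \<le> (\<integral>\<^sub>S x. g x)"
  proof (rule integral_mono)
    show "integrable surface_measure (\<lambda>x. g e / 2 * indicator (ball e d \<inter> sphere 0 1) x)"
      by (intro integrable_mult_right integrable_real_indicator)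
         (auto simp: sets_surface_measure_iff surface.emeasure_finite less_top[symmetric])
    show "g e / 2 * indicator (ball e d \<inter> sphere 0 1) x \<le> g x" if "x \<in> space surface_measure" for x
    proof (cases "x \<in> ball e d")
      case True
      then have "\<bar>g x - g e\<bar> < g e / 2" using d(2)[of x] that by (simp add: dist_commute dist_real_def abs_minus_commute)
      then have "g e / 2 \<le> g x" by linarith
      then show ?thesis using that True by simp
    qed (use g(2)[of x] that in simp)
  qed (rule integrable_sphere[OF g(1)])
  finally show ?thesis .
qed

lemma surface_measure_pos: "measure surface_measure (sphere (0::'a::euclidean_space) 1) > 0"
proof -
  obtain e :: 'a where "norm e = 1" by (metis norm_Basis SOME_Basis)
  then show ?thesis using surface_measure_open_pos[of UNIV e] by simp
qed

section \<open>Zonal integrals and moments\<close>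

lemma reflection_exists:
  fixes a b :: "'a::euclidean_space"
  assumes "norm a = norm b"
  obtains f where "orthogonal_transformation f" "f a = b" "\<And>z. z \<bullet> a = z \<bullet> b \<Longrightarrow> f z = z"
proof -
  define v where "v = a - b"
  define f where "f z = z - (2 * (z \<bullet> v) / (v \<bullet> v)) *\<^sub>R v" for z
  define c where "c z = 2 * (z \<bullet> v) / (v \<bullet> v)" for z
  have f: "f z = z - c z *\<^sub>R v" for z by (simp add: f_def c_def)
  have c: "c (z + w) = c z + c w" "c (r *\<^sub>R z) = r * c z" for z w r
    by (simp_all add: c_def inner_add_left distrib_left add_divide_distrib)
  have lin: "linear f"
    by (rule linearI) (simp_all only: f c scaleR_add_left scaleR_diff_right scaleR_scaleR, simp_all)
  have cv: "c z * (v \<bullet> v) = 2 * (z \<bullet> v)" for z by (simp add: c_def)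
  have "f z \<bullet> f w = z \<bullet> w" for z w
  proof -
    have "f z \<bullet> f w = z \<bullet> w - c w * (z \<bullet> v) - c z * (w \<bullet> v) + c z * (c w * (v \<bullet> v))"
      using inner_commute[of v w] by (simp add: f inner_diff_left inner_diff_right right_diff_distrib)
    also have "\<dots> = z \<bullet> w - c w * (z \<bullet> v) + c z * (w \<bullet> v)" unfolding cv by simp
    also have "c w * (z \<bullet> v) = c z * (w \<bullet> v)" by (simp add: c_def)
    finally show ?thesis by simp
  qed
  with lin have "orthogonal_transformation f" by (simp add: orthogonal_transformation_def)
  moreover have "f a = b"
  proof (cases "v = 0")
    case False
    have "a \<bullet> a = b \<bullet> b" using assms by (simp add: norm_eq_sqrt_inner)
    then have "2 * (a \<bullet> v) = v \<bullet> v" using inner_commute[of a b] by (simp add: v_def inner_diff_left inner_diff_right)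
    then show ?thesis using False by (simp add: f_def) (simp add: v_def)
  qed (simp add: f_def v_def)
  moreover have "f z = z" if "z \<bullet> a = z \<bullet> b" for z
    using that by (simp add: f_def v_def inner_diff_right)
  ultimately show thesis by (rule that)
qed

text \<open>
  A first reflection moves \<open>x\<close> to \<open>x'\<close>; the second moves the image of \<open>w\<close> to \<open>w'\<close> and fixes \<open>x'\<close>, which is orthogonal to
  both.
\<close>

lemma orthonormal_pair_transitive:
  fixes x w x' w' :: "'a::euclidean_space"
  assumes "norm x = 1" "norm w = 1" "x \<bullet> w = 0" "norm x' = 1" "norm w' = 1" "x' \<bullet> w' = 0"
  obtains f where "orthogonal_transformation f" "f x = x'" "f w = w'"
proof -
  obtain f where f: "orthogonal_transformation f" "f x = x'"
    using reflection_exists[of x x'] assms by (metis)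
  have fw: "norm (f w) = norm w'" "x' \<bullet> f w = x' \<bullet> w'"
    using f assms by (auto simp: orthogonal_transformation_norm orthogonal_transformation_def)
  obtain g where g: "orthogonal_transformation g" "g (f w) = w'" "\<And>z. z \<bullet> f w = z \<bullet> w' \<Longrightarrow> g z = z"
    using reflection_exists[OF fw(1)] by blast
  show thesis
    by (rule that[of "g \<circ> f"]) (use f g fw in \<open>auto intro: orthogonal_transformation_compose\<close>)
qed

lemma integral_orthonormal_pair:
  fixes x w x' w' :: "'a::euclidean_space" and G :: "real \<Rightarrow> real \<Rightarrow> real"
  assumes "norm x = 1" "norm w = 1" "x \<bullet> w = 0" "norm x' = 1" "norm w' = 1" "x' \<bullet> w' = 0"
    and G: "continuous_on (sphere 0 1) (\<lambda>y. G (x' \<bullet> y) (w' \<bullet> y))"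
  shows "(\<integral>\<^sub>S y. G (x \<bullet> y) (w \<bullet> y)) = (\<integral>\<^sub>S y. G (x' \<bullet> y) (w' \<bullet> y))"
proof -
  obtain f where f: "orthogonal_transformation f" "f x = x'" "f w = w'"
    using orthonormal_pair_transitive[OF assms(1-6)] by blast
  then have "x \<bullet> y = x' \<bullet> f y" "w \<bullet> y = w' \<bullet> f y" for y
    by (auto simp: orthogonal_transformation_def)
  then have "(\<integral>\<^sub>S y. G (x \<bullet> y) (w \<bullet> y)) = (\<integral>\<^sub>S y. G (x' \<bullet> f y) (w' \<bullet> f y))"
    by simp
  also have "\<dots> = (\<integral>\<^sub>S y. G (x' \<bullet> y) (w' \<bullet> y))"
    by (rule integral_surface_orthogonal[OF f(1) G])
  finally show ?thesis .
qed

lemma integral_surface_sum: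
  fixes g :: "'i \<Rightarrow> 'a::euclidean_space \<Rightarrow> real"
  assumes "\<And>i. i \<in> A \<Longrightarrow> continuous_on (sphere 0 1) (g i)"
  shows "(\<integral>\<^sub>S y. (\<Sum>i\<in>A. g i y)) = (\<Sum>i\<in>A. \<integral>\<^sub>S y. g i y)"
  by (rule Bochner_Integration.integral_sum) (use assms in \<open>auto intro: integrable_sphere\<close>)

lemma integral_surface_diff:
  fixes f g :: "'a::euclidean_space \<Rightarrow> real"
  assumes "continuous_on (sphere 0 1) f" "continuous_on (sphere 0 1) g"
  shows "(\<integral>\<^sub>S y. f y - g y) = (\<integral>\<^sub>S y. f y) - (\<integral>\<^sub>S y. g y)"
  by (rule Bochner_Integration.integral_diff) (use assms in \<open>auto intro: integrable_sphere\<close>)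

lemma integral_surface_add:
  fixes f g :: "'a::euclidean_space \<Rightarrow> real"
  assumes "continuous_on (sphere 0 1) f" "continuous_on (sphere 0 1) g"
  shows "(\<integral>\<^sub>S y. f y + g y) = (\<integral>\<^sub>S y. f y) + (\<integral>\<^sub>S y. g y)"
  by (rule Bochner_Integration.integral_add) (use assms in \<open>auto intro: integrable_sphere\<close>)

text \<open>
  The point \<open>e\<close> is a reference pole for integrals of zonal functions; by \<open>J_eq\<close> no integral depends on it.
\<close>

locale zonal = gegenbauer p for p :: real +
  fixes e :: "'a::euclidean_space"
  assumes norm_e: "norm e = 1" and dim: "real DIM('a) = p + 2"
begin

definition J :: "(real \<Rightarrow> real) \<Rightarrow> real" where
  "J \<Phi> = (\<integral>\<^sub>S y. \<Phi> (e \<bullet> y))"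

lemma three_orthonormal:
  obtains b1 b2 b3 :: 'a where "b1 \<in> Basis" "b2 \<in> Basis" "b3 \<in> Basis" "b1 \<noteq> b2" "b1 \<noteq> b3" "b2 \<noteq> b3"
proof -
  have "real DIM('a) \<ge> 4" using dim p by simp
  then have "3 \<le> card (Basis :: 'a set)" by linarith
  then obtain T :: "'a set" where "T \<subseteq> Basis" "card T = 3" by (meson obtain_subset_with_card_n)
  then show thesis using that by (auto simp: card_3_iff)
qed

lemma orthogonal_unit_exists:
  assumes "norm (x::'a) = 1" obtains w where "norm w = 1" "x \<bullet> w = 0"
proof -
  obtain b1 b2 b3 :: 'a where b: "b1 \<in> Basis" "b2 \<in> Basis" "b1 \<noteq> b2" by (rule three_orthonormal)
  then obtain f where f: "orthogonal_transformation f" "f b1 = x"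
    using reflection_exists[of b1 x] assms by (metis norm_Basis)
  then have "norm (f b2) = 1" "x \<bullet> f b2 = 0"
    using b by (auto simp: orthogonal_transformation_norm orthogonal_transformation_def inner_Basis)
  then show thesis by (rule that)
qed

lemma J_eq:
  assumes "continuous_on UNIV \<Phi>" "norm (x::'a) = 1"
  shows "(\<integral>\<^sub>S y. \<Phi> (x \<bullet> y)) = J \<Phi>"
proof -
  obtain f where f: "orthogonal_transformation f" "f x = e"
    using reflection_exists[of x e] assms norm_e by metis
  have "(\<integral>\<^sub>S y. \<Phi> (x \<bullet> y)) = (\<integral>\<^sub>S y. \<Phi> (e \<bullet> f y))"
    using f by (metis orthogonal_transformation_def)
  also have "\<dots> = J \<Phi>"
    unfolding J_def by (rule integral_surface_orthogonal[OF f(1)])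
      (intro continuous_on_compose2[OF assms(1)] continuous_intros, auto)
  finally show ?thesis .
qed

text \<open>
  The orthonormal pair of the pole and \<open>w\<close> may be replaced by any other one (\<open>moment_eq\<close>).
\<close>

definition moment :: "(real \<Rightarrow> real) \<Rightarrow> nat \<Rightarrow> real" where
  "moment \<Phi> n = (let w = (SOME w. norm w = 1 \<and> e \<bullet> w = 0) in \<integral>\<^sub>S y. \<Phi> (e \<bullet> y) * (w \<bullet> y) ^ n)"

lemma moment_eq:
  fixes x w :: 'a
  assumes \<Phi>: "continuous_on UNIV \<Phi>" and xw: "norm x = 1" "norm w = 1" "x \<bullet> w = 0"
  shows "(\<integral>\<^sub>S y. \<Phi> (x \<bullet> y) * (w \<bullet> y) ^ n) = moment \<Phi> n"
proof -
  have "\<exists>w. norm w = 1 \<and> e \<bullet> w = 0" using orthogonal_unit_exists[OF norm_e] by metis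
  then have "norm (SOME w. norm w = 1 \<and> e \<bullet> w = 0) = 1 \<and> e \<bullet> (SOME w. norm w = 1 \<and> e \<bullet> w = 0) = 0"
    by (rule someI_ex)
  then show ?thesis unfolding moment_def Let_def
    by (intro integral_orthonormal_pair[of x w e _ "\<lambda>s r. \<Phi> s * r ^ n"] xw norm_e
        continuous_intros continuous_on_compose2[OF \<Phi>]) auto
qed

lemma moment_odd:
  assumes \<Phi>: "continuous_on UNIV \<Phi>" and n: "odd n"
  shows "moment \<Phi> n = 0"
proof -
  obtain w where w: "norm w = 1" "e \<bullet> w = 0" using orthogonal_unit_exists[OF norm_e] .
  have "moment \<Phi> n = (\<integral>\<^sub>S y. \<Phi> (e \<bullet> y) * (- w \<bullet> y) ^ n)"
    using moment_eq[OF \<Phi> norm_e, of "- w"] w by simp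
  also have "\<dots> = - moment \<Phi> n"
    using moment_eq[OF \<Phi> norm_e w] n by simp
  finally show ?thesis by simp
qed

lemma coeff_circle_power:
  "coeff ([:1, 0, 1:] ^ m) 0 = (1::real)" "coeff ([:1, 0, 1:] ^ m) 1 = (0::real)"
  "coeff ([:1, 0, 1:] ^ m) 2 = real m"
  by (induction m) (simp_all add: coeff_pCons numeral_2_eq_2)

text \<open>
  Replacing \<open>w\<close> by the unit vector in direction \<open>w + \<tau> * w'\<close> does not change its moment of order \<open>n + 2\<close>. Multiplied by
  \<open>(1 + \<tau>\<^sup>2) ^ m\<close> with \<open>2 * m = n + 2\<close>, this is an identity between polynomials in \<open>\<tau>\<close>, and the claim compares the
  coefficients of \<open>\<tau>\<^sup>2\<close>.
\<close>

lemma planar_moment: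
  fixes x w w' :: 'a
  assumes \<Phi>: "continuous_on UNIV \<Phi>"
    and on: "norm x = 1" "norm w = 1" "x \<bullet> w = 0" "norm w' = 1" "x \<bullet> w' = 0" "w \<bullet> w' = 0"
    and n: "even n"
  shows "(real n + 1) * (\<integral>\<^sub>S y. \<Phi> (x \<bullet> y) * (w \<bullet> y) ^ n * (w' \<bullet> y)\<^sup>2) = moment \<Phi> (n + 2)"
proof -
  obtain m where m: "n + 2 = 2 * m" "m > 0"
  proof
    show "n + 2 = 2 * (n div 2 + 1)" using n by simp
  qed simp
  define N where "N k = (\<integral>\<^sub>S y. \<Phi> (x \<bullet> y) * ((w' \<bullet> y) ^ k * (w \<bullet> y) ^ (2 * m - k)))" for k
  have cont: "continuous_on (sphere 0 1) (\<lambda>y::'a. \<Phi> (z \<bullet> y))" for z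
    by (intro continuous_on_compose2[OF \<Phi>] continuous_intros) auto
  define A where "A = (\<Sum>k\<le>2*m. monom (real (2 * m choose k) * N k) k)"
  have "poly A \<tau> = poly (smult (moment \<Phi> (2 * m)) ([:1, 0, 1:] ^ m)) \<tau>" for \<tau>
  proof -
    let ?T = "\<lambda>k y. real (2 * m choose k) * \<tau> ^ k * (\<Phi> (x \<bullet> y) * ((w' \<bullet> y) ^ k * (w \<bullet> y) ^ (2 * m - k)))"
    define r where "r = sqrt (1 + \<tau>\<^sup>2)"
    have r: "r > 0" "r\<^sup>2 = 1 + \<tau>\<^sup>2" by (auto simp: r_def add_pos_nonneg)
    have ww: "(w + \<tau> *\<^sub>R w') \<bullet> (w + \<tau> *\<^sub>R w') = 1 + \<tau>\<^sup>2"
    proof -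
      have "w \<bullet> w = 1" "w' \<bullet> w' = 1" using on by (simp_all add: dot_square_norm)
      then show ?thesis
        using on inner_commute[of w w'] by (simp only: inner_add_left inner_add_right inner_scaleR_left inner_scaleR_right)
          (simp add: power2_eq_square)
    qed
    define w'' where "w'' = (1 / r) *\<^sub>R (w + \<tau> *\<^sub>R w')"
    have "norm w'' = 1" using ww r by (simp add: w''_def norm_eq_sqrt_inner r_def)
    moreover have "x \<bullet> w'' = 0" using on by (simp add: w''_def inner_add_right)
    moreover have "w'' \<bullet> y = (w \<bullet> y + \<tau> * (w' \<bullet> y)) / r" for y
      by (simp add: w''_def inner_add_left)
    ultimately have "moment \<Phi> (2 * m) = (\<integral>\<^sub>S y. \<Phi> (x \<bullet> y) * ((w \<bullet> y + \<tau> * (w' \<bullet> y)) / r) ^ (2 * m))"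
      using moment_eq[OF \<Phi> on(1), of w'' "2 * m"] by simp
    then have "r ^ (2 * m) * moment \<Phi> (2 * m)
        = (\<integral>\<^sub>S y. r ^ (2 * m) * (\<Phi> (x \<bullet> y) * ((w \<bullet> y + \<tau> * (w' \<bullet> y)) / r) ^ (2 * m)))"
      by simp
    also have "\<dots> = (\<integral>\<^sub>S y. (\<Sum>k\<le>2*m. ?T k y))"
    proof (rule integral_surface_cong)
      fix y :: 'a
      have "r ^ (2 * m) * (\<Phi> (x \<bullet> y) * ((w \<bullet> y + \<tau> * (w' \<bullet> y)) / r) ^ (2 * m))
          = \<Phi> (x \<bullet> y) * (\<tau> * (w' \<bullet> y) + w \<bullet> y) ^ (2 * m)"
        using r by (simp add: power_divide add.commute)
      also have "\<dots> = (\<Sum>k\<le>2*m. ?T k y)"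
        by (simp add: binomial_ring sum_distrib_left power_mult_distrib mult_ac)
      finally show "r ^ (2 * m) * (\<Phi> (x \<bullet> y) * ((w \<bullet> y + \<tau> * (w' \<bullet> y)) / r) ^ (2 * m)) = \<dots>" .
    qed
    also have "\<dots> = poly A \<tau>"
    proof (subst integral_surface_sum)
      show "(\<Sum>k\<le>2*m. \<integral>\<^sub>S y. ?T k y) = poly A \<tau>"
        unfolding A_def N_def poly_sum poly_monom integral_mult_right_zero
        by (rule sum.cong) (simp_all only: mult_ac)
    qed (intro continuous_intros cont)
    also have "r ^ (2 * m) = (1 + \<tau>\<^sup>2) ^ m" using r by (simp add: power_mult)
    finally show ?thesis by (simp add: power2_eq_square mult_ac)
  qed
  then have "A = smult (moment \<Phi> (2 * m)) ([:1, 0, 1:] ^ m)" by (intro poly_eq_poly_eq_iff[THEN iffD1] ext)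
  then have "coeff A 2 = moment \<Phi> (2 * m) * real m" by (simp add: coeff_circle_power)
  moreover have "coeff A 2 = real (2 * m choose 2) * N 2"
    using m by (simp add: A_def coeff_sum coeff_monom)
  moreover have "real (2 * m choose 2) = real m * (2 * real m - 1)"
  proof -
    have "2 * m choose 2 = m * (2 * m - 1)" by (simp add: choose_two)
    then show ?thesis using m(2) by (simp add: of_nat_diff)
  qed
  ultimately have "real m * ((2 * real m - 1) * N 2) = real m * moment \<Phi> (2 * m)" by (simp add: mult_ac)
  then have "(2 * real m - 1) * N 2 = moment \<Phi> (2 * m)" using m by simp
  moreover have "2 * real m - 1 = real n + 1" "2 * m - 2 = n" using m by linarith+
  moreover have "N 2 = (\<integral>\<^sub>S y. \<Phi> (x \<bullet> y) * (w \<bullet> y) ^ n * (w' \<bullet> y)\<^sup>2)"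
    unfolding N_def \<open>2 * m - 2 = n\<close> by (simp add: mult_ac)
  ultimately show ?thesis using m by simp
qed

lemma continuous_zonal_slice:
  assumes "continuous_on UNIV \<Phi>" shows "continuous_on (sphere 0 1) (\<lambda>y::'a. \<Phi> (z \<bullet> y))"
  by (intro continuous_on_compose2[OF assms] continuous_intros) auto

text \<open>
  Sum \<open>planar_moment\<close> over an orthonormal basis of the complement of \<open>x\<close> and \<open>w\<close>, where the squares of the coordinates
  of a point \<open>y\<close> of the sphere add up to \<open>1 - (x \<bullet> y)\<^sup>2 - (w \<bullet> y)\<^sup>2\<close>.
\<close>

lemma moment_step:
  assumes \<Phi>: "continuous_on UNIV \<Phi>" and n: "even n"
  shows "(p + real n + 1) * moment \<Phi> (n + 2) = (real n + 1) * moment (\<lambda>s. \<Phi> s * (1 - s\<^sup>2)) n"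
proof -
  obtain x w b3 :: 'a where b: "x \<in> Basis" "w \<in> Basis" "x \<noteq> w" by (rule three_orthonormal) blast
  have on: "norm x = 1" "norm w = 1" "x \<bullet> w = 0" using b by (auto simp: inner_Basis)
  let ?B = "Basis - {x, w}"
  note cont = continuous_zonal_slice[OF \<Phi>]
  have card: "real (card ?B) = p"
  proof -
    have "DIM('a) \<ge> 4" using dim p by linarith
    then show ?thesis using b dim by (simp add: card_Diff_subset of_nat_diff)
  qed
  have "p * moment \<Phi> (n + 2) = (\<Sum>b\<in>?B. moment \<Phi> (n + 2))" by (simp add: card)
  also have "\<dots> = (\<Sum>b\<in>?B. (real n + 1) * (\<integral>\<^sub>S y. \<Phi> (x \<bullet> y) * (w \<bullet> y) ^ n * (b \<bullet> y)\<^sup>2))"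
    by (intro sum.cong refl planar_moment[symmetric] \<Phi> n on) (use b in \<open>auto simp: inner_Basis\<close>)
  also have "\<dots> = (real n + 1) * (\<integral>\<^sub>S y. (\<Sum>b\<in>?B. \<Phi> (x \<bullet> y) * (w \<bullet> y) ^ n * (b \<bullet> y)\<^sup>2))"
    by (subst integral_surface_sum) (auto simp: sum_distrib_left intro!: continuous_intros cont)
  also have "(\<integral>\<^sub>S y. (\<Sum>b\<in>?B. \<Phi> (x \<bullet> y) * (w \<bullet> y) ^ n * (b \<bullet> y)\<^sup>2))
      = (\<integral>\<^sub>S y. (\<Phi> (x \<bullet> y) * (1 - (x \<bullet> y)\<^sup>2)) * (w \<bullet> y) ^ n - \<Phi> (x \<bullet> y) * (w \<bullet> y) ^ (n + 2))"
  proof (rule integral_surface_cong)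
    fix y :: 'a assume "norm y = 1"
    then have "1 = (\<Sum>b\<in>Basis. (b \<bullet> y)\<^sup>2)"
      using euclidean_inner[of y y] by (simp add: dot_square_norm inner_commute power2_eq_square)
    also have "\<dots> = (x \<bullet> y)\<^sup>2 + (w \<bullet> y)\<^sup>2 + (\<Sum>b\<in>?B. (b \<bullet> y)\<^sup>2)"
      using b by (subst sum.subset_diff[of "{x, w}"]) auto
    finally have "(\<Sum>b\<in>?B. (b \<bullet> y)\<^sup>2) = 1 - (x \<bullet> y)\<^sup>2 - (w \<bullet> y)\<^sup>2" by simp
    then have "(\<Sum>b\<in>?B. \<Phi> (x \<bullet> y) * (w \<bullet> y) ^ n * (b \<bullet> y)\<^sup>2)
        = \<Phi> (x \<bullet> y) * (w \<bullet> y) ^ n * (1 - (x \<bullet> y)\<^sup>2 - (w \<bullet> y)\<^sup>2)"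
      unfolding sum_distrib_left[symmetric] by simp
    then show "(\<Sum>b\<in>?B. \<Phi> (x \<bullet> y) * (w \<bullet> y) ^ n * (b \<bullet> y)\<^sup>2)
        = (\<Phi> (x \<bullet> y) * (1 - (x \<bullet> y)\<^sup>2)) * (w \<bullet> y) ^ n - \<Phi> (x \<bullet> y) * (w \<bullet> y) ^ (n + 2)"
      by (simp add: power_add power2_eq_square algebra_simps)
  qed
  also have "\<dots> = moment (\<lambda>s. \<Phi> s * (1 - s\<^sup>2)) n - moment \<Phi> (n + 2)"
  proof -
    have "continuous_on UNIV (\<lambda>s. \<Phi> s * (1 - s\<^sup>2))" by (intro continuous_intros \<Phi>)
    from moment_eq[OF this on, of n] moment_eq[OF \<Phi> on, of "n + 2"] show ?thesis
      by (subst integral_surface_diff) (auto intro!: continuous_intros cont)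
  qed
  finally show ?thesis by (simp add: algebra_simps)
qed

text \<open>
  The mean of \<open>a ^ (2 * i)\<close>, where \<open>a\<close> is a coordinate of a random point on the unit sphere of a space of dimension
  \<open>p + 1\<close>; up to scaling, the points of the sphere with given inner product with \<open>x\<close> form such a sphere.
\<close>

fun \<kappa> :: "nat \<Rightarrow> real" where
  "\<kappa> 0 = 1"
| "\<kappa> (Suc i) = (2 * real i + 1) / (p + 2 * real i + 1) * \<kappa> i"

lemma moment_even:
  assumes "continuous_on UNIV \<Phi>"
  shows "moment \<Phi> (2 * i) = \<kappa> i * J (\<lambda>s. \<Phi> s * (1 - s\<^sup>2) ^ i)"
  using assms
proof (induction i arbitrary: \<Phi>)
  case 0
  obtain w where w: "norm w = 1" "e \<bullet> w = 0" using orthogonal_unit_exists[OF norm_e] .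
  show ?case using moment_eq[OF 0 norm_e w, of 0] by (simp add: J_def)
next
  case (Suc i)
  have c: "continuous_on UNIV (\<lambda>s. \<Phi> s * (1 - s\<^sup>2))" by (intro continuous_intros Suc.prems)
  have "(p + 2 * real i + 1) * moment \<Phi> (2 * Suc i) = (2 * real i + 1) * moment (\<lambda>s. \<Phi> s * (1 - s\<^sup>2)) (2 * i)"
    using moment_step[OF Suc.prems, of "2 * i"] by simp
  also have "\<dots> = (2 * real i + 1) * (\<kappa> i * J (\<lambda>s. \<Phi> s * (1 - s\<^sup>2) ^ Suc i))"
    using Suc.IH[OF c] by (simp add: mult_ac)
  finally show ?case using p by (simp add: field_simps add_nonneg_eq_0_iff)
qed

lemma J_cong: "(\<And>s. \<Phi> s = \<Psi> s) \<Longrightarrow> J \<Phi> = J \<Psi>" by (simp add: J_def)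

lemma J_add:
  assumes "continuous_on UNIV \<Phi>" "continuous_on UNIV \<Psi>"
  shows "J (\<lambda>s. \<Phi> s + \<Psi> s) = J \<Phi> + J \<Psi>"
  unfolding J_def by (rule integral_surface_add) (intro continuous_zonal_slice assms)+

lemma J_cmult: "J (\<lambda>s. c * \<Phi> s) = c * J \<Phi>"
  by (simp add: J_def)

lemma J_sum:
  assumes "\<And>i. i \<in> A \<Longrightarrow> continuous_on UNIV (\<Phi> i)"
  shows "J (\<lambda>s. \<Sum>i\<in>A. \<Phi> i s) = (\<Sum>i\<in>A. J (\<Phi> i))"
  unfolding J_def by (rule integral_surface_sum) (intro continuous_zonal_slice assms)

lemma J_power_step: "(real n + 1) * (J (\<lambda>s. s ^ n) - J (\<lambda>s. s ^ (n + 2))) = (p + 1) * J (\<lambda>s. s ^ (n + 2))"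
proof -
  have c1: "continuous_on UNIV (\<lambda>s::real. 1::real)" by simp
  obtain w where w: "norm w = 1" "e \<bullet> w = 0" using orthogonal_unit_exists[OF norm_e] .
  have J_moment: "J (\<lambda>s. s ^ k) = moment (\<lambda>_. 1) k" for k
    using moment_eq[OF c1 w(1) norm_e, of k] w by (simp add: J_def inner_commute)
  show ?thesis
  proof (cases "even n")
    case False
    then show ?thesis unfolding J_moment by (simp add: moment_odd[OF c1])
  next
    case True
    obtain x y z :: 'a where b: "x \<in> Basis" "y \<in> Basis" "z \<in> Basis" "x \<noteq> y" "x \<noteq> z" "y \<noteq> z"
      by (rule three_orthonormal)
    have b0: "norm x = 1" "norm y = 1" "norm z = 1" "x \<bullet> y = 0" "x \<bullet> z = 0" "y \<bullet> z = 0"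
      using b by (auto simp: inner_Basis)
    have c2: "continuous_on UNIV (\<lambda>s::real. 1 - s\<^sup>2)" by (intro continuous_intros)
    have "moment (\<lambda>s. 1 - s\<^sup>2) n = (\<integral>\<^sub>S v. (y \<bullet> v) ^ n - (y \<bullet> v) ^ n * (x \<bullet> v)\<^sup>2)"
      using moment_eq[OF c2 b0(1,2,4), of n] by (simp add: algebra_simps)
    also have "\<dots> = moment (\<lambda>_. 1) n - (\<integral>\<^sub>S v. (y \<bullet> v) ^ n * (x \<bullet> v)\<^sup>2)"
      using moment_eq[OF c1 b0(1,2,4), of n]
      by (subst integral_surface_diff) (auto intro!: continuous_intros)
    finally have m2: "moment (\<lambda>s. 1 - s\<^sup>2) n = moment (\<lambda>_. 1) n - (\<integral>\<^sub>S v. (y \<bullet> v) ^ n * (x \<bullet> v)\<^sup>2)" .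
    have "(real n + 1) * moment (\<lambda>s. 1 - s\<^sup>2) n = (real n + 1) * moment (\<lambda>_. 1) n - moment (\<lambda>_. 1) (n + 2)"
    proof -
      have "z \<bullet> y = 0" "z \<bullet> x = 0" "y \<bullet> x = 0" using b0 by (simp_all add: inner_commute)
      then have "(real n + 1) * (\<integral>\<^sub>S v. (y \<bullet> v) ^ n * (x \<bullet> v)\<^sup>2) = moment (\<lambda>_. 1) (n + 2)"
        using planar_moment[OF c1 b0(3,2) _ b0(1), of n] True by simp
      then show ?thesis using m2 by (simp add: right_diff_distrib)
    qed
    then have "(p + real n + 1) * moment (\<lambda>_. 1) (n + 2) = (real n + 1) * moment (\<lambda>_. 1) n - moment (\<lambda>_. 1) (n + 2)"
      using moment_step[OF c1 True] by simp
    then show ?thesis unfolding J_moment by (simp add: algebra_simps)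
  qed
qed

abbreviation E :: "real poly \<Rightarrow> real" where "E q \<equiv> J (poly q)"

lemma continuous_poly: "continuous_on UNIV (poly q :: real \<Rightarrow> real)"
  by (intro continuous_intros)

lemma E_add: "E (q + r) = E q + E r"
  using J_add[OF continuous_poly continuous_poly, of q r] by (simp add: poly_add[abs_def])

lemma E_smult: "E (smult c q) = c * E q"
  using J_cmult[of c "poly q"] by (simp add: poly_smult[abs_def])

lemma E_sum: "E (\<Sum>i\<in>A. q i) = (\<Sum>i\<in>A. E (q i))"
  using J_sum[of A "\<lambda>i. poly (q i)"] continuous_poly by (simp add: poly_sum[abs_def])

text \<open>
  Integration by parts on the sphere, in a form in which it expresses that the differential operator of \<open>ode\<close> is
  symmetric with respect to \<open>E\<close>.
\<close>

lemma E_self_adjoint: "E ([:1, 0, -1:] * pderiv q) = (p + 1) * E ([:0, 1:] * q)"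
proof -
  have monom: "E ([:1, 0, -1:] * pderiv (monom c n)) = (p + 1) * E ([:0, 1:] * monom c n)" for c n
  proof (cases n)
    case 0
    have "moment (\<lambda>_. 1) 1 = 0" by (rule moment_odd) auto
    moreover obtain w where "norm w = 1" "e \<bullet> w = 0" using orthogonal_unit_exists[OF norm_e] .
    ultimately have "J (\<lambda>s. s) = 0" using moment_eq[of "\<lambda>_. 1" w e 1] norm_e by (simp add: J_def inner_commute)
    moreover have "E ([:0, 1:] * monom c n) = J (\<lambda>s. c * s)"
      unfolding 0 by (rule J_cong) (simp add: poly_monom)
    moreover have "E ([:1, 0, -1:] * pderiv (monom c n)) = J (\<lambda>s. 0 * s)"
      unfolding 0 by (rule J_cong) (simp add: pderiv_monom)
    ultimately show ?thesis unfolding J_cmult by simp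
  next
    case (Suc m)
    have "E ([:1, 0, -1:] * pderiv (monom c n)) = J (\<lambda>s. c * ((real m + 1) * (s ^ m + (-1) * s ^ (m + 2))))"
      unfolding Suc by (rule J_cong) (simp add: pderiv_monom poly_monom power2_eq_square algebra_simps)
    also have "\<dots> = c * ((real m + 1) * (J (\<lambda>s. s ^ m) - J (\<lambda>s. s ^ (m + 2))))"
      unfolding J_cmult by (subst J_add) (auto simp: J_cmult[of "-1", simplified] intro!: continuous_intros)
    also have "\<dots> = (p + 1) * (c * J (\<lambda>s. s ^ (m + 2)))" unfolding J_power_step by simp
    also have "c * J (\<lambda>s. s ^ (m + 2)) = E ([:0, 1:] * monom c n)"
      unfolding J_cmult[symmetric] Suc by (rule J_cong) (simp add: poly_monom algebra_simps)
    finally show ?thesis .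
  qed
  have "E ([:1, 0, -1:] * pderiv (\<Sum>i\<le>n. monom (coeff q i) i)) = (p + 1) * E ([:0, 1:] * (\<Sum>i\<le>n. monom (coeff q i) i))" for n
    by (induction n) (simp_all only: sum.atMost_Suc atMost_0 sum.insert sum.empty finite.emptyI empty_iff
        not_False_eq_True add_0_right pderiv_add distrib_left E_add monom)
  from this[of "degree q"] show ?thesis by (simp only: poly_as_sum_of_monoms)
qed

section \<open>Orthogonality and the Funk-Hecke formula\<close>

abbreviation Q :: "nat \<Rightarrow> real poly" where "Q \<equiv> gegen p"

text \<open>
  Both polynomials are eigenfunctions of a symmetric operator, with different eigenvalues \<open>k * (k + p)\<close>.
\<close>

lemma orthogonal:
  assumes "k \<noteq> l" shows "E (Q k * Q l) = 0"
proof -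
  let ?lam = "\<lambda>k. real k * (real k + p)"
  let ?F = "pderiv (Q k) * Q l - Q k * pderiv (Q l)"
  have "E ([:1, 0, -1:] * pderiv ?F) = E (smult (p + 1) ([:0, 1:] * ?F) + smult (?lam l - ?lam k) (Q k * Q l))"
  proof (rule J_cong)
    fix s
    show "poly ([:1, 0, -1:] * pderiv ?F) s
        = poly (smult (p + 1) ([:0, 1:] * ?F) + smult (?lam l - ?lam k) (Q k * Q l)) s"
    proof -
      have "poly ([:1, 0, -1:] * pderiv ?F) s
        = ((1 - s\<^sup>2) * poly (pderiv (pderiv (Q k))) s) * P l s - P k s * ((1 - s\<^sup>2) * poly (pderiv (pderiv (Q l))) s)"
        by (simp only: pderiv_diff pderiv_mult poly_mult poly_diff poly_add) (simp add: power2_eq_square algebra_simps)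
      also have "\<dots> = poly (smult (p + 1) ([:0, 1:] * ?F) + smult (?lam l - ?lam k) (Q k * Q l)) s"
        unfolding ode by (simp add: algebra_simps)
      finally show ?thesis .
    qed
  qed
  then have "(?lam l - ?lam k) * E (Q k * Q l) = 0"
    unfolding E_self_adjoint E_add E_smult by simp
  moreover have "?lam l \<noteq> ?lam k"
  proof -
    have "?lam l - ?lam k = (real l - real k) * (real l + real k + p)" by (simp add: algebra_simps)
    moreover have "real l + real k + p \<noteq> 0" using p by (smt (verit) of_nat_0_le_iff)
    ultimately show ?thesis using assms by (metis diff_self mult_eq_0_iff of_nat_eq_iff right_minus_eq)
  qed
  ultimately show ?thesis by simp
qed

lemma E_square_pos: "E (Q k * Q k) > 0"
  unfolding J_def
proof (rule integral_surface_pos)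
  show "0 < poly (Q k * Q k) (e \<bullet> e)" using norm_e by (simp add: dot_square_norm P_at_1)
qed (use norm_e in \<open>auto intro!: continuous_intros\<close>)

lemma degree_Q: "degree (Q k) \<le> k \<and> coeff (Q k) k > 0"
proof (induction k rule: induct_nat_012)
  case (ge2 k)
  let ?A = "smult (2 * real k + 2 + p) ([:0, 1:] * Q (Suc k)) - smult (real k + 1) (Q k)"
  have A: "Q (Suc (Suc k)) = smult (1 / (real k + 1 + p)) ?A" by (rule gegen.simps)
  have "degree ?A \<le> Suc (Suc k)"
  proof (rule degree_diff_le)
    show "degree (smult (2 * real k + 2 + p) ([:0, 1:] * Q (Suc k))) \<le> Suc (Suc k)"
      using ge2 by (intro order_trans[OF degree_smult_le] order_trans[OF degree_mult_le]) auto
    show "degree (smult (real k + 1) (Q k)) \<le> Suc (Suc k)"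
      using ge2 by (intro order_trans[OF degree_smult_le]) auto
  qed
  then have "degree (Q (Suc (Suc k))) \<le> Suc (Suc k)"
    unfolding A by (intro order_trans[OF degree_smult_le])
  moreover have "coeff (Q k) (Suc (Suc k)) = 0" using ge2 by (intro coeff_eq_0) auto
  then have "coeff (Q (Suc (Suc k))) (Suc (Suc k)) = (2 * real k + 2 + p) / (real k + 1 + p) * coeff (Q (Suc k)) (Suc k)"
    unfolding A by simp
  moreover have "\<dots> > 0" using ge2 p by simp
  ultimately show ?case by simp
qed auto

lemma gegenbauer_expansion:
  "degree q \<le> n \<Longrightarrow> \<exists>c. q = (\<Sum>l\<le>n. smult (c l) (Q l))"
proof (induction n arbitrary: q)
  case 0
  then obtain a where "q = [:a:]" by (auto elim: degree_eq_zeroE)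
  then show ?case by (intro exI[of _ "\<lambda>_. a"]) simp
next
  case (Suc n)
  define a where "a = coeff q (Suc n) / coeff (Q (Suc n)) (Suc n)"
  let ?r = "q - smult a (Q (Suc n))"
  have "degree ?r \<le> n"
  proof (rule degree_le, intro allI impI)
    fix i assume "n < i"
    show "coeff ?r i = 0"
    proof (cases "i = Suc n")
      case True
      then show ?thesis using degree_Q[of "Suc n"] by (simp add: a_def)
    next
      case False
      then have "coeff q i = 0" "coeff (Q (Suc n)) i = 0"
        using \<open>n < i\<close> Suc.prems degree_Q[of "Suc n"] by (auto intro!: coeff_eq_0)
      then show ?thesis by simp
    qed
  qed
  then obtain c where "?r = (\<Sum>l\<le>n. smult (c l) (Q l))" using Suc.IH by blast
  then have "q = (\<Sum>l\<le>n. smult (c l) (Q l)) + smult a (Q (Suc n))" by (simp add: diff_eq_eq)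
  moreover have "(\<Sum>l\<le>n. smult ((c(Suc n := a)) l) (Q l)) = (\<Sum>l\<le>n. smult (c l) (Q l))"
    by (rule sum.cong) auto
  ultimately show ?case by (intro exI[of _ "c(Suc n := a)"]) simp
qed

lemma orthogonal_to_lower_degree:
  assumes "degree q < k" shows "E (Q k * q) = 0"
proof -
  obtain c where q: "q = (\<Sum>l\<le>degree q. smult (c l) (Q l))" using gegenbauer_expansion[of q "degree q"] by auto
  have "E (Q k * q) = (\<Sum>l\<le>degree q. E (smult (c l) (Q k * Q l)))"
    by (subst q) (simp add: sum_distrib_left E_sum)
  also have "\<dots> = 0" unfolding E_smult using assms by (intro sum.neutral) (auto simp: orthogonal)
  finally show ?thesis .
qed

abbreviation translate_term :: "real \<Rightarrow> nat \<Rightarrow> nat \<Rightarrow> real poly" where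
  "translate_term t j i \<equiv> smult (real (j choose (2 * i)) * t ^ (j - 2 * i) * (1 - t\<^sup>2) ^ i * \<kappa> i)
     ([:0, 1:] ^ (j - 2 * i) * [:1, 0, -1:] ^ i)"

text \<open>
  The mean of \<open>(y \<bullet> z) ^ j\<close> over all points \<open>y\<close> of the sphere with \<open>x \<bullet> y = s\<close>, as a polynomial in \<open>s\<close>, where
  \<open>t = x \<bullet> z\<close>. It comes from expanding the power of \<open>y \<bullet> z = s * t + sqrt (1 - s\<^sup>2) * sqrt (1 - t\<^sup>2) * a\<close>, in which only
  even powers of \<open>a\<close> have a nonzero mean, namely \<open>\<kappa>\<close>.
\<close>

definition translate_power :: "real \<Rightarrow> nat \<Rightarrow> real poly" where
  "translate_power t j = (\<Sum>i\<le>j div 2. translate_term t j i)"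

definition translate :: "real \<Rightarrow> real poly \<Rightarrow> real poly" where
  "translate t q = (\<Sum>j\<le>degree q. smult (coeff q j) (translate_power t j))"

lemma degree_translate: "degree (translate t q) \<le> degree q"
  unfolding translate_def
proof (rule degree_sum_le)
  fix j assume "j \<in> {..degree q}"
  have "degree (translate_power t j) \<le> j"
    unfolding translate_power_def
  proof (rule degree_sum_le)
    fix i assume i: "i \<in> {..j div 2}"
    have "degree ([:0, 1::real:] ^ (j - 2 * i) * [:1, 0, -1:] ^ i) \<le> (j - 2 * i) + 2 * i"
      by (intro order_trans[OF degree_mult_le] add_mono order_trans[OF degree_power_le]) auto
    also have "\<dots> = j" using i by auto
    finally show "degree (translate_term t j i) \<le> j" by (rule order_trans[OF degree_smult_le])
  qed simp
  then show "degree (smult (coeff q j) (translate_power t j)) \<le> degree q"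
    using \<open>j \<in> {..degree q}\<close> by (intro order_trans[OF degree_smult_le]) auto
qed simp

lemma poly_translate_1: "poly (translate t q) 1 = poly q t"
proof -
  have "poly (translate_power t j) 1 = t ^ j" for j
  proof -
    have "poly (translate_power t j) 1 = (\<Sum>i\<le>j div 2. if i = 0 then t ^ j else 0)"
      unfolding translate_power_def poly_sum by (rule sum.cong) auto
    then show ?thesis by simp
  qed
  then show ?thesis by (simp only: translate_def poly_sum poly_smult) (simp only: poly_altdef[of q t])
qed

lemma sphere_decomposition:
  assumes "norm (x::'a) = 1" "norm z = 1"
  obtains w r where "norm w = 1" "x \<bullet> w = 0" "z = (x \<bullet> z) *\<^sub>R x + r *\<^sub>R w" "r\<^sup>2 = 1 - (x \<bullet> z)\<^sup>2"
proof -
  define v where "v = z - (x \<bullet> z) *\<^sub>R x"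
  have xx: "x \<bullet> x = 1" "z \<bullet> z = 1" using assms by (auto simp: dot_square_norm)
  have xv: "x \<bullet> v = 0" using xx by (simp add: v_def inner_diff_right)
  have vv: "v \<bullet> v = 1 - (x \<bullet> z)\<^sup>2"
    using xx inner_commute[of x z] by (simp add: v_def inner_diff_right inner_diff_left power2_eq_square)
  show thesis
  proof (cases "v = 0")
    case True
    obtain w where "norm w = 1" "x \<bullet> w = 0" using orthogonal_unit_exists[OF assms(1)] .
    then show thesis using True vv by (intro that[of w 0]) (auto simp: v_def)
  next
    case False
    show thesis
      by (rule that[of "(1 / norm v) *\<^sub>R v" "norm v"])
        (use False xv vv in \<open>auto simp: v_def[symmetric] dot_square_norm, simp add: v_def\<close>)
  qed
qed

lemma convolution_power:
  assumes \<Phi>: "continuous_on UNIV \<Phi>" and xz: "norm (x::'a) = 1" "norm z = 1"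
  shows "(\<integral>\<^sub>S y. \<Phi> (x \<bullet> y) * (y \<bullet> z) ^ j) = J (\<lambda>s. \<Phi> s * poly (translate_power (x \<bullet> z) j) s)"
proof -
  define t where "t = x \<bullet> z"
  obtain w r where w: "norm w = 1" "x \<bullet> w = 0" "z = t *\<^sub>R x + r *\<^sub>R w" "r\<^sup>2 = 1 - t\<^sup>2"
    using sphere_decomposition[OF xz] unfolding t_def by blast
  let ?\<Psi> = "\<lambda>i s. \<Phi> s * s ^ (j - i)"
  have c: "continuous_on UNIV (?\<Psi> i)" for i by (intro continuous_intros \<Phi>)
  have "(\<integral>\<^sub>S y. \<Phi> (x \<bullet> y) * (y \<bullet> z) ^ j)
      = (\<integral>\<^sub>S y. (\<Sum>i\<le>j. (real (j choose i) * r ^ i * t ^ (j - i)) * (\<Phi> (x \<bullet> y) * (x \<bullet> y) ^ (j - i) * (w \<bullet> y) ^ i)))"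
  proof (rule integral_surface_cong)
    fix y :: 'a
    have "y \<bullet> z = r * (w \<bullet> y) + t * (x \<bullet> y)" by (subst w(3)) (simp add: inner_add_right inner_commute)
    then show "\<Phi> (x \<bullet> y) * (y \<bullet> z) ^ j
        = (\<Sum>i\<le>j. (real (j choose i) * r ^ i * t ^ (j - i)) * (\<Phi> (x \<bullet> y) * (x \<bullet> y) ^ (j - i) * (w \<bullet> y) ^ i))"
      by (simp add: binomial_ring sum_distrib_left power_mult_distrib mult_ac)
  qed
  also have "\<dots> = (\<Sum>i\<le>j. (real (j choose i) * r ^ i * t ^ (j - i)) * moment (?\<Psi> i) i)"
  proof (subst integral_surface_sum)
    show "(\<Sum>i\<le>j. \<integral>\<^sub>S y. real (j choose i) * r ^ i * t ^ (j - i) * (\<Phi> (x \<bullet> y) * (x \<bullet> y) ^ (j - i) * (w \<bullet> y) ^ i))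
        = (\<Sum>i\<le>j. real (j choose i) * r ^ i * t ^ (j - i) * moment (?\<Psi> i) i)"
      unfolding integral_mult_right_zero using moment_eq[OF c xz(1) w(1,2)] by simp
  qed (intro continuous_intros continuous_zonal_slice \<Phi>)
  also have "\<dots> = (\<Sum>i\<in>(\<lambda>i. 2 * i) ` {..j div 2}. (real (j choose i) * r ^ i * t ^ (j - i)) * moment (?\<Psi> i) i)"
  proof (rule sum.mono_neutral_right)
    show "\<forall>i\<in>{..j} - (\<lambda>i. 2 * i) ` {..j div 2}. real (j choose i) * r ^ i * t ^ (j - i) * moment (?\<Psi> i) i = 0"
    proof
      fix i assume i: "i \<in> {..j} - (\<lambda>i. 2 * i) ` {..j div 2}"
      have "odd i"
      proof
        assume "even i"
        then obtain k where "i = 2 * k" by (elim evenE)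
        then show False using i by auto
      qed
      then show "real (j choose i) * r ^ i * t ^ (j - i) * moment (?\<Psi> i) i = 0" by (simp add: moment_odd[OF c])
    qed
  qed auto
  also have "\<dots> = (\<Sum>i\<le>j div 2. (real (j choose (2 * i)) * r ^ (2 * i) * t ^ (j - 2 * i)) * moment (?\<Psi> (2 * i)) (2 * i))"
    by (subst sum.reindex) (auto simp: inj_on_def)
  also have "\<dots> = (\<Sum>i\<le>j div 2. J (\<lambda>s. \<Phi> s * poly (translate_term t j i) s))"
  proof (rule sum.cong)
    fix i
    have "(real (j choose (2 * i)) * r ^ (2 * i) * t ^ (j - 2 * i)) * moment (?\<Psi> (2 * i)) (2 * i)
      = J (\<lambda>s. (real (j choose (2 * i)) * (1 - t\<^sup>2) ^ i * t ^ (j - 2 * i) * \<kappa> i) * (?\<Psi> (2 * i) s * (1 - s\<^sup>2) ^ i))"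
      unfolding J_cmult moment_even[OF c] by (simp add: power_mult w(4))
    also have "\<dots> = J (\<lambda>s. \<Phi> s * poly (translate_term t j i) s)"
      by (rule J_cong) (simp add: poly_power power2_eq_square mult_ac)
    finally show "(real (j choose (2 * i)) * r ^ (2 * i) * t ^ (j - 2 * i)) * moment (?\<Psi> (2 * i)) (2 * i) = \<dots>" .
  qed simp
  also have "\<dots> = J (\<lambda>s. \<Sum>i\<le>j div 2. \<Phi> s * poly (translate_term t j i) s)"
    by (rule J_sum[symmetric]) (intro continuous_intros \<Phi>)
  also have "\<dots> = J (\<lambda>s. \<Phi> s * poly (translate_power t j) s)"
    by (rule J_cong) (simp only: translate_power_def poly_sum sum_distrib_left)
  finally show ?thesis by (simp only: t_def)
qed

lemma convolution_poly:
  assumes \<Phi>: "continuous_on UNIV \<Phi>" and xz: "norm (x::'a) = 1" "norm z = 1"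
  shows "(\<integral>\<^sub>S y. \<Phi> (x \<bullet> y) * poly q (y \<bullet> z)) = J (\<lambda>s. \<Phi> s * poly (translate (x \<bullet> z) q) s)"
proof -
  have "(\<integral>\<^sub>S y. \<Phi> (x \<bullet> y) * poly q (y \<bullet> z))
      = (\<integral>\<^sub>S y. (\<Sum>j\<le>degree q. coeff q j * (\<Phi> (x \<bullet> y) * (y \<bullet> z) ^ j)))"
    by (simp add: poly_altdef sum_distrib_left mult_ac)
  also have "\<dots> = (\<Sum>j\<le>degree q. coeff q j * J (\<lambda>s. \<Phi> s * poly (translate_power (x \<bullet> z) j) s))"
  proof (subst integral_surface_sum)
    show "(\<Sum>j\<le>degree q. \<integral>\<^sub>S y. coeff q j * (\<Phi> (x \<bullet> y) * (y \<bullet> z) ^ j))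
      = (\<Sum>j\<le>degree q. coeff q j * J (\<lambda>s. \<Phi> s * poly (translate_power (x \<bullet> z) j) s))"
      unfolding integral_mult_right_zero convolution_power[OF \<Phi> xz] ..
  qed (intro continuous_intros continuous_zonal_slice \<Phi>)
  also have "\<dots> = J (\<lambda>s. \<Sum>j\<le>degree q. coeff q j * (\<Phi> s * poly (translate_power (x \<bullet> z) j) s))"
    unfolding J_cmult[symmetric] by (rule J_sum[symmetric]) (intro continuous_intros \<Phi>)
  also have "\<dots> = J (\<lambda>s. \<Phi> s * poly (translate (x \<bullet> z) q) s)"
    by (rule J_cong) (simp add: translate_def poly_sum sum_distrib_left mult_ac)
  finally show ?thesis .
qed

lemma point_with_inner_product:
  assumes "\<bar>t\<bar> \<le> 1" obtains z :: 'a where "norm z = 1" "e \<bullet> z = t"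
proof -
  obtain w where w: "norm w = 1" "e \<bullet> w = 0" using orthogonal_unit_exists[OF norm_e] .
  define z where "z = t *\<^sub>R e + sqrt (1 - t\<^sup>2) *\<^sub>R w"
  have t2: "1 - t\<^sup>2 \<ge> 0" using assms by (simp add: abs_square_le_1)
  have ee: "e \<bullet> e = 1" "w \<bullet> w = 1" "w \<bullet> e = 0" using norm_e w by (auto simp: dot_square_norm inner_commute)
  have "z \<bullet> z = 1" using t2 ee w
    by (simp add: z_def inner_add_left inner_add_right) (simp add: power2_eq_square)
  then have "norm z = 1" by (simp add: norm_eq_sqrt_inner)
  moreover have "e \<bullet> z = t" using ee w by (simp add: z_def inner_add_right)
  ultimately show thesis by (rule that)
qed

text \<open>
  The translate has degree at most \<open>k\<close>. Paired with a polynomial \<open>q\<close> of lower degree it gives a double integral in which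
  the two factors may be exchanged; then \<open>Q k\<close> is paired with the translate of \<open>q\<close>, which has lower degree, so the result
  is \<open>0\<close>. Hence the translate is a multiple of \<open>Q k\<close>, and evaluation at \<open>1\<close> identifies the factor.
\<close>

lemma product_formula:
  assumes "\<bar>t\<bar> \<le> 1" shows "translate t (Q k) = smult (P k t) (Q k)"
proof -
  obtain z where z: "norm z = 1" and ez: "e \<bullet> z = t" using point_with_inner_product[OF assms] .
  have lower: "E (translate t (Q k) * q) = 0" if "degree q < k" for q
  proof -
    have "E (translate t (Q k) * q) = J (\<lambda>s. poly q s * poly (translate (e \<bullet> z) (Q k)) s)"
      by (rule J_cong) (simp add: ez)
    also have "\<dots> = (\<integral>\<^sub>S y. poly q (e \<bullet> y) * P k (y \<bullet> z))"
      by (rule convolution_poly[symmetric]) (intro continuous_poly norm_e z)+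
    also have "\<dots> = (\<integral>\<^sub>S y. P k (z \<bullet> y) * poly q (y \<bullet> e))"
      by (simp add: mult.commute inner_commute)
    also have "\<dots> = J (\<lambda>s. P k s * poly (translate (z \<bullet> e) q) s)"
      by (rule convolution_poly) (intro continuous_poly norm_e z)+
    also have "\<dots> = E (Q k * translate (z \<bullet> e) q)" by (rule J_cong) simp
    also have "\<dots> = 0" using degree_translate[of "z \<bullet> e" q] that by (intro orthogonal_to_lower_degree) auto
    finally show ?thesis .
  qed
  have "degree (translate t (Q k)) \<le> k" using degree_translate degree_Q le_trans by blast
  then obtain c where c: "translate t (Q k) = (\<Sum>l\<le>k. smult (c l) (Q l))" using gegenbauer_expansion by blast
  have "c l = 0" if "l < k" for l
  proof -
    have "0 = E (translate t (Q k) * Q l)" using lower[of "Q l"] degree_Q[of l] that by auto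
    also have "\<dots> = (\<Sum>i\<le>k. c i * E (Q i * Q l))"
      unfolding c by (simp add: sum_distrib_right E_sum E_smult)
    also have "\<dots> = (\<Sum>i\<le>k. if i = l then c l * E (Q l * Q l) else 0)"
      by (rule sum.cong) (auto simp: orthogonal)
    also have "\<dots> = c l * E (Q l * Q l)" using that by simp
    finally show ?thesis using E_square_pos[of l] by simp
  qed
  then have "translate t (Q k) = (\<Sum>l\<le>k. if l = k then smult (c k) (Q k) else 0)"
    unfolding c by (intro sum.cong) auto
  then have eq: "translate t (Q k) = smult (c k) (Q k)" by simp
  then have "P k t = c k" using poly_translate_1[of t "Q k"] by (simp add: P_at_1)
  with eq show ?thesis by simp
qed

theorem funk_hecke:
  assumes \<Phi>: "continuous_on UNIV \<Phi>" and xz: "norm (x::'a) = 1" "norm z = 1"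
  shows "(\<integral>\<^sub>S y. \<Phi> (x \<bullet> y) * P k (y \<bullet> z)) = J (\<lambda>s. \<Phi> s * P k s) * P k (x \<bullet> z)"
proof -
  have t: "\<bar>x \<bullet> z\<bar> \<le> 1" using Cauchy_Schwarz_ineq2[of x z] xz by simp
  have "(\<integral>\<^sub>S y. \<Phi> (x \<bullet> y) * P k (y \<bullet> z)) = J (\<lambda>s. P k (x \<bullet> z) * (\<Phi> s * P k s))"
    unfolding convolution_poly[OF \<Phi> xz] product_formula[OF t] by (rule J_cong) simp
  then show ?thesis by (simp add: J_cmult)
qed

end

section \<open>Positive semidefinite kernels\<close>

lemma continuous_slice:
  fixes K :: "'a::euclidean_space \<Rightarrow> 'a \<Rightarrow> real"
  assumes K: "continuous_kernel K" and x: "norm x = 1"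
  shows "continuous_on (sphere 0 1) (K x)"
proof -
  have "continuous_on (sphere 0 1) (\<lambda>z::'a. (x, z))" by (intro continuous_intros)
  moreover have "(\<lambda>z. (x, z)) ` sphere 0 1 \<subseteq> sphere 0 1 \<times> sphere 0 1" using x by auto
  ultimately have "continuous_on (sphere 0 1) (\<lambda>z. case (x, z) of (x, y) \<Rightarrow> K x y)"
    by (rule continuous_on_compose2[OF K])
  then show ?thesis by simp
qed

lemma kernel_uniformly_continuous:
  fixes K :: "'a::euclidean_space \<Rightarrow> 'a \<Rightarrow> real"
  assumes "continuous_kernel K" "\<delta> > 0"
  obtains d where "d > 0"
    "\<And>x z x' z'. x \<in> sphere 0 1 \<Longrightarrow> z \<in> sphere 0 1 \<Longrightarrow> x' \<in> sphere 0 1 \<Longrightarrow> z' \<in> sphere 0 1 \<Longrightarrow>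
      dist (x', z') (x, z) < d \<Longrightarrow> \<bar>K x' z' - K x z\<bar> < \<delta>"
proof -
  have "compact (sphere (0::'a) 1 \<times> sphere (0::'a) 1)" by (intro compact_Times) auto
  then have "uniformly_continuous_on (sphere 0 1 \<times> sphere 0 1) (\<lambda>(x, y). K x y)"
    by (rule compact_uniformly_continuous[OF assms(1)])
  then obtain d where d: "d > 0" "\<And>u v. u \<in> sphere 0 1 \<times> sphere 0 1 \<Longrightarrow> v \<in> sphere 0 1 \<times> sphere 0 1 \<Longrightarrow> dist v u < d
      \<Longrightarrow> dist (case v of (x, y) \<Rightarrow> K x y) (case u of (x, y) \<Rightarrow> K x y) < \<delta>"
    using assms(2) unfolding uniformly_continuous_on_def by metis
  show thesis
    using d(2)[of "(_, _)" "(_, _)"] by (intro that[OF d(1)]) (simp add: dist_real_def)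
qed

lemma continuous_integral_slice:
  fixes K :: "'a::euclidean_space \<Rightarrow> 'a \<Rightarrow> real"
  assumes K: "continuous_kernel K"
  shows "continuous_on (sphere 0 1) (\<lambda>x. \<integral>\<^sub>S z. K x z)"
  unfolding continuous_on_iff
proof (intro ballI allI impI)
  fix x :: 'a and \<epsilon> :: real assume x: "x \<in> sphere 0 1" and \<epsilon>: "\<epsilon> > 0"
  let ?\<sigma> = "measure surface_measure (sphere (0::'a) 1)"
  define \<delta> where "\<delta> = \<epsilon> / (2 * ?\<sigma>)"
  have \<delta>: "\<delta> > 0" using \<epsilon> surface_measure_pos[where 'a = 'a] by (simp add: \<delta>_def)
  obtain d where d: "d > 0" "\<And>x z x' z'. x \<in> sphere 0 1 \<Longrightarrow> z \<in> sphere 0 1 \<Longrightarrow> x' \<in> sphere 0 1 \<Longrightarrow> z' \<in> sphere 0 1 \<Longrightarrow>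
      dist (x', z') (x, z) < d \<Longrightarrow> \<bar>K x' z' - K x z\<bar> < \<delta>"
    by (rule kernel_uniformly_continuous[OF K \<delta>]) blast
  have slice: "continuous_on (sphere 0 1) (K x')" if "x' \<in> sphere 0 1" for x'
    using continuous_slice[OF K] that by simp
  show "\<exists>d>0. \<forall>x'\<in>sphere 0 1. dist x' x < d \<longrightarrow> dist (\<integral>\<^sub>S z. K x' z) (\<integral>\<^sub>S z. K x z) < \<epsilon>"
  proof (intro exI conjI ballI impI)
    show "d > 0" by fact
    fix x' assume x': "x' \<in> sphere 0 1" "dist x' x < d"
    have "norm (\<integral>\<^sub>S z. K x' z - K x z) \<le> (\<integral>\<^sub>S z. norm (K x' z - K x z))"
      by (rule integral_norm_bound)
    also have "\<dots> \<le> (\<integral>z. \<delta> \<partial>(surface_measure :: 'a measure))"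
    proof (rule integral_surface_mono)
      fix z :: 'a assume "norm z = 1"
      then show "norm (K x' z - K x z) \<le> \<delta>"
        using d(2)[of x z x' z] x x' by (simp add: dist_Pair_Pair)
    qed (intro continuous_intros slice x x')+
    also have "\<dots> = ?\<sigma> * \<delta>" by simp
    also have "\<dots> < \<epsilon>" using \<epsilon> surface_measure_pos[where 'a = 'a] by (simp add: \<delta>_def)
    finally show "dist (\<integral>\<^sub>S z. K x' z) (\<integral>\<^sub>S z. K x z) < \<epsilon>"
      using integral_surface_diff[OF slice[OF x'(1)] slice[OF x]] by (simp add: dist_norm)
  qed
qed

text \<open>
  Cut the sphere into finitely many Borel pieces on which \<open>K\<close> is nearly constant in each argument. The Riemann sum
  for the pieces is a quadratic form of \<open>K\<close> whose weights are the measures of the pieces.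
\<close>

lemma psd_double_integral_nonneg:
  fixes K :: "'a::euclidean_space \<Rightarrow> 'a \<Rightarrow> real"
  assumes K: "continuous_kernel K"
    and psd: "psd_kernel_on (sphere 0 1) K"
  shows "(\<integral>\<^sub>S x. (\<integral>\<^sub>S z. K x z)) \<ge> 0"
proof (rule field_le_epsilon)
  fix \<epsilon> :: real assume \<epsilon>: "\<epsilon> > 0"
  let ?S = "sphere (0::'a) 1"
  let ?\<sigma> = "measure surface_measure ?S"
  define \<delta> where "\<delta> = \<epsilon> / ?\<sigma>\<^sup>2"
  have \<delta>: "\<delta> > 0" using \<epsilon> surface_measure_pos[where 'a = 'a] by (simp add: \<delta>_def)
  obtain d where d: "d > 0" "\<And>x z x' z'. x \<in> sphere 0 1 \<Longrightarrow> z \<in> sphere 0 1 \<Longrightarrow> x' \<in> sphere 0 1 \<Longrightarrow> z' \<in> sphere 0 1 \<Longrightarrow>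
      dist (x', z') (x, z) < d \<Longrightarrow> \<bar>K x' z' - K x z\<bar> < \<delta>"
    by (rule kernel_uniformly_continuous[OF K \<delta>]) blast
  obtain D where D: "D \<subseteq> ?S" "finite D" "?S \<subseteq> (\<Union>c\<in>D. ball c (d / 2))"
    by (rule compactE_image[of ?S ?S "\<lambda>c. ball c (d / 2)"]) (use d in auto)
  obtain c :: "nat \<Rightarrow> 'a" and N where c: "D = c ` {..<N}"
    using finite_imp_nat_seg_image_inj_on[OF D(2)] unfolding lessThan_def by blast
  \<comment> \<open>The points of the sphere whose first covering ball is the \<open>i\<close>-th one.\<close>
  define A where "A i = ?S \<inter> ball (c i) (d / 2) - (\<Union>j<i. ball (c j) (d / 2))" for i
  have A_sets: "A i \<in> sets surface_measure" for i
  proof -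
    have "?S \<inter> ball (c i) (d / 2) - (\<Union>j<i. ball (c j) (d / 2)) \<in> sets borel"
      by (intro sets.Diff sets.Int sets.finite_UN borel_open borel_closed) auto
    then show ?thesis by (auto simp: sets_surface_measure_iff A_def)
  qed
  have cS: "c i \<in> ?S" if "i < N" for i using that c D(1) by auto
  have disj: "i = j" if "x \<in> A i" "x \<in> A j" for x i j
    using that by (cases i j rule: linorder_cases) (auto simp: A_def)
  have cover: "\<exists>i<N. x \<in> A i" if x: "x \<in> ?S" for x
  proof -
    obtain i where i: "i < N" "x \<in> ball (c i) (d / 2)" using D(3) x c by blast
    define m where "m = (LEAST i. x \<in> ball (c i) (d / 2))"
    have m: "x \<in> ball (c m) (d / 2)" unfolding m_def using i(2) by (rule LeastI)
    have "m \<le> i" unfolding m_def using i(2) by (rule Least_le)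
    have least: "x \<notin> ball (c j) (d / 2)" if "j < m" for j
      using that unfolding m_def by (rule not_less_Least)
    have "x \<in> A m" unfolding A_def using x m least by blast
    then show ?thesis using \<open>m \<le> i\<close> i(1) by (intro exI[of _ m]) simp
  qed
  have ind_sum: "(\<Sum>i<N. f i * indicator (A i) x) = f i" if "x \<in> A i" "i < N" for f :: "nat \<Rightarrow> real" and x i
  proof -
    have "(\<Sum>j<N. f j * indicator (A j) x) = (\<Sum>j<N. if j = i then f i else 0)"
      by (rule sum.cong) (use disj that in \<open>auto simp: indicator_def\<close>)
    then show ?thesis using that by simp
  qed
  have int_ind: "integrable surface_measure (\<lambda>x. \<Sum>i<N. f i * indicator (A i) x)" for f :: "nat \<Rightarrow> real"
    by (intro Bochner_Integration.integrable_sum integrable_mult_right integrable_real_indicator A_sets)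
       (auto simp: surface.emeasure_finite less_top[symmetric])
  have val_ind: "(\<integral>\<^sub>S x. (\<Sum>i<N. f i * indicator (A i) x)) = (\<Sum>i<N. f i * measure surface_measure (A i))"
    for f :: "nat \<Rightarrow> real"
  proof -
    have "A i \<inter> ?S = A i" for i by (auto simp: A_def)
    then show ?thesis
      by (subst Bochner_Integration.integral_sum)
       (auto intro!: integrable_mult_right integrable_real_indicator A_sets sum.cong
         simp: surface.emeasure_finite less_top[symmetric] A_sets)
  qed
  define \<mu> where "\<mu> i = measure surface_measure (A i)" for i
  define F where "F i = (\<Sum>j<N. \<mu> j * K (c i) (c j))" for i
  have close: "K (c i) (c j) - \<delta> \<le> K x z" if "x \<in> A i" "z \<in> A j" "i < N" "j < N" for x z i j
  proof -
    have "dist (x, z) (c i, c j) \<le> dist x (c i) + dist z (c j)"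
      unfolding dist_Pair_Pair by (rule sqrt_sum_squares_le_sum) auto
    also have "\<dots> < d" using that by (auto simp: A_def dist_commute)
    finally show ?thesis
      using d(2)[of "c i" "c j" x z] that cS by (simp add: A_def)
  qed
  have inner: "F i - \<delta> * ?\<sigma> \<le> (\<integral>\<^sub>S z. K x z)" if x: "x \<in> A i" "i < N" for x i
  proof -
    have "F i - \<delta> * ?\<sigma> = (\<integral>\<^sub>S z. (\<Sum>j<N. K (c i) (c j) * indicator (A j) z) - \<delta>)"
    proof (subst Bochner_Integration.integral_diff[OF int_ind])
      show "F i - \<delta> * ?\<sigma> = (\<integral>\<^sub>S z. (\<Sum>j<N. K (c i) (c j) * indicator (A j) z)) - (\<integral>z. \<delta> \<partial>(surface_measure :: 'a measure))"
        unfolding val_ind F_def \<mu>_def by (simp add: mult.commute)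
    qed simp
    also have "\<dots> \<le> (\<integral>\<^sub>S z. K x z)"
    proof (rule integral_mono)
      show "integrable surface_measure (\<lambda>z. (\<Sum>j<N. K (c i) (c j) * indicator (A j) z) - \<delta>)"
        by (intro Bochner_Integration.integrable_diff int_ind surface.integrable_const)
      show "integrable surface_measure (K x)"
        using x by (intro integrable_sphere continuous_slice[OF K]) (auto simp: A_def)
      fix z :: 'a assume "z \<in> space surface_measure"
      then obtain j where j: "j < N" "z \<in> A j" using cover by auto
      then show "(\<Sum>j<N. K (c i) (c j) * indicator (A j) z) - \<delta> \<le> K x z"
        using close[OF x(1) j(2) x(2) j(1)] ind_sum[OF j(2,1), of "\<lambda>j. K (c i) (c j)"] by simp
    qed
    finally show ?thesis .
  qed
  have "(\<Sum>i<N. (F i - \<delta> * ?\<sigma>) * \<mu> i) = (\<integral>\<^sub>S x. (\<Sum>i<N. (F i - \<delta> * ?\<sigma>) * indicator (A i) x))"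
    unfolding val_ind \<mu>_def ..
  also have "\<dots> \<le> (\<integral>\<^sub>S x. (\<integral>\<^sub>S z. K x z))"
  proof (rule integral_mono[OF int_ind])
    fix x :: 'a assume "x \<in> space surface_measure"
    then obtain i where i: "i < N" "x \<in> A i" using cover by auto
    then show "(\<Sum>i<N. (F i - \<delta> * ?\<sigma>) * indicator (A i) x) \<le> (\<integral>\<^sub>S z. K x z)"
      using inner[OF i(2,1)] ind_sum[OF i(2,1), of "\<lambda>i. F i - \<delta> * ?\<sigma>"] by simp
  qed (intro integrable_sphere continuous_integral_slice K)
  finally have 1: "(\<Sum>i<N. (F i - \<delta> * ?\<sigma>) * \<mu> i) \<le> (\<integral>\<^sub>S x. (\<integral>\<^sub>S z. K x z))" .
  have "(\<Sum>i<N. \<mu> i) = ?\<sigma>"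
  proof -
    have "(\<Sum>i<N. 1 * \<mu> i) = (\<integral>\<^sub>S x. (\<Sum>i<N. 1 * indicator (A i) x))"
      unfolding val_ind \<mu>_def ..
    also have "\<dots> = (\<integral>x. 1 \<partial>(surface_measure :: 'a measure))"
    proof (rule integral_surface_cong)
      fix x :: 'a assume "norm x = 1"
      then obtain i where i: "i < N" "x \<in> A i" using cover[of x] by auto
      then show "(\<Sum>i<N. 1 * indicator (A i) x) = (1::real)" using ind_sum[OF i(2,1), of "\<lambda>_. 1"] by simp
    qed
    finally show ?thesis by simp
  qed
  moreover have "(\<Sum>i<N. (F i - \<delta> * ?\<sigma>) * \<mu> i) = (\<Sum>i<N. \<Sum>j<N. \<mu> i * \<mu> j * K (c i) (c j)) - \<delta> * ?\<sigma> * (\<Sum>i<N. \<mu> i)"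
    unfolding left_diff_distrib sum_subtractf sum_distrib_left[symmetric]
    by (simp add: F_def sum_distrib_left sum_distrib_right mult_ac)
  moreover have "(\<Sum>i<N. \<Sum>j<N. \<mu> i * \<mu> j * K (c i) (c j)) \<ge> 0"
    using psd cS unfolding psd_kernel_on_def by blast
  moreover have "\<delta> * ?\<sigma> * ?\<sigma> = \<epsilon>"
    using surface_measure_pos[where 'a = 'a] by (simp add: \<delta>_def power2_eq_square)
  ultimately show "0 \<le> (\<integral>\<^sub>S x. (\<integral>\<^sub>S z. K x z)) + \<epsilon>"
    using 1 by simp
qed

context zonal
begin

text \<open>
  By \<open>funk_hecke\<close> the kernel \<open>P\<^sub>k(x \<bullet> z)\<close> is a positive multiple of the integral of \<open>P\<^sub>k(x \<bullet> y) * P\<^sub>k(y \<bullet> z)\<close> over \<open>y\<close>, so the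
  quadratic form in question is an integral of quadratic forms of \<open>K\<close>.
\<close>

lemma psd_mult_gegenbauer:
  assumes K: "psd_kernel_on (sphere (0::'a) 1) K"
  shows "psd_kernel_on (sphere 0 1) (\<lambda>x y. K x y * P k (x \<bullet> y))"
  unfolding psd_kernel_on_def
proof (intro conjI ballI allI impI)
  fix x y :: 'a assume "x \<in> sphere 0 1" "y \<in> sphere 0 1"
  then show "K x y * P k (x \<bullet> y) = K y x * P k (y \<bullet> x)"
    using K by (simp add: psd_kernel_on_def inner_commute)
next
  fix N :: nat and x :: "nat \<Rightarrow> 'a" and c :: "nat \<Rightarrow> real" assume x: "\<forall>i<N. x i \<in> sphere 0 1"
  let ?C = "J (\<lambda>s. P k s * P k s)"
  have "?C > 0" using E_square_pos[of k] by (simp add: poly_mult[abs_def])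
  have "?C * (\<Sum>i<N. \<Sum>j<N. c i * c j * (K (x i) (x j) * P k (x i \<bullet> x j)))
      = (\<Sum>i<N. \<Sum>j<N. c i * c j * K (x i) (x j) * (?C * P k (x i \<bullet> x j)))"
    by (simp add: sum_distrib_left mult_ac)
  also have "\<dots> = (\<Sum>i<N. \<Sum>j<N. \<integral>\<^sub>S y. c i * c j * K (x i) (x j) * (P k (x i \<bullet> y) * P k (y \<bullet> x j)))"
    using x by (intro sum.cong refl) (simp add: funk_hecke[OF continuous_poly])
  also have "\<dots> = (\<integral>\<^sub>S y. (\<Sum>i<N. \<Sum>j<N. c i * c j * K (x i) (x j) * (P k (x i \<bullet> y) * P k (y \<bullet> x j))))"
    by (subst integral_surface_sum, intro continuous_intros, subst integral_surface_sum) (auto intro!: continuous_intros)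
  also have "\<dots> = (\<integral>\<^sub>S y. (\<Sum>i<N. \<Sum>j<N. (c i * P k (x i \<bullet> y)) * (c j * P k (x j \<bullet> y)) * K (x i) (x j)))"
    by (simp add: mult_ac inner_commute)
  also have "\<dots> \<ge> 0"
    by (rule integral_surface_nonneg) (use K x in \<open>auto simp: psd_kernel_on_def\<close>)
  finally show "(\<Sum>i<N. \<Sum>j<N. c i * c j * (K (x i) (x j) * P k (x i \<bullet> x j))) \<ge> 0"
    using \<open>?C > 0\<close> by (simp add: zero_le_mult_iff)
qed

lemma psd_gegenbauer: "psd_kernel_on (sphere (0::'a) 1) (\<lambda>x y. P k (x \<bullet> y))"
proof -
  have "psd_kernel_on (sphere (0::'a) 1) (\<lambda>x y. 1)"
    by (auto simp: psd_kernel_on_def sum_distrib_left[symmetric] sum_distrib_right[symmetric])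
  from psd_mult_gegenbauer[OF this, of k] show ?thesis by simp
qed

section \<open>Approximation of the identity by polynomials\<close>

abbreviation \<sigma> :: real where "\<sigma> \<equiv> J (\<lambda>_. 1)"

lemma sigma_eq: "\<sigma> = measure surface_measure (sphere (0::'a) 1)"
  by (simp add: J_def)

lemma sigma_pos: "\<sigma> > 0"
  unfolding sigma_eq by (rule surface_measure_pos)

text \<open>
  The polynomials whose Gegenbauer coefficients are nonnegative.
\<close>

inductive_set cone :: "real poly set" where
  zero: "0 \<in> cone"
| base: "Q k \<in> cone"
| add: "q \<in> cone \<Longrightarrow> r \<in> cone \<Longrightarrow> q + r \<in> cone"
| smult: "q \<in> cone \<Longrightarrow> c \<ge> 0 \<Longrightarrow> smult c q \<in> cone"

text \<open>
  The recurrence writes \<open>x * P\<^sub>k(x)\<close> as a combination of the two adjacent polynomials with positive coefficients.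
\<close>

lemma cone_shift: "q \<in> cone \<Longrightarrow> [:0, 1:] * q \<in> cone"
proof (induction rule: cone.induct)
  case (base k)
  show ?case
  proof (cases k)
    case 0
    then show ?thesis using cone.base[of 1] by simp
  next
    case (Suc n)
    let ?s = "2 * real n + 2 + p"
    have "[:0, 1:] * Q (Suc n)
        = smult ((real n + 1 + p) / ?s) (Q (Suc (Suc n))) + smult ((real n + 1) / ?s) (Q n)"
    proof (intro poly_eq_poly_eq_iff[THEN iffD1] ext)
      fix x
      have "x * P (Suc n) x = ((real n + 1 + p) * P (Suc (Suc n)) x + (real n + 1) * P n x) / ?s"
        using recurrence[of n x] p by (simp add: field_simps add_nonneg_eq_0_iff)
      then show "poly ([:0, 1:] * Q (Suc n)) x
        = poly (smult ((real n + 1 + p) / ?s) (Q (Suc (Suc n))) + smult ((real n + 1) / ?s) (Q n)) x"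
        by (simp only: poly_mult poly_add poly_smult poly_pCons poly_0) (simp add: add_divide_distrib[of "_ * _"])
    qed
    then show ?thesis unfolding Suc using p by (auto intro!: cone.intros)
  qed
qed (simp_all only: distrib_left mult_smult_right mult_zero_right cone.intros)

text \<open>
  As a function on \<open>[-1, 1]\<close> this is nonnegative and concentrates at \<open>1\<close> when \<open>N\<close> grows.
\<close>

definition bump :: "nat \<Rightarrow> real poly" where
  "bump N = [:1/2, 1/2:] ^ N"

lemma poly_bump: "poly (bump N) s = ((1 + s) / 2) ^ N"
  by (simp add: bump_def poly_power add_divide_distrib)

lemma bump_in_cone: "bump N \<in> cone"
proof (induction N)
  case 0
  then show ?case using cone.base[of 0] by (simp add: bump_def)
next
  case (Suc N)
  have "bump (Suc N) = smult (1/2) (bump N) + smult (1/2) ([:0, 1:] * bump N)"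
    by (simp add: bump_def)
  moreover have "smult (1/2) (bump N) + smult (1/2) ([:0, 1:] * bump N) \<in> cone"
    using Suc by (intro cone.add cone.smult cone_shift) simp_all
  ultimately show ?case by simp
qed

lemma J_mono:
  assumes "continuous_on UNIV \<Phi>" "continuous_on UNIV \<Psi>" "\<And>s. \<bar>s\<bar> \<le> 1 \<Longrightarrow> \<Phi> s \<le> \<Psi> s"
  shows "J \<Phi> \<le> J \<Psi>"
  unfolding J_def
proof (rule integral_surface_mono)
  fix y :: 'a assume "norm y = 1"
  then have "\<bar>e \<bullet> y\<bar> \<le> 1" using Cauchy_Schwarz_ineq2[of e y] norm_e by simp
  then show "\<Phi> (e \<bullet> y) \<le> \<Psi> (e \<bullet> y)" by (rule assms(3))
qed (intro continuous_zonal_slice assms)+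

lemma J_const: "J (\<lambda>_. c) = c * \<sigma>"
  using J_cmult[of c "\<lambda>_. 1"] by simp

lemma abs_inner_le_1: "norm (x::'a) = 1 \<Longrightarrow> norm z = 1 \<Longrightarrow> \<bar>x \<bullet> z\<bar> \<le> 1"
  using Cauchy_Schwarz_ineq2[of x z] by simp

lemma E_bump_pos: "E (bump N) > 0"
  unfolding J_def
proof (rule integral_surface_pos)
  show "0 \<le> poly (bump N) (e \<bullet> x)" if "norm x = 1" for x
    using abs_inner_le_1[OF norm_e that] by (simp add: poly_bump)
  show "0 < poly (bump N) (e \<bullet> e)" using norm_e by (simp add: poly_bump dot_square_norm)
qed (use norm_e in \<open>auto intro!: continuous_intros\<close>)

text \<open>
  The integral of the bump is at least its contribution from the smaller cap \<open>e \<bullet> y > 1 - \<delta> / 2\<close>, where the base of the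
  power is at least \<open>1 - \<delta> / 4\<close>. So up to a constant the quotient is a power of \<open>(1 - \<delta> / 2) / (1 - \<delta> / 4)\<close>.
\<close>

lemma bump_concentrates:
  assumes "0 < \<delta>" "\<delta> \<le> 1"
  shows "(\<lambda>N. (1 - \<delta> / 2) ^ N / E (bump N)) \<longlonglongrightarrow> 0"
proof -
  let ?U = "{y. e \<bullet> y > 1 - \<delta> / 2} :: 'a set"
  let ?\<mu> = "measure surface_measure (?U \<inter> sphere 0 1)"
  have "open ?U" by (intro open_Collect_less continuous_intros)
  then have mu: "?\<mu> > 0" using surface_measure_open_pos[of ?U e] norm_e assms by (simp add: dot_square_norm)
  have lower: "(1 - \<delta> / 4) ^ N * ?\<mu> \<le> E (bump N)" for N
  proof -
    have U: "?U \<inter> sphere 0 1 \<in> sets surface_measure"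
      using \<open>open ?U\<close> by (auto simp: sets_surface_measure_iff)
    have "(1 - \<delta> / 4) ^ N * ?\<mu> = (\<integral>\<^sub>S y. (1 - \<delta> / 4) ^ N * indicator (?U \<inter> sphere 0 1) y)"
      using U by (simp add: Int_assoc)
    also have "\<dots> \<le> (\<integral>\<^sub>S y. poly (bump N) (e \<bullet> y))"
    proof (rule integral_mono)
      show "integrable surface_measure (\<lambda>y. (1 - \<delta> / 4) ^ N * indicator (?U \<inter> sphere 0 1) y :: real)"
        using U by (intro integrable_mult_right integrable_real_indicator)
          (auto simp: surface.emeasure_finite less_top[symmetric])
      show "integrable surface_measure (\<lambda>y. poly (bump N) (e \<bullet> y))"
        by (intro integrable_sphere continuous_zonal_slice continuous_poly)
      fix y :: 'a assume "y \<in> space surface_measure"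
      then have y: "\<bar>e \<bullet> y\<bar> \<le> 1" using abs_inner_le_1[OF norm_e, of y] by simp
      show "(1 - \<delta> / 4) ^ N * indicator (?U \<inter> sphere 0 1) y \<le> poly (bump N) (e \<bullet> y)"
      proof (cases "y \<in> ?U \<inter> sphere 0 1")
        case True
        have "(1 - \<delta> / 4) ^ N \<le> ((1 + e \<bullet> y) / 2) ^ N"
          using True assms by (intro power_mono) (auto simp: field_simps)
        then show ?thesis using True by (simp add: poly_bump)
      next
        case False
        have "0 \<le> ((1 + e \<bullet> y) / 2) ^ N" using y by (intro zero_le_power) auto
        then show ?thesis using False by (simp add: poly_bump del: Int_iff)
      qed
    qed
    finally show ?thesis by (simp add: J_def)
  qed
  let ?q = "(1 - \<delta> / 2) / (1 - \<delta> / 4)"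
  have q: "0 \<le> ?q" "?q < 1" using assms by (auto simp: field_simps)
  have "(\<lambda>N. ?q ^ N / ?\<mu>) \<longlonglongrightarrow> 0 / ?\<mu>"
    using mu by (intro tendsto_divide tendsto_const LIMSEQ_realpow_zero q) auto
  then have lim: "(\<lambda>N. ?q ^ N / ?\<mu>) \<longlonglongrightarrow> 0" by simp
  show ?thesis
  proof (rule tendsto_sandwich[OF _ _ tendsto_const lim])
    show "\<forall>\<^sub>F N in sequentially. 0 \<le> (1 - \<delta> / 2) ^ N / E (bump N)"
      using assms E_bump_pos by (intro always_eventually allI divide_nonneg_pos) auto
    have "(1 - \<delta> / 2) ^ N / E (bump N) \<le> ?q ^ N / ?\<mu>" for N
    proof -
      have pos: "(1 - \<delta> / 4) ^ N * ?\<mu> > 0" using mu assms by simp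
      have "(1 - \<delta> / 2) ^ N / E (bump N) \<le> (1 - \<delta> / 2) ^ N / ((1 - \<delta> / 4) ^ N * ?\<mu>)"
        using pos lower[of N] E_bump_pos[of N] assms by (intro divide_left_mono) auto
      then show ?thesis by (simp add: power_divide)
    qed
    then show "\<forall>\<^sub>F N in sequentially. (1 - \<delta> / 2) ^ N / E (bump N) \<le> ?q ^ N / ?\<mu>" by simp
  qed
qed

text \<open>
  Inside a small cap around \<open>x\<close> the values of \<open>F\<close> are close to \<open>F x\<close>; outside it, where \<open>x \<bullet> z \<le> 1 - \<delta>\<close>, the normalised
  bump is uniformly small by \<open>bump_concentrates\<close>.
\<close>

lemma approximate_identity:
  assumes F: "continuous_on (sphere (0::'a) 1) F" and x: "norm x = 1"
  shows "(\<lambda>N. \<integral>\<^sub>S z. F z * (poly (bump N) (x \<bullet> z) / E (bump N))) \<longlonglongrightarrow> F x"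
proof (rule LIMSEQ_I)
  fix \<epsilon> :: real assume \<epsilon>: "\<epsilon> > 0"
  have "compact (F ` sphere 0 1)" by (intro compact_continuous_image F) simp
  then obtain C where C: "\<And>z. norm z = 1 \<Longrightarrow> \<bar>F z\<bar> \<le> C"
    using compact_imp_bounded bounded_iff by (metis imageI mem_sphere_0 real_norm_def)
  obtain d where d: "d > 0" "\<And>z. norm z = 1 \<Longrightarrow> dist z x < d \<Longrightarrow> dist (F z) (F x) < \<epsilon> / 2"
    using F x \<epsilon> unfolding continuous_on_iff by (metis half_gt_zero mem_sphere_0)
  define \<delta> where "\<delta> = min 1 (d\<^sup>2 / 2)"
  have \<delta>: "0 < \<delta>" "\<delta> \<le> 1" using d by (auto simp: \<delta>_def)
  have C0: "C \<ge> 0" using C[OF x] by simp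
  have near: "dist z x < d" if "norm z = 1" "x \<bullet> z > 1 - \<delta>" for z
  proof -
    have "(dist z x)\<^sup>2 = z \<bullet> z - 2 * (x \<bullet> z) + x \<bullet> x"
      by (simp add: dist_norm power2_norm_eq_inner inner_diff_left inner_diff_right inner_commute[of z x])
    also have "\<dots> = 2 - 2 * (x \<bullet> z)" using that x by (simp add: dot_square_norm)
    also have "\<dots> < d\<^sup>2" using that by (auto simp: \<delta>_def min_def split: if_splits)
    finally show ?thesis using d by (metis less_imp_le power2_less_imp_less)
  qed
  note cont_bump = continuous_zonal_slice[OF continuous_poly]
  have bound: "\<bar>(\<integral>\<^sub>S z. F z * (poly (bump N) (x \<bullet> z) / E (bump N))) - F x\<bar>
      \<le> \<epsilon> / 2 + 2 * C * \<sigma> * ((1 - \<delta> / 2) ^ N / E (bump N))" for N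
  proof -
    let ?b = "\<lambda>z. poly (bump N) (x \<bullet> z)" and ?I = "E (bump N)"
    have I: "(\<integral>\<^sub>S z. ?b z) = ?I" by (rule J_eq[OF continuous_poly x])
    have "(\<integral>\<^sub>S z. F z * (?b z / ?I)) - F x = (\<integral>\<^sub>S z. F z * (?b z / ?I)) - (\<integral>\<^sub>S z. F x * (?b z / ?I))"
      using I E_bump_pos[of N] by simp
    also have "\<dots> = (\<integral>\<^sub>S z. F z * (?b z / ?I) - F x * (?b z / ?I))"
      using E_bump_pos[of N] by (intro integral_surface_diff[symmetric] continuous_intros F cont_bump) auto
    finally have "\<bar>(\<integral>\<^sub>S z. F z * (?b z / ?I)) - F x\<bar> \<le> (\<integral>\<^sub>S z. \<bar>F z * (?b z / ?I) - F x * (?b z / ?I)\<bar>)"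
      using integral_norm_bound[of surface_measure "\<lambda>z. F z * (?b z / ?I) - F x * (?b z / ?I)"] by simp
    also have "\<dots> \<le> (\<integral>\<^sub>S z. \<epsilon> / 2 * (?b z / ?I) + 2 * C * ((1 - \<delta> / 2) ^ N / ?I))"
    proof (rule integral_surface_mono)
      fix z :: 'a assume z: "norm z = 1"
      have s: "\<bar>x \<bullet> z\<bar> \<le> 1" by (rule abs_inner_le_1[OF x z])
      have b: "?b z / ?I \<ge> 0" using s E_bump_pos[of N] by (simp add: poly_bump)
      have "\<bar>F z * (?b z / ?I) - F x * (?b z / ?I)\<bar> = \<bar>F z - F x\<bar> * (?b z / ?I)"
        using b by (metis abs_mult abs_of_nonneg left_diff_distrib)
      also have "\<dots> \<le> \<epsilon> / 2 * (?b z / ?I) + 2 * C * ((1 - \<delta> / 2) ^ N / ?I)"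
      proof (cases "x \<bullet> z > 1 - \<delta>")
        case True
        then have "\<bar>F z - F x\<bar> * (?b z / ?I) \<le> \<epsilon> / 2 * (?b z / ?I)"
          using d(2)[OF z near[OF z True]] b by (intro mult_right_mono) (auto simp: dist_real_def)
        moreover have "2 * C * ((1 - \<delta> / 2) ^ N / ?I) \<ge> 0"
          using C0 \<delta> E_bump_pos[of N] by (intro mult_nonneg_nonneg divide_nonneg_pos) auto
        ultimately show ?thesis by linarith
      next
        case False
        have "?b z \<le> (1 - \<delta> / 2) ^ N"
          unfolding poly_bump using False s by (intro power_mono) auto
        then have "?b z / ?I \<le> (1 - \<delta> / 2) ^ N / ?I" using E_bump_pos[of N] by (intro divide_right_mono) auto
        moreover have "\<bar>F z - F x\<bar> \<le> 2 * C" using C[OF z] C[OF x] by linarith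
        ultimately have "\<bar>F z - F x\<bar> * (?b z / ?I) \<le> 2 * C * ((1 - \<delta> / 2) ^ N / ?I)"
          using b C0 by (intro mult_mono) auto
        moreover have "\<epsilon> / 2 * (?b z / ?I) \<ge> 0" using \<epsilon> b by (intro mult_nonneg_nonneg) auto
        ultimately show ?thesis by linarith
      qed
      finally show "\<bar>F z * (?b z / ?I) - F x * (?b z / ?I)\<bar> \<le> \<epsilon> / 2 * (?b z / ?I) + 2 * C * ((1 - \<delta> / 2) ^ N / ?I)" .
    qed (use E_bump_pos[of N] in \<open>auto intro!: continuous_intros F cont_bump\<close>)
    also have "\<dots> = (\<integral>\<^sub>S z. \<epsilon> / 2 * (?b z / ?I)) + (\<integral>z. 2 * C * ((1 - \<delta> / 2) ^ N / ?I) \<partial>(surface_measure :: 'a measure))"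
      using E_bump_pos[of N] by (intro integral_surface_add continuous_intros cont_bump) auto
    also have "\<dots> = \<epsilon> / 2 + 2 * C * \<sigma> * ((1 - \<delta> / 2) ^ N / ?I)" using I E_bump_pos[of N] by (simp add: sigma_eq)
    finally show ?thesis .
  qed
  have "(\<lambda>N. 2 * C * \<sigma> * ((1 - \<delta> / 2) ^ N / E (bump N))) \<longlonglongrightarrow> 2 * C * \<sigma> * 0"
    by (intro tendsto_intros bump_concentrates \<delta>)
  then have "eventually (\<lambda>N. 2 * C * \<sigma> * ((1 - \<delta> / 2) ^ N / E (bump N)) < \<epsilon> / 2) sequentially"
    using \<epsilon> by (intro order_tendstoD(2)) auto
  then obtain N0 where N0: "\<And>N. N \<ge> N0 \<Longrightarrow> 2 * C * \<sigma> * ((1 - \<delta> / 2) ^ N / E (bump N)) < \<epsilon> / 2"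
    by (auto simp: eventually_sequentially)
  have "norm ((\<integral>\<^sub>S z. F z * (poly (bump N) (x \<bullet> z) / E (bump N))) - F x) < \<epsilon>" if "N \<ge> N0" for N
    using bound[of N] N0[OF that] by simp
  then show "\<exists>N0. \<forall>N\<ge>N0. norm ((\<integral>\<^sub>S z. F z * (poly (bump N) (x \<bullet> z) / E (bump N))) - F x) < \<epsilon>"
    by blast
qed

end

section \<open>The eigenvalue bound\<close>

lemma double_integral_bounded_limit:
  fixes K :: "nat \<Rightarrow> 'a::euclidean_space \<Rightarrow> 'a \<Rightarrow> real"
  assumes cont: "\<And>n. continuous_kernel (K n)"
    and cont': "continuous_kernel L"
    and lim: "\<And>x z. norm x = 1 \<Longrightarrow> norm z = 1 \<Longrightarrow> (\<lambda>n. K n x z) \<longlonglongrightarrow> L x z"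
    and bound: "\<And>n x z. norm x = 1 \<Longrightarrow> norm z = 1 \<Longrightarrow> \<bar>K n x z\<bar> \<le> C"
  shows "(\<lambda>n. \<integral>\<^sub>S x. (\<integral>\<^sub>S z. K n x z))
    \<longlonglongrightarrow> (\<integral>\<^sub>S x. (\<integral>\<^sub>S z. L x z))"
proof (rule integral_dominated_convergence[where w = "\<lambda>_. C * measure surface_measure (sphere (0::'a) 1)"])
  show "(\<lambda>x. \<integral>\<^sub>S z. L x z) \<in> borel_measurable surface_measure"
    by (intro measurable_sphere continuous_integral_slice cont')
  show "(\<lambda>x. \<integral>\<^sub>S z. K n x z) \<in> borel_measurable surface_measure" for n
    by (intro measurable_sphere continuous_integral_slice cont)
  show "integrable (surface_measure :: 'a measure) (\<lambda>_. C * measure surface_measure (sphere (0::'a) 1))" by simp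
  show "AE x in surface_measure. (\<lambda>n. \<integral>\<^sub>S z. K n x z) \<longlonglongrightarrow> (\<integral>\<^sub>S z. L x z)"
  proof (rule AE_I2)
    fix x :: 'a assume "x \<in> space surface_measure"
    then have x: "norm x = 1" by simp
    show "(\<lambda>n. \<integral>\<^sub>S z. K n x z) \<longlonglongrightarrow> (\<integral>\<^sub>S z. L x z)"
    proof (rule integral_dominated_convergence[where w = "\<lambda>_. C"])
      show "AE z in surface_measure. (\<lambda>n. K n x z) \<longlonglongrightarrow> L x z" using lim[OF x] by (intro AE_I2) simp
      show "AE z in surface_measure. norm (K n x z) \<le> C" for n using bound[OF x] by (intro AE_I2) simp
    qed (simp_all add: measurable_sphere continuous_slice[OF cont x] continuous_slice[OF cont' x])
  qed
  show "AE x in surface_measure. norm (\<integral>\<^sub>S z. K n x z) \<le> C * measure surface_measure (sphere (0::'a) 1)" for n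
  proof (rule AE_I2)
    fix x :: 'a assume "x \<in> space surface_measure"
    then have x: "norm x = 1" by simp
    have "norm (\<integral>\<^sub>S z. K n x z) \<le> (\<integral>\<^sub>S z. norm (K n x z))"
      by (rule integral_norm_bound)
    also have "\<dots> \<le> (\<integral>z. C \<partial>(surface_measure :: 'a measure))"
      using bound[OF x] by (intro integral_surface_mono continuous_intros continuous_slice[OF cont x]) auto
    also have "\<dots> = C * measure surface_measure (sphere (0::'a) 1)" by simp
    finally show "norm (\<integral>\<^sub>S z. K n x z) \<le> C * measure surface_measure (sphere (0::'a) 1)" .
  qed
qed

lemma continuous_zonal:
  assumes "continuous_on UNIV (f :: real \<Rightarrow> real)"
  shows "continuous_on (sphere 0 1 \<times> sphere 0 1) (\<lambda>(x::'a::euclidean_space, y). f (x \<bullet> y))"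
  unfolding case_prod_beta by (intro continuous_on_compose2[OF assms] continuous_intros) auto

lemma continuous_kernel_mult:
  fixes K L :: "'a::euclidean_space \<Rightarrow> 'a \<Rightarrow> real"
  assumes "continuous_kernel K" "continuous_kernel L"
  shows "continuous_on (sphere 0 1 \<times> sphere 0 1) (\<lambda>(x, y). K x y * L x y)"
  using assms unfolding case_prod_beta by (intro continuous_intros)

lemma double_integral_add:
  fixes K L :: "'a::euclidean_space \<Rightarrow> 'a \<Rightarrow> real"
  assumes K: "continuous_kernel K" and L: "continuous_kernel L"
  shows "(\<integral>\<^sub>S x. (\<integral>\<^sub>S z. K x z + L x z))
    = (\<integral>\<^sub>S x. (\<integral>\<^sub>S z. K x z)) + (\<integral>\<^sub>S x. (\<integral>\<^sub>S z. L x z))"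
proof -
  have "(\<integral>\<^sub>S x. (\<integral>\<^sub>S z. K x z + L x z))
      = (\<integral>\<^sub>S x. (\<integral>\<^sub>S z. K x z) + (\<integral>\<^sub>S z. L x z))"
    by (rule integral_surface_cong) (intro integral_surface_add continuous_slice K L)
  also have "\<dots> = (\<integral>\<^sub>S x. (\<integral>\<^sub>S z. K x z)) + (\<integral>\<^sub>S x. (\<integral>\<^sub>S z. L x z))"
    by (intro integral_surface_add continuous_integral_slice K L)
  finally show ?thesis .
qed

lemma double_integral_mono:
  fixes K L :: "'a::euclidean_space \<Rightarrow> 'a \<Rightarrow> real"
  assumes K: "continuous_kernel K" and L: "continuous_kernel L"
    and le: "\<And>x z. norm x = 1 \<Longrightarrow> norm z = 1 \<Longrightarrow> K x z \<le> L x z"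
  shows "(\<integral>\<^sub>S x. (\<integral>\<^sub>S z. K x z)) \<le> (\<integral>\<^sub>S x. (\<integral>\<^sub>S z. L x z))"
  by (intro integral_surface_mono continuous_integral_slice continuous_slice K L le)

context zonal
begin

text \<open>
  As \<open>K\<close> is positive semidefinite, this functional is nonnegative on the \<open>P\<^sub>k\<close>, and by \<open>funk_hecke\<close> convolution of the
  argument with a zonal function acts diagonally on them.
\<close>

definition \<Lambda> :: "('a \<Rightarrow> 'a \<Rightarrow> real) \<Rightarrow> (real \<Rightarrow> real) \<Rightarrow> real" where
  "\<Lambda> K f = (\<integral>\<^sub>S x. (\<integral>\<^sub>S z. K x z * f (x \<bullet> z)))"

lemma Lambda_add:
  assumes K: "continuous_kernel K" and f: "continuous_on UNIV f" "continuous_on UNIV g"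
  shows "\<Lambda> K (\<lambda>s. f s + g s) = \<Lambda> K f + \<Lambda> K g"
  unfolding \<Lambda>_def distrib_left
  by (intro double_integral_add continuous_kernel_mult K continuous_zonal f)

lemma Lambda_cmult: "\<Lambda> K (\<lambda>s. c * f s) = c * \<Lambda> K f"
  unfolding \<Lambda>_def by (simp add: mult.left_commute[of _ c])

lemma Lambda_gegenbauer_nonneg:
  assumes K: "continuous_kernel K" and psd: "psd_kernel_on (sphere 0 1) K"
  shows "\<Lambda> K (P k) \<ge> 0"
  unfolding \<Lambda>_def
  by (intro psd_double_integral_nonneg continuous_kernel_mult K continuous_zonal continuous_poly psd_mult_gegenbauer psd)

lemma E_gegenbauer: "k \<ge> 1 \<Longrightarrow> E (Q k) = 0"
  using orthogonal[of k 0] by simp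

text \<open>
  The polynomial \<open>r\<close> is the convolution of \<open>\<Phi>\<close> and \<open>q\<close>. Both sides of the inequality are additive in \<open>q\<close>, which reduces
  it to \<open>q = Q k\<close>. There \<open>r\<close> is \<open>q\<close> times a factor that is at least \<open>m\<close>; for \<open>k = 0\<close> the factor is \<open>1\<close>, and the second term on
  the left accounts for the difference.
\<close>

lemma cone_convolution:
  assumes K: "continuous_kernel K" and psd: "psd_kernel_on (sphere 0 1) K"
    and \<Phi>: "continuous_on UNIV \<Phi>" "J \<Phi> = 1" and m: "\<And>k. J (\<lambda>s. \<Phi> s * P k s) \<ge> m"
    and q: "q \<in> cone"
  shows "\<exists>r. (\<forall>x z::'a. norm x = 1 \<longrightarrow> norm z = 1 \<longrightarrow> (\<integral>\<^sub>S y. \<Phi> (x \<bullet> y) * poly q (y \<bullet> z)) = poly r (x \<bullet> z)) \<and>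
    m * \<Lambda> K (poly q) + (1 - m) * (E q / \<sigma>) * \<Lambda> K (\<lambda>_. 1) \<le> \<Lambda> K (poly r)"
  using q
proof (induction rule: cone.induct)
  case zero
  have "J (\<lambda>_. 0) = 0" using J_const[of 0] by simp
  moreover have "\<Lambda> K (\<lambda>_. 0) = 0" by (simp add: \<Lambda>_def)
  ultimately show ?case by (intro exI[of _ 0]) (simp add: poly_0[abs_def])
next
  case (base k)
  let ?c = "J (\<lambda>s. \<Phi> s * P k s)"
  have "\<Lambda> K (poly (smult ?c (Q k))) = ?c * \<Lambda> K (P k)"
    using Lambda_cmult[of K ?c "P k"] by (simp add: poly_smult[abs_def])
  moreover have "m * \<Lambda> K (P k) + (1 - m) * (E (Q k) / \<sigma>) * \<Lambda> K (\<lambda>_. 1) \<le> ?c * \<Lambda> K (P k)"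
  proof (cases "k = 0")
    case True
    then have "P k = (\<lambda>_. 1)" by (auto simp: poly_1)
    then show ?thesis using \<Phi> sigma_pos by (simp add: algebra_simps)
  next
    case False
    then show ?thesis using E_gegenbauer[of k] m[of k] Lambda_gegenbauer_nonneg[OF K psd, of k]
      by (simp add: mult_right_mono)
  qed
  ultimately have "m * \<Lambda> K (P k) + (1 - m) * (E (Q k) / \<sigma>) * \<Lambda> K (\<lambda>_. 1) \<le> \<Lambda> K (poly (smult ?c (Q k)))" by simp
  moreover have "(\<integral>\<^sub>S y. \<Phi> (x \<bullet> y) * P k (y \<bullet> z)) = poly (smult ?c (Q k)) (x \<bullet> z)"
    if "norm x = 1" "norm z = 1" for x z :: 'a
    using funk_hecke[OF \<Phi>(1) that] by simp
  ultimately show ?case by blast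
next
  case (add q1 q2)
  then obtain r1 r2 where r1: "\<forall>x z::'a. norm x = 1 \<longrightarrow> norm z = 1 \<longrightarrow> (\<integral>\<^sub>S y. \<Phi> (x \<bullet> y) * poly q1 (y \<bullet> z)) = poly r1 (x \<bullet> z)"
     "m * \<Lambda> K (poly q1) + (1 - m) * (E q1 / \<sigma>) * \<Lambda> K (\<lambda>_. 1) \<le> \<Lambda> K (poly r1)"
   and r2: "\<forall>x z::'a. norm x = 1 \<longrightarrow> norm z = 1 \<longrightarrow> (\<integral>\<^sub>S y. \<Phi> (x \<bullet> y) * poly q2 (y \<bullet> z)) = poly r2 (x \<bullet> z)"
     "m * \<Lambda> K (poly q2) + (1 - m) * (E q2 / \<sigma>) * \<Lambda> K (\<lambda>_. 1) \<le> \<Lambda> K (poly r2)"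
    by blast
  have conv: "(\<integral>\<^sub>S y. \<Phi> (x \<bullet> y) * poly (q1 + q2) (y \<bullet> z)) = poly (r1 + r2) (x \<bullet> z)"
    if "norm x = 1" "norm z = 1" for x z :: 'a
    using r1(1) r2(1) that unfolding poly_add distrib_left
    by (subst integral_surface_add) (auto intro!: continuous_intros continuous_zonal_slice \<Phi>)
  have Lam: "\<Lambda> K (poly (q + r)) = \<Lambda> K (poly q) + \<Lambda> K (poly r)" for q r
    using Lambda_add[OF K continuous_poly continuous_poly, of q r] by (simp add: poly_add[abs_def])
  have "m * \<Lambda> K (poly (q1 + q2)) + (1 - m) * (E (q1 + q2) / \<sigma>) * \<Lambda> K (\<lambda>_. 1)
      = (m * \<Lambda> K (poly q1) + (1 - m) * (E q1 / \<sigma>) * \<Lambda> K (\<lambda>_. 1)) + (m * \<Lambda> K (poly q2) + (1 - m) * (E q2 / \<sigma>) * \<Lambda> K (\<lambda>_. 1))"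
    unfolding Lam E_add by (simp add: add_divide_distrib algebra_simps)
  also have "\<dots> \<le> \<Lambda> K (poly (r1 + r2))" unfolding Lam using r1(2) r2(2) by (rule add_mono)
  finally show ?case using conv by blast
next
  case (smult q c)
  then obtain r where r: "\<forall>x z::'a. norm x = 1 \<longrightarrow> norm z = 1 \<longrightarrow> (\<integral>\<^sub>S y. \<Phi> (x \<bullet> y) * poly q (y \<bullet> z)) = poly r (x \<bullet> z)"
     "m * \<Lambda> K (poly q) + (1 - m) * (E q / \<sigma>) * \<Lambda> K (\<lambda>_. 1) \<le> \<Lambda> K (poly r)" by blast
  have conv: "(\<integral>\<^sub>S y. \<Phi> (x \<bullet> y) * poly (smult c q) (y \<bullet> z)) = poly (smult c r) (x \<bullet> z)"
    if "norm x = 1" "norm z = 1" for x z :: 'a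
  proof -
    have "(\<integral>\<^sub>S y. \<Phi> (x \<bullet> y) * poly (smult c q) (y \<bullet> z)) = (\<integral>\<^sub>S y. c * (\<Phi> (x \<bullet> y) * poly q (y \<bullet> z)))"
      by (simp add: mult.left_commute)
    then show ?thesis using r(1) that by simp
  qed
  have Lam: "\<Lambda> K (poly (smult c q)) = c * \<Lambda> K (poly q)" for q
    using Lambda_cmult[of K c "poly q"] by (simp add: poly_smult[abs_def])
  have "m * \<Lambda> K (poly (smult c q)) + (1 - m) * (E (smult c q) / \<sigma>) * \<Lambda> K (\<lambda>_. 1)
      = c * (m * \<Lambda> K (poly q) + (1 - m) * (E q / \<sigma>) * \<Lambda> K (\<lambda>_. 1))"
    unfolding Lam E_smult by (simp add: algebra_simps)
  also have "\<dots> \<le> \<Lambda> K (poly (smult c r))" unfolding Lam using r(2) smult.hyps by (intro mult_left_mono)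
  finally show ?case using conv by blast
qed

text \<open>
  Apply \<open>cone_convolution\<close> to bumps of integral \<open>1\<close>. As they concentrate, \<open>\<Lambda>\<close> of the bump tends to the trace of \<open>K\<close>,
  and the convolution of \<open>\<Phi>\<close> with the bump tends to \<open>\<Phi>\<close>.
\<close>

lemma hoffman_bound:
  assumes K: "continuous_kernel K" and psd: "psd_kernel_on (sphere 0 1) K"
    and \<Phi>: "continuous_on UNIV \<Phi>" "J \<Phi> = 1" "\<And>s. \<Phi> s \<ge> 0" and m: "\<And>k. J (\<lambda>s. \<Phi> s * P k s) \<ge> m"
  shows "m * (\<integral>\<^sub>S x. K x x) + (1 - m) / \<sigma> * (\<integral>\<^sub>S x. (\<integral>\<^sub>S z. K x z)) \<le> \<Lambda> K \<Phi>"
proof -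
  have "compact ((\<lambda>(x, y). K x y) ` (sphere (0::'a) 1 \<times> sphere (0::'a) 1))"
    by (intro compact_continuous_image K compact_Times) auto
  then obtain C where C': "\<And>u. u \<in> sphere (0::'a) 1 \<times> sphere (0::'a) 1 \<Longrightarrow> norm (case u of (x, y) \<Rightarrow> K x y) \<le> C"
    using compact_imp_bounded bounded_iff by (metis (no_types, lifting) imageI)
  have C: "\<bar>K x z\<bar> \<le> C" if "norm x = 1" "norm z = 1" for x z using C'[of "(x, z)"] that by simp
  define q where "q N = smult (1 / E (bump N)) (bump N)" for N
  have q: "q N \<in> cone" "E (q N) = 1" for N
    using E_bump_pos[of N] bump_in_cone[of N] by (auto simp: q_def E_smult intro!: cone.smult)
  have q_val: "poly (q N) s = poly (bump N) s / E (bump N)" for N s by (simp add: q_def)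
  have q_nonneg: "poly (q N) (x \<bullet> z) \<ge> 0" if "norm x = 1" "norm z = 1" for x z :: 'a and N
    using abs_inner_le_1[OF that] E_bump_pos[of N] by (simp add: q_val poly_bump)
  have "\<exists>r. \<forall>N. (\<forall>x z::'a. norm x = 1 \<longrightarrow> norm z = 1 \<longrightarrow>
        (\<integral>\<^sub>S y. \<Phi> (x \<bullet> y) * poly (q N) (y \<bullet> z)) = poly (r N) (x \<bullet> z)) \<and>
      m * \<Lambda> K (poly (q N)) + (1 - m) * (1 / \<sigma>) * \<Lambda> K (\<lambda>_. 1) \<le> \<Lambda> K (poly (r N))"
    using cone_convolution[OF K psd \<Phi>(1,2) m q(1)] unfolding q(2) by (intro choice allI)
  then obtain r where r: "\<And>N x z::'a. norm x = 1 \<Longrightarrow> norm z = 1 \<Longrightarrow> (\<integral>\<^sub>S y. \<Phi> (x \<bullet> y) * poly (q N) (y \<bullet> z)) = poly (r N) (x \<bullet> z)"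
    "\<And>N. m * \<Lambda> K (poly (q N)) + (1 - m) * (1 / \<sigma>) * \<Lambda> K (\<lambda>_. 1) \<le> \<Lambda> K (poly (r N))"
    by blast
  have "(\<lambda>N. \<Lambda> K (poly (q N))) \<longlonglongrightarrow> (\<integral>\<^sub>S x. K x x)"
    unfolding \<Lambda>_def
  proof (rule integral_dominated_convergence[where w = "\<lambda>_. C"])
    have "continuous_on (sphere 0 1) (\<lambda>x. case (x, x) of (x, y) \<Rightarrow> K x y)"
      by (rule continuous_on_compose2[OF K]) (auto intro!: continuous_intros)
    then show "(\<lambda>x. K x x) \<in> borel_measurable surface_measure" by (simp add: measurable_sphere)
    show "(\<lambda>x. \<integral>\<^sub>S z. K x z * poly (q N) (x \<bullet> z)) \<in> borel_measurable surface_measure" for N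
      by (intro measurable_sphere continuous_integral_slice continuous_kernel_mult K continuous_zonal continuous_poly)
    show "integrable surface_measure (\<lambda>_::'a. C)" by simp
    show "AE x in surface_measure. (\<lambda>N. \<integral>\<^sub>S z. K x z * poly (q N) (x \<bullet> z)) \<longlonglongrightarrow> K x x"
      unfolding q_val by (intro AE_I2 approximate_identity continuous_slice[OF K]) auto
    show "AE x in surface_measure. norm (\<integral>\<^sub>S z. K x z * poly (q N) (x \<bullet> z)) \<le> C" for N
    proof (rule AE_I2)
      fix x :: 'a assume "x \<in> space surface_measure"
      then have x: "norm x = 1" by simp
      have "norm (\<integral>\<^sub>S z. K x z * poly (q N) (x \<bullet> z)) \<le> (\<integral>\<^sub>S z. norm (K x z * poly (q N) (x \<bullet> z)))"
        by (rule integral_norm_bound)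
      also have "\<dots> \<le> (\<integral>\<^sub>S z. C * poly (q N) (x \<bullet> z))"
      proof (rule integral_surface_mono)
        fix z :: 'a assume z: "norm z = 1"
        show "norm (K x z * poly (q N) (x \<bullet> z)) \<le> C * poly (q N) (x \<bullet> z)"
          using C[OF x z] q_nonneg[OF x z] by (simp add: abs_mult mult_right_mono)
      qed (intro continuous_intros continuous_slice[OF K x])+
      also have "\<dots> = C" using J_eq[OF continuous_poly x, of "q N"] q(2) by simp
      finally show "norm (\<integral>\<^sub>S z. K x z * poly (q N) (x \<bullet> z)) \<le> C" .
    qed
  qed
  then have left: "(\<lambda>N. m * \<Lambda> K (poly (q N)) + (1 - m) * (1 / \<sigma>) * \<Lambda> K (\<lambda>_. 1))
      \<longlonglongrightarrow> m * (\<integral>\<^sub>S x. K x x) + (1 - m) * (1 / \<sigma>) * \<Lambda> K (\<lambda>_. 1)"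
    by (intro tendsto_intros)
  have "compact (\<Phi> ` {-1..1})" by (intro compact_continuous_image continuous_on_subset[OF \<Phi>(1)]) auto
  then obtain C\<Phi> where "\<And>s. s \<in> {-1..1} \<Longrightarrow> norm (\<Phi> s) \<le> C\<Phi>"
    using compact_imp_bounded bounded_iff by (metis imageI)
  then have C\<Phi>: "\<Phi> s \<le> C\<Phi>" if "\<bar>s\<bar> \<le> 1" for s using that by (force simp: abs_le_iff)
  have r_bound: "\<bar>poly (r N) (x \<bullet> z)\<bar> \<le> C\<Phi>" if xz: "norm x = 1" "norm z = 1" for N and x z :: 'a
  proof -
    have "\<bar>poly (r N) (x \<bullet> z)\<bar> \<le> (\<integral>\<^sub>S y. norm (\<Phi> (x \<bullet> y) * poly (q N) (y \<bullet> z)))"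
      unfolding r(1)[OF xz, symmetric] real_norm_def[symmetric] by (rule integral_norm_bound)
    also have "\<dots> \<le> (\<integral>\<^sub>S y. C\<Phi> * poly (q N) (z \<bullet> y))"
    proof (rule integral_surface_mono)
      fix y :: 'a assume y: "norm y = 1"
      show "norm (\<Phi> (x \<bullet> y) * poly (q N) (y \<bullet> z)) \<le> C\<Phi> * poly (q N) (z \<bullet> y)"
        using C\<Phi>[OF abs_inner_le_1[OF xz(1) y]] q_nonneg[OF y xz(2)] \<Phi>(3)
        by (simp add: abs_mult mult_right_mono inner_commute[of z y])
    qed (intro continuous_intros continuous_zonal_slice \<Phi>)+
    also have "\<dots> = C\<Phi>" using J_eq[OF continuous_poly xz(2), of "q N"] q(2) by simp
    finally show ?thesis .
  qed
  have right: "(\<lambda>N. \<Lambda> K (poly (r N))) \<longlonglongrightarrow> \<Lambda> K \<Phi>"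
    unfolding \<Lambda>_def
  proof (rule double_integral_bounded_limit)
    show "(\<lambda>N. K x z * poly (r N) (x \<bullet> z)) \<longlonglongrightarrow> K x z * \<Phi> (x \<bullet> z)" if xz: "norm x = 1" "norm z = 1" for x z :: 'a
    proof (intro tendsto_intros)
      have "(\<lambda>N. \<integral>\<^sub>S y. \<Phi> (x \<bullet> y) * (poly (bump N) (z \<bullet> y) / E (bump N))) \<longlonglongrightarrow> \<Phi> (x \<bullet> z)"
        by (rule approximate_identity[OF continuous_zonal_slice[OF \<Phi>(1)] xz(2)])
      then show "(\<lambda>N. poly (r N) (x \<bullet> z)) \<longlonglongrightarrow> \<Phi> (x \<bullet> z)"
        unfolding r(1)[OF xz, symmetric] q_val by (simp add: inner_commute[of z])
    qed
    show "\<bar>K x z * poly (r N) (x \<bullet> z)\<bar> \<le> C * C\<Phi>" if xz: "norm x = 1" "norm z = 1" for N and x z :: 'a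
      using C[OF xz] r_bound[OF xz] unfolding abs_mult by (intro mult_mono) auto
  qed (intro continuous_kernel_mult K continuous_zonal continuous_poly \<Phi>)+
  have "m * (\<integral>\<^sub>S x. K x x) + (1 - m) * (1 / \<sigma>) * \<Lambda> K (\<lambda>_. 1) \<le> \<Lambda> K \<Phi>"
    by (rule LIMSEQ_le[OF left right]) (use r(2) in blast)
  then show ?thesis by (simp add: \<Lambda>_def)
qed

end

section \<open>Theta numbers of distance graphs\<close>

lemma psd_le_diagonal:
  assumes K: "psd_kernel_on S K" and xz: "x \<in> S" "z \<in> S"
  shows "K x z \<le> (K x x + K z z) / 2"
proof -
  have "0 \<le> (\<Sum>i<2. \<Sum>j<2. (if i = 0 then 1 else -1) * (if j = 0 then 1 else -1) *
      K (if i = (0::nat) then x else z) (if j = (0::nat) then x else z))"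
    using K xz unfolding psd_kernel_on_def by (elim conjE allE[of _ 2] allE) (erule mp, auto)
  also have "\<dots> = K x x - K x z - K z x + K z z" by (simp add: numeral_2_eq_2)
  also have "K z x = K x z" using K xz by (simp add: psd_kernel_on_def)
  finally show ?thesis by simp
qed

lemma theta_feasible_integral_le:
  assumes "theta_feasible G (K :: 'a::euclidean_space \<Rightarrow> 'a \<Rightarrow> real)"
  shows "(\<integral>\<^sub>S x. (\<integral>\<^sub>S z. K x z)) \<le> measure surface_measure (sphere (0::'a) 1)"
proof -
  let ?s = "measure surface_measure (sphere (0::'a) 1)"
  have K: "continuous_kernel K" "psd_kernel_on (sphere 0 1) K"
     "(\<integral>\<^sub>S x. K x x) = 1"
    using assms by (auto simp: theta_feasible_def)
  have diag: "continuous_on (sphere 0 1) (\<lambda>x. K x x)"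
  proof -
    have "continuous_on (sphere 0 1) (\<lambda>x. case (x, x) of (x, y) \<Rightarrow> K x y)"
      by (rule continuous_on_compose2[OF K(1)]) (auto intro!: continuous_intros)
    then show ?thesis by simp
  qed
  have c1: "continuous_on (sphere 0 1 \<times> sphere 0 1) (\<lambda>(x::'a, y::'a). K x x)"
    unfolding case_prod_beta by (rule continuous_on_compose2[OF diag]) (auto intro!: continuous_intros)
  have c2: "continuous_on (sphere 0 1 \<times> sphere 0 1) (\<lambda>(x::'a, y::'a). K y y)"
    unfolding case_prod_beta by (rule continuous_on_compose2[OF diag]) (auto intro!: continuous_intros)
  have "continuous_on (sphere 0 1 \<times> sphere 0 1) (\<lambda>(x::'a, y::'a). (K x x + K y y) / 2)"
    using c1 c2 unfolding case_prod_beta by (intro continuous_intros) auto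
  then have "(\<integral>\<^sub>S x. (\<integral>\<^sub>S z. K x z))
      \<le> (\<integral>\<^sub>S x. (\<integral>\<^sub>S z. (K x x + K z z) / 2))"
    using psd_le_diagonal[OF K(2)] by (intro double_integral_mono K(1)) auto
  also have "\<dots> = (\<integral>\<^sub>S x. (K x x * ?s + 1) / 2)"
    using K(3) diag by (intro integral_surface_cong) (simp add: integral_surface_add)
  also have "\<dots> = ?s"
    using K(3) diag by (simp add: integral_surface_add continuous_intros)
  finally show ?thesis .
qed

lemma bdd_above_theta_values:
  "bdd_above {(\<integral>\<^sub>S x. (\<integral>\<^sub>S z. K x z)) | K :: 'a::euclidean_space \<Rightarrow> 'a \<Rightarrow> real. theta_feasible G K}"
  using theta_feasible_integral_le by (intro bdd_aboveI[of _ "measure surface_measure (sphere (0::'a) 1)"]) blast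

context zonal
begin

text \<open>
  The kernel is the affine function of \<open>P\<^sub>k(x \<bullet> z)\<close> that vanishes on the edges and has trace \<open>1\<close>. Only its constant
  part contributes to the double integral.
\<close>

lemma feasible_gegenbauer:
  assumes neg: "P k u \<le> 0" and k: "k \<ge> 1"
  defines "m \<equiv> P k u"
  shows "\<exists>K. theta_feasible (sphere_distance_graph u :: 'a rel) K \<and>
    (\<integral>\<^sub>S x. (\<integral>\<^sub>S z. K x z)) = \<sigma> * (- m / (1 - m))"
proof -
  define K :: "'a \<Rightarrow> 'a \<Rightarrow> real" where "K x z = (- m + P k (x \<bullet> z)) / (\<sigma> * (1 - m))" for x z
  have m: "m \<le> 0" using neg by (simp add: m_def)
  have pos: "\<sigma> * (1 - m) > 0" using sigma_pos m by (intro mult_pos_pos) auto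
  have "theta_feasible (sphere_distance_graph u :: 'a rel) K"
    unfolding theta_feasible_def
  proof (intro conjI)
    show "continuous_kernel K"
      unfolding K_def by (rule continuous_zonal) (use pos in \<open>auto intro!: continuous_intros\<close>)
    show "psd_kernel_on (sphere 0 1) K"
      unfolding psd_kernel_on_def
    proof (intro conjI ballI allI impI)
      show "K x y = K y x" for x y by (simp add: K_def inner_commute)
      fix N :: nat and x :: "nat \<Rightarrow> 'a" and c :: "nat \<Rightarrow> real" assume x: "\<forall>i<N. x i \<in> sphere 0 1"
      have "(\<Sum>i<N. \<Sum>j<N. c i * c j * K (x i) (x j))
          = ((\<Sum>i<N. \<Sum>j<N. c i * c j * P k (x i \<bullet> x j)) + - m * (\<Sum>i<N. \<Sum>j<N. c i * c j)) / (\<sigma> * (1 - m))"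
        unfolding K_def sum_distrib_left sum.distrib[symmetric] sum_divide_distrib
        by (intro sum.cong refl) (simp add: algebra_simps)
      also have "(\<Sum>i<N. \<Sum>j<N. c i * c j) = (\<Sum>i<N. c i)\<^sup>2"
        by (simp add: sum_distrib_left[symmetric] sum_distrib_right[symmetric] power2_eq_square)
      finally have eq: "(\<Sum>i<N. \<Sum>j<N. c i * c j * K (x i) (x j))
          = ((\<Sum>i<N. \<Sum>j<N. c i * c j * P k (x i \<bullet> x j)) + - m * (\<Sum>i<N. c i)\<^sup>2) / (\<sigma> * (1 - m))" .
      have "0 \<le> (\<Sum>i<N. \<Sum>j<N. c i * c j * P k (x i \<bullet> x j))"
        using psd_gegenbauer[of k] x unfolding psd_kernel_on_def by blast
      then show "0 \<le> (\<Sum>i<N. \<Sum>j<N. c i * c j * K (x i) (x j))"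
        unfolding eq using m by (intro divide_nonneg_pos add_nonneg_nonneg mult_nonneg_nonneg pos) auto
    qed
    have "(\<integral>\<^sub>S x. K x x) = (\<integral>x. 1 / \<sigma> \<partial>(surface_measure :: 'a measure))"
      using m sigma_pos by (intro integral_surface_cong) (simp add: K_def dot_square_norm P_at_1 field_simps)
    also have "\<dots> = 1" using sigma_pos by (simp add: sigma_eq)
    finally show "(\<integral>\<^sub>S x. K x x) = 1" .
    show "\<forall>(x, y)\<in>sphere_distance_graph u. K x y = 0"
      by (auto simp: sphere_distance_graph_def K_def m_def)
  qed
  moreover have "(\<integral>\<^sub>S x. (\<integral>\<^sub>S z. K x z)) = \<sigma> * (- m / (1 - m))"
  proof -
    have "(\<integral>\<^sub>S z. K x z) = - m / (1 - m)" if x: "norm x = 1" for x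
    proof -
      have "(\<integral>\<^sub>S z. K x z) = (\<integral>\<^sub>S z. 1 / (\<sigma> * (1 - m)) * (- m + P k (x \<bullet> z)))"
        by (simp only: K_def times_divide_eq_left mult_1)
      also have "\<dots> = J (\<lambda>s. 1 / (\<sigma> * (1 - m)) * (- m + P k s))"
        by (rule J_eq[of "\<lambda>s. 1 / (\<sigma> * (1 - m)) * (- m + P k s)", OF _ x]) (intro continuous_intros)
      also have "\<dots> = 1 / (\<sigma> * (1 - m)) * (- m * \<sigma> + E (Q k))"
        unfolding J_cmult by (subst J_add) (auto intro!: continuous_intros simp: J_const[of "- m"])
      finally show ?thesis using E_gegenbauer[OF k] sigma_pos m by simp
    qed
    then have "(\<integral>\<^sub>S x. (\<integral>\<^sub>S z. K x z)) = (\<integral>x. - m / (1 - m) \<partial>(surface_measure :: 'a measure))"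
      by (intro integral_surface_cong) auto
    then show ?thesis by (simp add: sigma_eq)
  qed
  ultimately show ?thesis by blast
qed

lemma theta_number_ge:
  assumes "P k u \<le> 0" "k \<ge> 1"
  shows "\<sigma> * (- P k u / (1 - P k u)) \<le> theta_number (sphere_distance_graph u :: 'a rel)"
proof -
  obtain K :: "'a \<Rightarrow> 'a \<Rightarrow> real" where K: "theta_feasible (sphere_distance_graph u :: 'a rel) K"
    "(\<integral>\<^sub>S x. (\<integral>\<^sub>S z. K x z)) = \<sigma> * (- P k u / (1 - P k u))"
    using feasible_gegenbauer[OF assms] by blast
  show ?thesis unfolding theta_number_def K(2)[symmetric]
    by (rule cSup_upper[OF _ bdd_above_theta_values]) (use K(1) in blast)
qed

text \<open>
  Choose \<open>\<Phi>\<close> in \<open>hoffman_bound\<close> as a narrow tent at \<open>t\<close>. Its Gegenbauer coefficients are means of values of \<open>P\<^sub>k\<close> on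
  \<open>(t0, 1)\<close>, hence at least \<open>m\<close>; and \<open>\<Lambda> K \<Phi>\<close> is small because \<open>K\<close> vanishes on the edges.
\<close>

lemma feasible_value_le:
  assumes t: "0 \<le> t0" "t0 < t" "t < 1" and m: "m < 1" "\<And>s k. t0 < s \<Longrightarrow> s < 1 \<Longrightarrow> m \<le> P k s"
    and feasible: "theta_feasible (sphere_distance_graph t :: 'a rel) K"
  shows "(\<integral>\<^sub>S x. (\<integral>\<^sub>S z. K x z)) \<le> \<sigma> * (- m / (1 - m))"
proof -
  let ?I = "\<integral>\<^sub>S x. (\<integral>\<^sub>S z. K x z)"
  have K: "continuous_kernel K" "psd_kernel_on (sphere 0 1) K"
     "(\<integral>\<^sub>S x. K x x) = 1"
    and edge: "\<And>x y. norm x = 1 \<Longrightarrow> norm y = 1 \<Longrightarrow> x \<bullet> y = t \<Longrightarrow> K x y = 0"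
    using feasible by (auto simp: theta_feasible_def sphere_distance_graph_def)
  have "m + (1 - m) / \<sigma> * ?I \<le> 0"
  proof (rule field_le_epsilon)
    fix \<epsilon>' :: real assume "\<epsilon>' > 0"
    define \<epsilon> where "\<epsilon> = \<epsilon>' / \<sigma>"
    have \<epsilon>: "\<epsilon> > 0" "\<epsilon> * \<sigma> = \<epsilon>'" using \<open>\<epsilon>' > 0\<close> sigma_pos by (auto simp: \<epsilon>_def)
    let ?SS = "sphere (0::'a) 1 \<times> sphere (0::'a) 1"
    \<comment> \<open>By compactness the pairs with a large entry have inner products bounded away from \<open>t\<close>.\<close>
    define B where "B = {v \<in> ?SS. \<epsilon> \<le> (case v of (x, y) \<Rightarrow> K x y)}"
    have SS: "compact ?SS" by (intro compact_Times) auto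
    have "closed B" unfolding B_def
      by (intro continuous_on_closed_Collect_le continuous_intros K(1) compact_imp_closed SS)
    then have "compact B" using SS closed_Int_compact[of B ?SS] by (simp add: B_def Int_absorb2)
    then have "compact ((\<lambda>(x, y). x \<bullet> y) ` B)"
      by (intro compact_continuous_image) (auto simp: case_prod_beta intro!: continuous_intros)
    then have "open (- ((\<lambda>(x, y). x \<bullet> y) ` B))" by (intro open_Compl compact_imp_closed)
    moreover have "t \<in> - ((\<lambda>(x, y). x \<bullet> y) ` B)" using edge \<epsilon> by (force simp: B_def)
    ultimately obtain \<eta> where \<eta>: "\<eta> > 0" "ball t \<eta> \<subseteq> - ((\<lambda>(x, y). x \<bullet> y) ` B)" by (meson openE)
    define h where "h = min \<eta> (min (t - t0) (1 - t))"
    have h: "h > 0" "h \<le> \<eta>" "h \<le> t - t0" "h \<le> 1 - t" using \<eta> t by (auto simp: h_def)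
    define \<Phi>0 where "\<Phi>0 s = max 0 (h - \<bar>s - t\<bar>)" for s
    have c0: "continuous_on UNIV \<Phi>0" unfolding \<Phi>0_def by (intro continuous_intros)
    obtain y where y: "norm y = 1" "e \<bullet> y = t" using point_with_inner_product[of t] t by auto
    have J0: "J \<Phi>0 > 0"
      unfolding J_def using y h
      by (intro integral_surface_pos[of _ y] continuous_zonal_slice c0) (auto simp: \<Phi>0_def)
    define \<Phi> where "\<Phi> s = 1 / J \<Phi>0 * \<Phi>0 s" for s
    have c: "continuous_on UNIV \<Phi>" unfolding \<Phi>_def by (intro continuous_intros c0)
    have \<Phi>J: "J \<Phi> = 1" unfolding \<Phi>_def J_cmult using J0 by simp
    have \<Phi>pos: "\<Phi> s \<ge> 0" for s using J0 by (simp add: \<Phi>_def \<Phi>0_def)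
    have supp: "\<bar>s - t\<bar> < h" if "\<Phi> s \<noteq> 0" for s using that by (auto simp: \<Phi>_def \<Phi>0_def)
    have "m \<le> J (\<lambda>s. \<Phi> s * P k s)" for k
    proof -
      have "m = J (\<lambda>s. m * \<Phi> s)" by (simp add: J_cmult \<Phi>J)
      also have "\<dots> \<le> J (\<lambda>s. \<Phi> s * P k s)"
      proof (rule J_mono)
        show "m * \<Phi> s \<le> \<Phi> s * P k s" for s
        proof (cases "\<Phi> s = 0")
          case False
          then have "t0 < s" "s < 1" using supp[OF False] h by auto
          then show ?thesis using m(2)[of s k] \<Phi>pos[of s] by (simp add: mult.commute[of m] mult_left_mono)
        qed simp
      qed (intro continuous_intros c)+
      finally show ?thesis .
    qed
    then have "m * 1 + (1 - m) / \<sigma> * ?I \<le> \<Lambda> K \<Phi>"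
      using hoffman_bound[OF K(1,2) c \<Phi>J \<Phi>pos, of m] K(3) by simp
    also have "\<Lambda> K \<Phi> \<le> (\<integral>\<^sub>S x. (\<integral>z. \<epsilon> * \<Phi> (x \<bullet> z) \<partial>(surface_measure :: 'a measure)))"
      unfolding \<Lambda>_def
    proof (rule double_integral_mono)
      fix x z :: 'a assume xz: "norm x = 1" "norm z = 1"
      show "K x z * \<Phi> (x \<bullet> z) \<le> \<epsilon> * \<Phi> (x \<bullet> z)"
      proof (cases "\<Phi> (x \<bullet> z) = 0")
        case False
        then have "x \<bullet> z \<in> ball t \<eta>" using supp[OF False] h by (simp add: dist_real_def abs_minus_commute)
        then have "x \<bullet> z \<notin> (\<lambda>(x, y). x \<bullet> y) ` B" using \<eta>(2) by auto
        then have "(x, z) \<notin> B" by (auto simp: image_iff)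
        then have "K x z \<le> \<epsilon>" using xz by (auto simp: B_def)
        then show ?thesis using \<Phi>pos by (intro mult_right_mono)
      qed simp
    qed (intro continuous_kernel_mult K(1) continuous_zonal c continuous_intros)+
    also have "\<dots> = (\<integral>x. \<epsilon> \<partial>(surface_measure :: 'a measure))"
      using J_eq[OF c] \<Phi>J by (intro integral_surface_cong) simp
    also have "\<dots> = \<epsilon>'" using \<epsilon>(2) by (simp add: sigma_eq mult.commute)
    finally show "m + (1 - m) / \<sigma> * ?I \<le> 0 + \<epsilon>'" by simp
  qed
  then show ?thesis using sigma_pos m(1) by (simp add: field_simps)
qed

end

theorem corollary3p1:
  assumes "CARD('n::finite) \<ge> 4"
  shows "\<exists>L::real.
           ((\<lambda>t. theta_number (sphere_distance_graph t :: (real ^ 'n) rel)) \<longlongrightarrow> L) (at_left 1) \<and>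
           (\<forall>u::real. -1 \<le> u \<and> u < 1 \<longrightarrow>
              L \<le> theta_number (sphere_distance_graph u :: (real ^ 'n) rel))"
proof -
  obtain e :: "real ^ 'n" where e: "norm e = 1" by (metis norm_Basis SOME_Basis)
  interpret zonal "real CARD('n) - 2" e
    by unfold_locales (use assms e in auto)
  let ?\<theta> = "\<lambda>t. theta_number (sphere_distance_graph t :: (real ^ 'n) rel)"
  obtain j where j: "j \<le> 0" "\<And>u. -1 \<le> u \<Longrightarrow> u < 1 \<Longrightarrow> \<exists>k\<ge>1. P k u \<le> j"
    "\<And>\<epsilon>. \<epsilon> > 0 \<Longrightarrow> \<exists>t0<1. \<forall>t l. t0 < t \<and> t < 1 \<longrightarrow> j - \<epsilon> \<le> P l t"
    by (rule minimum_over_degrees[OF that])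
  \<comment> \<open>The value of the theta number for the smallest polynomial value \<open>m\<close>; it decreases with \<open>m\<close>.\<close>
  define f where "f m = \<sigma> * (- m / (1 - m))" for m
  have lower: "f j \<le> ?\<theta> u" if u: "-1 \<le> u" "u < 1" for u
  proof -
    obtain k where k: "k \<ge> 1" "P k u \<le> j" using j(2)[OF u] by blast
    have "- j / (1 - j) \<le> - P k u / (1 - P k u)" using k j(1) by (simp add: field_simps)
    then have "f j \<le> f (P k u)" unfolding f_def using sigma_pos by (intro mult_left_mono) auto
    also have "\<dots> \<le> ?\<theta> u" unfolding f_def using k j(1) by (intro theta_number_ge) auto
    finally show ?thesis .
  qed
  have "(?\<theta> \<longlongrightarrow> f j) (at_left 1)"
  proof (rule order_tendstoI)
    fix a assume "a < f j"
    then have "a < ?\<theta> t" if "-1 < t" "t < 1" for t using lower[of t] that by simp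
    then show "eventually (\<lambda>t. a < ?\<theta> t) (at_left 1)"
      unfolding eventually_at_left[of "-1::real" 1, simplified] by (intro exI[of _ "-1"]) auto
  next
    fix a assume a: "f j < a"
    have "((\<lambda>\<epsilon>. f (j - \<epsilon>)) \<longlongrightarrow> f (j - 0)) (at_right 0)"
      unfolding f_def using j(1) by (intro tendsto_intros) auto
    then have "eventually (\<lambda>\<epsilon>. f (j - \<epsilon>) < a) (at_right 0)"
      using a by (intro order_tendstoD(2)) auto
    then obtain b where "b > 0" "\<And>\<epsilon>. 0 < \<epsilon> \<Longrightarrow> \<epsilon> < b \<Longrightarrow> f (j - \<epsilon>) < a"
      unfolding eventually_at_right[OF zero_less_one] by auto
    then obtain \<epsilon> where \<epsilon>: "\<epsilon> > 0" "f (j - \<epsilon>) < a" by (metis dense)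
    obtain t0 where t0: "t0 < 1" "\<And>t l. t0 < t \<Longrightarrow> t < 1 \<Longrightarrow> j - \<epsilon> \<le> P l t" using j(3)[OF \<epsilon>(1)] by blast
    have "?\<theta> t < a" if t: "max t0 0 < t" "t < 1" for t
    proof -
      obtain k where k: "k \<ge> 1" "P k t \<le> j" using j(2)[of t] t by auto
      obtain K where K: "theta_feasible (sphere_distance_graph t :: (real ^ 'n) rel) K"
        using feasible_gegenbauer[of k t] k j(1) by auto
      have "?\<theta> t \<le> f (j - \<epsilon>)"
        unfolding theta_number_def
      proof (rule cSup_least)
        show "{(\<integral>\<^sub>S x. (\<integral>\<^sub>S y. K x y)) | K. theta_feasible (sphere_distance_graph t :: (real ^ 'n) rel) K} \<noteq> {}"
          using K by blast
        fix v assume "v \<in> {(\<integral>\<^sub>S x. (\<integral>\<^sub>S y. K x y)) | K. theta_feasible (sphere_distance_graph t :: (real ^ 'n) rel) K}"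
        then show "v \<le> f (j - \<epsilon>)"
          unfolding f_def using feasible_value_le[of "max t0 0" t "j - \<epsilon>"] t t0 j(1) \<epsilon>(1) by auto
      qed
      with \<epsilon>(2) show ?thesis by simp
    qed
    then show "eventually (\<lambda>t. ?\<theta> t < a) (at_left 1)"
      unfolding eventually_at_left[of "-1::real" 1, simplified] using t0(1) by (intro exI[of _ "max t0 0"]) auto
  qed
  then show ?thesis using lower by blast
qed

end
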